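(* Let $k$ be a field of characteristic $0$ and $R=k[[X_1,\dots,X_n]]$. Let $B$ be the integral closure of $R$ in an algebraic field extension of $Q(R)$ such that $B$ contains an element $y$ with $y^2=X_i$ for some $i$, $1\le i\le n$. Let $\underline X$ denote the ideal of $R$ generated by $X_1,\dots,\widehat{X_i},\dots,X_n$ (with $X_i$ omitted). Then $H^{n-1}_{\underline X}(\Omega_{B/R})\neq 0$.
   Context: $Q(R)$ is the field of fractions of $R$. $\Omega_{B/R}$ is the module of Kähler differentials of $B$ over $R$ (not completed). $H^j_{\underline X}(-)$ denotes local cohomology with respect to the ideal $\underline X$. *)

theory Defs
  imports
    "HOL-Library.Cardinality"
    "HOL-Algebra.Ideal_Product"
    "HOL-Algebra.QuotRing"
    "HOL-Algebra.Module"
    "HOL-Algebra.Algebraic_Closure_Type"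
begin

section \<open>The ring of formal power series in finitely many variables\<close>

text \<open>
  \<open>('n, 'k) mps\<close> is \<open>k[[X\<^sub>i : i \<in> 'n]]\<close>; an exponent vector is a function \<open>'n \<Rightarrow> nat\<close>.
\<close>

typedef ('n, 'k) mps = "UNIV :: (('n \<Rightarrow> nat) \<Rightarrow> 'k) set"
  morphisms mps_nth Abs_mps ..

setup_lifting type_definition_mps

lemma mps_eqI: "(\<And>m. mps_nth f m = mps_nth g m) \<Longrightarrow> f = g"
  by (simp add: mps_nth_inject[symmetric] ext)

definition add_pairs :: "('n \<Rightarrow> nat) \<Rightarrow> (('n \<Rightarrow> nat) \<times> ('n \<Rightarrow> nat)) set" where
  "add_pairs m = {(a, b). \<forall>i. a i + b i = m i}"

lemma finite_add_pairs [simp]: "finite (add_pairs (m :: 'n::finite \<Rightarrow> nat))"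
proof -
  let ?A = "{a. \<forall>i. a i \<in> {..m i}}"
  have "finite (Pi\<^sub>E UNIV (\<lambda>i. {..m i}))" by (intro finite_PiE) auto
  moreover have "Pi\<^sub>E UNIV (\<lambda>i. {..m i}) = ?A" by (auto simp: PiE_def Pi_def extensional_def)
  ultimately have fin: "finite ?A" by simp
  have "add_pairs m \<subseteq> ?A \<times> ?A"
    unfolding add_pairs_def by clarsimp (metis le_add1 le_add2)
  then show ?thesis using fin finite_subset by blast
qed

instantiation mps :: (finite, comm_ring_1) comm_ring_1
begin

lift_definition zero_mps :: "('a, 'b) mps" is "\<lambda>m. 0" .
lift_definition one_mps :: "('a, 'b) mps" is "\<lambda>m. if m = (\<lambda>_. 0) then 1 else 0" .
lift_definition plus_mps :: "('a, 'b) mps \<Rightarrow> ('a, 'b) mps \<Rightarrow> ('a, 'b) mps"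
  is "\<lambda>f g m. f m + g m" .
lift_definition minus_mps :: "('a, 'b) mps \<Rightarrow> ('a, 'b) mps \<Rightarrow> ('a, 'b) mps"
  is "\<lambda>f g m. f m - g m" .
lift_definition uminus_mps :: "('a, 'b) mps \<Rightarrow> ('a, 'b) mps"
  is "\<lambda>f m. - f m" .
lift_definition times_mps :: "('a, 'b) mps \<Rightarrow> ('a, 'b) mps \<Rightarrow> ('a, 'b) mps"
  is "\<lambda>f g m. \<Sum>(a, b)\<in>add_pairs m. f a * g b" .

instance
proof
  fix f g h :: "('a, 'b) mps"
  show "f + g + h = f + (g + h)" by transfer (simp add: add.assoc)
  show "f + g = g + f" by transfer (simp add: add.commute)
  show "0 + f = f" by transfer simp
  show "- f + f = 0" by transfer simp
  show "f - g = f + - g" by transfer simp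
  show "(0::('a, 'b) mps) \<noteq> 1" by transfer (metis zero_neq_one)
  show "f * g = g * f"
  proof (transfer, rule ext)
    fix f g :: "('a \<Rightarrow> nat) \<Rightarrow> 'b" and m
    show "(\<Sum>(a, b)\<in>add_pairs m. f a * g b) = (\<Sum>(a, b)\<in>add_pairs m. g a * f b)"
      by (rule sum.reindex_bij_witness[of _ prod.swap prod.swap])
        (auto simp: add_pairs_def add.commute mult.commute)
  qed
  show "(f + g) * h = f * h + g * h"
    by transfer (auto simp: sum.distrib[symmetric] case_prod_unfold distrib_right)
  show "1 * f = f"
  proof (transfer, rule ext)
    fix f :: "('a \<Rightarrow> nat) \<Rightarrow> 'b" and m
    have "(\<Sum>(a, b)\<in>add_pairs m. (if a = (\<lambda>_. 0) then 1 else 0) * f b)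
        = (\<Sum>(a, b)\<in>{(\<lambda>_ :: 'a. 0 :: nat, m)}. (if a = (\<lambda>_. 0) then 1 else 0) * f b)"
    proof (rule sum.mono_neutral_right[OF finite_add_pairs])
      show "{(\<lambda>_ :: 'a. 0 :: nat, m)} \<subseteq> add_pairs m" by (simp add: add_pairs_def)
      have "b = m" if "((\<lambda>_. 0), b) \<in> add_pairs m" for b
        using that by (simp add: add_pairs_def fun_eq_iff)
      then show "\<forall>p\<in>add_pairs m - {(\<lambda>_ :: 'a. 0 :: nat, m)}.
          (case p of (a, b) \<Rightarrow> (if a = (\<lambda>_. 0) then 1 else 0) * f b) = 0"
        by (auto split: if_splits)
    qed
    then show "(\<Sum>(a, b)\<in>add_pairs m. (if a = (\<lambda>_. 0) then 1 else 0) * f b) = f m" by simp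
  qed
  show "f * g * h = f * (g * h)"
  proof (transfer, rule ext)
    fix f g h :: "('a \<Rightarrow> nat) \<Rightarrow> 'b" and m
    have "(\<Sum>(a, b)\<in>add_pairs m. (\<Sum>(c, d)\<in>add_pairs a. f c * g d) * h b)
        = (\<Sum>(p, q)\<in>Sigma (add_pairs m) (\<lambda>p. add_pairs (fst p)). f (fst q) * g (snd q) * h (snd p))"
      by (simp add: sum.Sigma sum_distrib_right case_prod_unfold)
    also have "\<dots> = (\<Sum>(p, q)\<in>Sigma (add_pairs m) (\<lambda>p. add_pairs (snd p)).
                        f (fst p) * (g (fst q) * h (snd q)))"
      by (rule sum.reindex_bij_witness[of _
            "\<lambda>((a, b), (c, d)). ((\<lambda>i. a i + c i, d), (a, c))"
            "\<lambda>((a, b), (c, d)). ((c, \<lambda>i. d i + b i), (d, b))"])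
        (auto simp: add_pairs_def fun_eq_iff mult.assoc, (metis add.assoc)+)
    also have "\<dots> = (\<Sum>(a, b)\<in>add_pairs m. f a * (\<Sum>(c, d)\<in>add_pairs b. g c * h d))"
      by (simp add: sum.Sigma sum_distrib_left case_prod_unfold)
    finally show "(\<Sum>(a, b)\<in>add_pairs m. (\<Sum>(c, d)\<in>add_pairs a. f c * g d) * h b)
        = (\<Sum>(a, b)\<in>add_pairs m. f a * (\<Sum>(c, d)\<in>add_pairs b. g c * h d))" .
  qed
qed

end

lemma mps_nth_times:
  "mps_nth (f * g) m = (\<Sum>(a, b)\<in>add_pairs m. mps_nth f a * mps_nth g b)"
  by transfer simp

lemma exists_lex_min:
  fixes S :: "('n \<Rightarrow> nat) set" and e :: "'n \<Rightarrow> nat"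
  assumes "inj e" "S \<noteq> {}"
  shows "\<exists>a\<in>S. \<forall>b\<in>S. (\<forall>j. e j < N \<longrightarrow> a j = b j) \<or>
           (\<exists>i. a i < b i \<and> (\<forall>j. e j < e i \<longrightarrow> a j = b j))"
proof (induction N)
  case 0
  then show ?case using assms by auto
next
  case (Suc N)
  then obtain a where a: "a \<in> S" and amin: "\<And>b. b \<in> S \<Longrightarrow> (\<forall>j. e j < N \<longrightarrow> a j = b j) \<or>
           (\<exists>i. a i < b i \<and> (\<forall>j. e j < e i \<longrightarrow> a j = b j))" by blast
  show ?case
  proof (cases "\<exists>v. e v = N")
    case False
    then have "e j < Suc N \<longleftrightarrow> e j < N" for j by (metis less_Suc_eq)
    with a amin show ?thesis by auto
  next
    case True
    then obtain v where v: "e v = N" ..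
    have ev: "e j < Suc N \<longleftrightarrow> e j < N \<or> j = v" for j
      using v assms(1) by (auto simp: less_Suc_eq inj_def)
    let ?T = "{b \<in> S. \<forall>j. e j < N \<longrightarrow> a j = b j}"
    obtain c where c: "c \<in> ?T" and cmin: "\<And>b. b \<in> ?T \<Longrightarrow> c v \<le> b v"
      using ex_has_least_nat[of "\<lambda>b. b \<in> ?T" a "\<lambda>b. b v"] a by blast
    have "(\<forall>j. e j < Suc N \<longrightarrow> c j = b j) \<or> (\<exists>i. c i < b i \<and> (\<forall>j. e j < e i \<longrightarrow> c j = b j))"
      if b: "b \<in> S" for b
    proof (cases "b \<in> ?T")
      case True
      then show ?thesis using c cmin[OF True] v ev by (cases "c v = b v") force+
    next
      case False
      then obtain i where i: "a i < b i" "\<forall>j. e j < e i \<longrightarrow> a j = b j" using amin[OF b] b by auto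
      obtain j where j: "e j < N" "a j \<noteq> b j" using False b by auto
      with i have "e i < N" by (metis linorder_not_less order.strict_trans1)
      with c i show ?thesis by (intro disjI2 exI[of _ i]) auto
    qed
    with c show ?thesis by blast
  qed
qed

lemma mps_exists_leading:
  fixes e :: "'n::finite \<Rightarrow> nat"
  assumes "inj e" "f \<noteq> (0 :: ('n, 'k::comm_ring_1) mps)"
  obtains a where "mps_nth f a \<noteq> 0"
    "\<And>b. mps_nth f b \<noteq> 0 \<Longrightarrow> a \<noteq> b \<Longrightarrow> \<exists>i. a i < b i \<and> (\<forall>j. e j < e i \<longrightarrow> a j = b j)"
proof -
  have "{a. mps_nth f a \<noteq> 0} \<noteq> {}"
    using assms(2) by (auto intro!: mps_eqI simp: zero_mps.rep_eq)
  moreover obtain N where N: "\<And>j. e j < N"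
    using finite_nat_set_iff_bounded[of "range e"] by auto
  ultimately obtain a where "mps_nth f a \<noteq> 0" and "\<forall>b\<in>{a. mps_nth f a \<noteq> 0}. (\<forall>j. e j < N \<longrightarrow> a j = b j) \<or>
           (\<exists>i. a i < b i \<and> (\<forall>j. e j < e i \<longrightarrow> a j = b j))"
    using exists_lex_min[OF assms(1), of "{a. mps_nth f a \<noteq> 0}" N] by blast
  with N show ?thesis by (intro that[of a]) (auto simp: fun_eq_iff)
qed

instance mps :: (finite, idom) idom
proof
  fix f g :: "('a, 'b) mps"
  assume "f \<noteq> 0" "g \<noteq> 0"
  obtain e :: "'a \<Rightarrow> nat" where e: "inj e"
    using finite_imp_inj_to_nat_seg[of "UNIV :: 'a set"] by auto
  let ?less = "\<lambda>a b :: 'a \<Rightarrow> nat. \<exists>i. a i < b i \<and> (\<forall>j. e j < e i \<longrightarrow> a j = b j)"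
  obtain a where a: "mps_nth f a \<noteq> 0" "\<And>b. mps_nth f b \<noteq> 0 \<Longrightarrow> a \<noteq> b \<Longrightarrow> ?less a b"
    using mps_exists_leading[OF e \<open>f \<noteq> 0\<close>] by metis
  obtain b where b: "mps_nth g b \<noteq> 0" "\<And>c. mps_nth g c \<noteq> 0 \<Longrightarrow> b \<noteq> c \<Longrightarrow> ?less b c"
    using mps_exists_leading[OF e \<open>g \<noteq> 0\<close>] by metis
  let ?m = "\<lambda>i. a i + b i"
  have pairs: "mps_nth f c * mps_nth g d = 0" if cd: "(c, d) \<in> add_pairs ?m" "(c, d) \<noteq> (a, b)" for c d
  proof (rule ccontr)
    assume nz: "mps_nth f c * mps_nth g d \<noteq> 0"
    have s: "c i + d i = a i + b i" for i using cd by (auto simp: add_pairs_def)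
    have "a \<noteq> c"
    proof
      assume "a = c"
      then have "b = d" using s by (simp add: fun_eq_iff)
      with \<open>a = c\<close> cd show False by simp
    qed
    have "b \<noteq> d"
    proof
      assume "b = d"
      then have "a = c" using s by (simp add: fun_eq_iff)
      with \<open>a \<noteq> c\<close> show False by simp
    qed
    obtain i where i: "a i < c i" "\<forall>j. e j < e i \<longrightarrow> a j = c j" using a(2) nz \<open>a \<noteq> c\<close> by force
    obtain k where k: "b k < d k" "\<forall>j. e j < e k \<longrightarrow> b j = d j" using b(2) nz \<open>b \<noteq> d\<close> by force
    have "e i < e k \<or> e k < e i \<or> i = k" using e by (metis inj_def linorder_neqE_nat)
    then show False
    proof (elim disjE)
      assume "e i < e k"
      then have "b i = d i" using k(2) by simp
      then show False using i(1) s[of i] by simp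
    next
      assume "e k < e i"
      then have "a k = c k" using i(2) by simp
      then show False using k(1) s[of k] by simp
    next
      assume "i = k"
      then show False using i(1) k(1) s[of k] by simp
    qed
  qed
  have zero: "\<forall>p\<in>add_pairs ?m - {(a, b)}. (case p of (c, d) \<Rightarrow> mps_nth f c * mps_nth g d) = 0"
  proof
    fix p assume "p \<in> add_pairs ?m - {(a, b)}"
    then show "(case p of (c, d) \<Rightarrow> mps_nth f c * mps_nth g d) = 0"
      using pairs[of "fst p" "snd p"] by (simp add: case_prod_unfold)
  qed
  have "mps_nth (f * g) ?m = (\<Sum>(c, d)\<in>{(a, b)}. mps_nth f c * mps_nth g d)"
    unfolding mps_nth_times
    by (rule sum.mono_neutral_right[OF finite_add_pairs _ zero]) (simp add: add_pairs_def)
  also have "\<dots> \<noteq> 0" using a(1) b(1) by simp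
  finally show "f * g \<noteq> 0" by (metis zero_mps.rep_eq)
qed

lift_definition mps_var :: "'n \<Rightarrow> ('n, 'k::comm_ring_1) mps"
  is "\<lambda>i m. if m = (\<lambda>j. if j = i then 1 else 0) then 1 else 0" .


section \<open>Algebraic extensions and integral closure\<close>

text \<open>A field extension is given by its structure map.\<close>

definition algebraic_extension :: "('a::field \<Rightarrow> 'b::field) \<Rightarrow> bool" where
  "algebraic_extension h \<longleftrightarrow>
     h \<in> ring_hom ring_of_type_algebra ring_of_type_algebra \<and>
     (\<forall>x. \<exists>p. p \<noteq> 0 \<and> poly (map_poly h p) x = 0)"

definition integral_closure :: "('a::comm_ring_1 \<Rightarrow> 'b::comm_ring_1) \<Rightarrow> 'b set" where
  "integral_closure f = {b. \<exists>p. Polynomial.lead_coeff p = 1 \<and> poly (map_poly f p) b = 0}"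


section \<open>Modules\<close>

text \<open>
  The record type of modules in HOL-Algebra extends that of rings; its fields \<open>mult\<close> and \<open>one\<close>
  carry no information for a module and are left undefined.
\<close>

definition linear_maps ::
  "('a, 'p) ring_scheme \<Rightarrow> ('a, 'm, 'q) module_scheme \<Rightarrow> ('a, 'n, 's) module_scheme \<Rightarrow> ('m \<Rightarrow> 'n) set"
  where
  "linear_maps R M N =
    {f. f \<in> carrier M \<rightarrow> carrier N \<and>
        (\<forall>x\<in>carrier M. \<forall>y\<in>carrier M. f (x \<oplus>\<^bsub>M\<^esub> y) = f x \<oplus>\<^bsub>N\<^esub> f y) \<and>
        (\<forall>a\<in>carrier R. \<forall>x\<in>carrier M. f (a \<odot>\<^bsub>M\<^esub> x) = a \<odot>\<^bsub>N\<^esub> f x)}"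

definition submodule_generated ::
  "('a, 'p) ring_scheme \<Rightarrow> ('a, 'm, 'q) module_scheme \<Rightarrow> 'm set \<Rightarrow> 'm set" where
  "submodule_generated R M S = \<Inter>{N. submodule N R M \<and> S \<subseteq> N}"

definition quotient_module ::
  "('a, 'm, 'q) module_scheme \<Rightarrow> 'm set \<Rightarrow> ('a, 'm set) module" where
  "quotient_module M N =
    \<lparr>carrier = a_rcosets\<^bsub>M\<^esub> N, monoid.mult = undefined, one = undefined,
     ring.zero = N, add = set_add M, module.smult = (\<lambda>a C. \<Union>x\<in>C. N +>\<^bsub>M\<^esub> (a \<odot>\<^bsub>M\<^esub> x))\<rparr>"

definition free_module :: "('b, 'p) ring_scheme \<Rightarrow> 's set \<Rightarrow> ('b, 's \<Rightarrow> 'b) module" where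
  "free_module B S =
    \<lparr>carrier = {v. (\<forall>s\<in>S. v s \<in> carrier B) \<and> (\<forall>s. s \<notin> S \<longrightarrow> v s = \<zero>\<^bsub>B\<^esub>) \<and>
                   finite {s. v s \<noteq> \<zero>\<^bsub>B\<^esub>}},
     monoid.mult = undefined, one = undefined,
     zero = (\<lambda>s. \<zero>\<^bsub>B\<^esub>), add = (\<lambda>u v s. u s \<oplus>\<^bsub>B\<^esub> v s), module.smult = (\<lambda>b v s. b \<otimes>\<^bsub>B\<^esub> v s)\<rparr>"

definition free_basis :: "('b, 'p) ring_scheme \<Rightarrow> 's \<Rightarrow> 's \<Rightarrow> 'b" where
  "free_basis B s = (\<lambda>t. if t = s then \<one>\<^bsub>B\<^esub> else \<zero>\<^bsub>B\<^esub>)"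

definition restrict_scalars ::
  "('a \<Rightarrow> 'b) \<Rightarrow> ('b, 'm, 'q) module_scheme \<Rightarrow> ('a, 'm) module" where
  "restrict_scalars f M =
    \<lparr>carrier = carrier M, monoid.mult = undefined, one = undefined,
     zero = \<zero>\<^bsub>M\<^esub>, add = add M, module.smult = (\<lambda>a x. f a \<odot>\<^bsub>M\<^esub> x)\<rparr>"


section \<open>Kaehler differentials\<close>

text \<open>
  For a ring homomorphism \<open>f : A \<rightarrow> B\<close>, the module of differentials of \<open>B\<close> over \<open>A\<close> is the free
  \<open>B\<close>-module on symbols \<open>db\<close>, one for each \<open>b \<in> B\<close>, modulo additivity of \<open>d\<close>, the Leibniz rule,
  and \<open>d (f a) = 0\<close>.
\<close>

definition kaehler_relations ::
  "('a, 'p) ring_scheme \<Rightarrow> ('b, 'q) ring_scheme \<Rightarrow> ('a \<Rightarrow> 'b) \<Rightarrow> ('b \<Rightarrow> 'b) set" where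
  "kaehler_relations A B f =
    (let F = free_module B (carrier B); d = free_basis B in
       {d (b \<oplus>\<^bsub>B\<^esub> c) \<ominus>\<^bsub>F\<^esub> (d b \<oplus>\<^bsub>F\<^esub> d c) | b c. b \<in> carrier B \<and> c \<in> carrier B} \<union>
       {d (b \<otimes>\<^bsub>B\<^esub> c) \<ominus>\<^bsub>F\<^esub> (b \<odot>\<^bsub>F\<^esub> d c \<oplus>\<^bsub>F\<^esub> c \<odot>\<^bsub>F\<^esub> d b) | b c. b \<in> carrier B \<and> c \<in> carrier B} \<union>
       {d (f a) | a. a \<in> carrier A})"

definition kaehler_differentials ::
  "('a, 'p) ring_scheme \<Rightarrow> ('b, 'q) ring_scheme \<Rightarrow> ('a \<Rightarrow> 'b) \<Rightarrow> ('b, ('b \<Rightarrow> 'b) set) module" where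
  "kaehler_differentials A B f =
    quotient_module (free_module B (carrier B))
      (submodule_generated B (free_module B (carrier B)) (kaehler_relations A B f))"


section \<open>Local cohomology\<close>

text \<open>
  A definition can only quantify over test modules on a fixed type. By Baer's criterion the
  element type of the ring is large enough: it carries the ring itself and all its ideals.
\<close>

definition injective_module ::
  "('a, 'p) ring_scheme \<Rightarrow> ('a, 'e, 'q) module_scheme \<Rightarrow> bool" where
  "injective_module R E \<longleftrightarrow> module R E \<and>
    (\<forall>(M :: ('a, 'a) module) (N :: ('a, 'a) module). \<forall>i\<in>linear_maps R M N. \<forall>g\<in>linear_maps R M E.
       module R M \<and> module R N \<and> inj_on i (carrier M) \<longrightarrow>
       (\<exists>h\<in>linear_maps R N E. \<forall>x\<in>carrier M. h (i x) = g x))"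

definition injective_resolution ::
  "('a, 'p) ring_scheme \<Rightarrow> ('a, 'm, 'q) module_scheme \<Rightarrow>
   ('m \<Rightarrow> 'e) \<Rightarrow> (nat \<Rightarrow> ('a, 'e) module) \<Rightarrow> (nat \<Rightarrow> 'e \<Rightarrow> 'e) \<Rightarrow> bool" where
  "injective_resolution R M \<epsilon> E d \<longleftrightarrow>
    (\<forall>j. injective_module R (E j)) \<and>
    \<epsilon> \<in> linear_maps R M (E 0) \<and> inj_on \<epsilon> (carrier M) \<and>
    (\<forall>j. d j \<in> linear_maps R (E j) (E (Suc j))) \<and>
    \<epsilon> ` carrier M = a_kernel (E 0) (E 1) (d 0) \<and>
    (\<forall>j. d j ` carrier (E j) = a_kernel (E (Suc j)) (E (Suc (Suc j))) (d (Suc j)))"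

primrec ideal_power :: "('a, 'p) ring_scheme \<Rightarrow> 'a set \<Rightarrow> nat \<Rightarrow> 'a set" where
  "ideal_power R I 0 = carrier R"
| "ideal_power R I (Suc t) = I \<cdot>\<^bsub>R\<^esub> ideal_power R I t"

definition torsion_part ::
  "('a, 'p) ring_scheme \<Rightarrow> 'a set \<Rightarrow> ('a, 'm, 'q) module_scheme \<Rightarrow> 'm set" where
  "torsion_part R I M = {x \<in> carrier M. \<exists>t. \<forall>a\<in>ideal_power R I t. a \<odot>\<^bsub>M\<^esub> x = \<zero>\<^bsub>M\<^esub>}"

text \<open>
  The \<open>j\<close>-th right derived functor of the \<open>I\<close>-torsion functor, computed from an injective
  resolution \<open>E\<close> with differential \<open>d\<close> as the \<open>j\<close>-th cohomology of the complex of
  \<open>I\<close>-torsion parts. Up to isomorphism it depends only on the resolved module.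
\<close>

definition local_cohomology ::
  "('a, 'p) ring_scheme \<Rightarrow> 'a set \<Rightarrow> (nat \<Rightarrow> ('a, 'e) module) \<Rightarrow> (nat \<Rightarrow> 'e \<Rightarrow> 'e) \<Rightarrow> nat \<Rightarrow>
   ('a, 'e set) module" where
  "local_cohomology R I E d j =
    quotient_module
      ((E j)\<lparr>carrier := torsion_part R I (E j) \<inter> a_kernel (E j) (E (Suc j)) (d j)\<rparr>)
      (case j of 0 \<Rightarrow> {\<zero>\<^bsub>E 0\<^esub>} | Suc i \<Rightarrow> d i ` torsion_part R I (E i))"

end

theory Submission
  imports
    Defs
    "Jordan_Normal_Form.Char_Poly"
    "HOL-Computational_Algebra.Formal_Laurent_Series"
begin

text \<open>
  Write \<open>L\<close> for the field of fractions of \<open>B\<close> and \<open>\<partial>\<^sub>j\<close> for the extension of \<open>\<partial>/\<partial>X\<^sub>j\<close> to \<open>L\<close>. Let \<open>Y\<^sub>j\<close> be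
  algebraically independent over \<open>k\<close>, in a larger coefficient field \<open>k'\<close>. For \<open>b, c \<in> B\<close> the trace
  \<open>Tr(b \<Sum>\<^sub>j Y\<^sub>j \<partial>\<^sub>j c)\<close> is a power series over \<open>k'\<close>: on Puiseux expansions at a point of a hypersurface
  \<open>w = 0\<close>, along the transversal direction \<open>Y\<close>, the logarithmic derivative keeps orders nonnegative, so the
  trace has no pole along \<open>w\<close>. Hence \<open>b dc \<mapsto> Tr(y b \<Sum>\<^sub>j Y\<^sub>j \<partial>\<^sub>j c) mod X\<^sub>i\<close> is a well defined additive map on
  \<open>\<Omega>\<close>, linear over power series: it kills \<open>dR\<close>, because \<open>b y = 2 X\<^sub>i (b \<partial>\<^sub>i y)\<close> has trace divisible by \<open>X\<^sub>i\<close>.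
  It sends \<open>dy\<close> to a unit, and so \<open>(\<Prod>\<^sub>l X\<^sub>l)\<^sup>s dy\<close> never lies in \<open>\<Sum>\<^sub>l X\<^sub>l\<^sup>s\<^sup>+\<^sup>1 \<Omega>\<close>, where \<open>l\<close> runs over the
  indices other than \<open>i\<close>. This is the nonvanishing of the class of \<open>dy / \<Prod>\<^sub>l X\<^sub>l\<close> in the top local cohomology;
  it is carried up an injective resolution one variable at a time, alternately dividing by \<open>X\<^sub>l\<close> and applying
  the differential.
\<close>

text \<open>The extension may have infinite degree, so \<open>B\<close> carries no trace to
  \<open>R\<close>, and the traces from two finite subextensions differ by a degree factor. Hence no
  functional on \<open>\<Omega>\<close> is built as an object: \<open>negligible\<close> says that a
  form has only values divisible by \<open>X\<^sub>i\<close>, in every large enough simple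
  subextension. This property passes to sums and to \<open>B\<close>-multiples, hence to all
  relations of \<open>\<Omega>\<close>. Contraction with \<open>Y\<close> comes from the way poles
  are tested. On a germ along a line in direction \<open>Y\<close> only
  \<open>\<Sum>\<^sub>j Y\<^sub>j \<partial>\<^sub>j\<close> is visible, as the derivative by the
  line parameter. Independence of the \<open>Y\<^sub>j\<close> keeps nonzero series over
  \<open>k\<close> from vanishing on the lines considered, so fractions have germs and Weierstrass
  preparation applies; roots of Weierstrass polynomials take the place of height one primes. The
  factor \<open>y\<close> is a twist: without it the trace of \<open>b dr\<close> is a multiple of
  the trace of \<open>b\<close>, which in general satisfies no congruence modulo
  \<open>X\<^sub>i\<close>.\<close>

no_notation vec_index (infixl "$" 100)

section \<open>Derivations of algebraic field extensions\<close>

text \<open>The target is a module over the source through \<open>h\<close>. One notion thus covers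
  derivations of a field, their restrictions to a subfield, and derivations composed with an
  evaluation of polynomials.\<close>

definition derivation_along :: "('a::comm_ring_1 \<Rightarrow> 'b::comm_ring_1) \<Rightarrow> ('a \<Rightarrow> 'b) \<Rightarrow> bool" where
  "derivation_along h D \<longleftrightarrow> (\<forall>a b. D (a + b) = D a + D b) \<and> (\<forall>a b. D (a * b) = h a * D b + h b * D a)"

lemma derivation_alongD:
  assumes "derivation_along h D"
  shows "D (a + b) = D a + D b" "D (a * b) = h a * D b + h b * D a"
  using assms by (auto simp: derivation_along_def)

lemma derivation_along_0 [simp]: "derivation_along h D \<Longrightarrow> D 0 = 0"
  using derivation_alongD(1)[of h D 0 0] by simp

lemma derivation_along_1 [simp]:
  assumes "comm_ring_hom h" "derivation_along h D"
  shows "D 1 = 0"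
proof -
  interpret comm_ring_hom h by fact
  show ?thesis using derivation_alongD(2)[OF assms(2), of 1 1] by simp
qed

text \<open>Chain rule for polynomials with nonconstant coefficients: the first term comes from the
  coefficients, the second from the argument.\<close>

lemma derivation_along_poly:
  fixes g :: "'s::comm_ring_1 \<Rightarrow> 't::comm_ring_1"
  assumes d: "derivation_along g d" and g: "comm_ring_hom g" and \<theta>: "comm_ring_hom \<theta>"
  shows "d (poly (map_poly \<theta> q) x) =
    poly (map_poly (\<lambda>a. d (\<theta> a)) q) (g x) + poly (map_poly (\<lambda>a. g (\<theta> a)) (pderiv q)) (g x) * d x"
proof -
  interpret g: comm_ring_hom g by fact
  interpret t: comm_ring_hom \<theta> by fact
  interpret gt: comm_ring_hom "\<lambda>a. g (\<theta> a)" by unfold_locales (auto simp: hom_distribs)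
  have gp: "g (poly (map_poly \<theta> p) x) = poly (map_poly (\<lambda>a. g (\<theta> a)) p) (g x)" for p
    by (induction p) (auto simp: hom_distribs)
  show ?thesis
  proof (induction q)
    case 0
    then show ?case using d by simp
  next
    case (pCons a q)
    have "d (poly (map_poly \<theta> (pCons a q)) x) =
       d (\<theta> a) + (g x * d (poly (map_poly \<theta> q) x) + g (poly (map_poly \<theta> q) x) * d x)"
      by (simp add: hom_distribs derivation_alongD[OF d])
    also have "\<dots> = poly (map_poly (\<lambda>a. d (\<theta> a)) (pCons a q)) (g x)
        + poly (map_poly (\<lambda>a. g (\<theta> a)) (pderiv (pCons a q))) (g x) * d x"
      using d by (simp add: pCons.IH gp Polynomial.map_poly_pCons pderiv_pCons hom_distribs algebra_simps)
    finally show ?case .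
  qed
qed

section \<open>Minimal polynomials and simple subextensions\<close>

locale alg_ext = field_hom h for h :: "'a::field_char_0 \<Rightarrow> 'b::field" +
  assumes alg: "\<exists>p. p \<noteq> 0 \<and> poly (map_poly h p) x = 0"
begin

sublocale mp: map_poly_inj_idom_hom h ..

definition ev :: "'b \<Rightarrow> 'a poly \<Rightarrow> 'b" where "ev c p = poly (map_poly h p) c"

sublocale ev: comm_ring_hom "ev c"
  by unfold_locales (auto simp: ev_def mp.hom_add mp.hom_mult)

lemma ev_const [simp]: "ev c [:a:] = h a" by (simp add: ev_def hom_distribs)
lemma ev_pCons: "ev c (pCons a p) = h a + c * ev c p" by (simp add: ev_def hom_distribs)
lemma ev_X [simp]: "ev c [:0, 1:] = c" by (simp add: ev_pCons)
lemma ev_smult: "ev c (smult a p) = h a * ev c p" by (simp add: ev_def hom_distribs)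
lemma ev_pcompose: "ev c (p \<circ>\<^sub>p q) = ev (ev c q) p"
  by (induction p) (auto simp: pcompose_pCons ev_pCons hom_distribs ev.hom_add ev.hom_mult simp flip: ev_const)

definition mpoly :: "'b \<Rightarrow> 'a poly" where
  "mpoly c = (ARG_MIN degree p. lead_coeff p = 1 \<and> ev c p = 0)"

lemma mpoly_props: "lead_coeff (mpoly c) = 1" "ev c (mpoly c) = 0"
  "\<And>p. lead_coeff p = 1 \<Longrightarrow> ev c p = 0 \<Longrightarrow> degree (mpoly c) \<le> degree p"
proof -
  obtain p where p: "p \<noteq> 0" "ev c p = 0" using alg[of c] by (auto simp: ev_def)
  then have "lead_coeff (smult (inverse (lead_coeff p)) p) = 1 \<and> ev c (smult (inverse (lead_coeff p)) p) = 0"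
    by (simp add: ev_smult)
  from arg_min_nat_lemma[of "\<lambda>p. lead_coeff p = 1 \<and> ev c p = 0", OF this, of degree]
  show "lead_coeff (mpoly c) = 1" "ev c (mpoly c) = 0"
    "\<And>p. lead_coeff p = 1 \<Longrightarrow> ev c p = 0 \<Longrightarrow> degree (mpoly c) \<le> degree p"
    unfolding mpoly_def by auto
qed

lemma mpoly_le: "p \<noteq> 0 \<Longrightarrow> ev c p = 0 \<Longrightarrow> degree (mpoly c) \<le> degree p"
  using mpoly_props(3)[of "smult (inverse (lead_coeff p)) p" c] by (simp add: ev_smult)

lemma mpoly_neq0 [simp]: "mpoly c \<noteq> 0" using mpoly_props(1)[of c] by auto

lemma mpoly_dvd: assumes "ev c p = 0" shows "mpoly c dvd p"
proof -
  have "ev c (p mod mpoly c) = 0"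
    using assms mpoly_props(2)[of c] by (metis ev.hom_add ev.hom_mult add_0 mult_div_mod_eq mult_zero_left)
  then have "p mod mpoly c = 0"
    using mpoly_le[of "p mod mpoly c" c] degree_mod_less'[of "mpoly c" p] by fastforce
  then show ?thesis by auto
qed

lemma mpoly_degree_pos: "degree (mpoly c) > 0"
proof (rule ccontr)
  assume "\<not> ?thesis"
  then obtain a where "mpoly c = [:a:]" by (metis degree_eq_zeroE not_gr_zero)
  then show False using mpoly_props(1,2)[of c] by simp
qed

text \<open>Separability in characteristic zero: the derivative is a nonzero polynomial of smaller
  degree, so minimality forbids it to vanish at \<open>c\<close>.\<close>

lemma ev_pderiv_mpoly: "ev c (pderiv (mpoly c)) \<noteq> 0"
proof
  assume "ev c (pderiv (mpoly c)) = 0"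
  moreover have "pderiv (mpoly c) \<noteq> 0" using mpoly_degree_pos[of c] by (simp add: pderiv_eq_0_iff)
  ultimately show False using mpoly_le[of "pderiv (mpoly c)" c] mpoly_degree_pos[of c]
    by (simp add: degree_pderiv)
qed

text \<open>As \<open>c\<close> is algebraic, the polynomial expressions in \<open>c\<close> already
  form a field, the simple subextension generated by \<open>c\<close>.\<close>

definition adj :: "'b \<Rightarrow> 'b set" where "adj c = range (ev c)"

lemma ev_in_adj [simp, intro]: "ev c p \<in> adj c" by (simp add: adj_def)
lemma adjE: assumes "a \<in> adj c" obtains p where "a = ev c p" using assms by (auto simp: adj_def)
lemma adj_self [simp]: "c \<in> adj c" using ev_in_adj[of c "[:0,1:]"] by simp
lemma adj_h [simp]: "h a \<in> adj c" using ev_in_adj[of c "[:a:]"] by simp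
lemma adj_0 [simp]: "0 \<in> adj c" using adj_h[of 0] by simp
lemma adj_1 [simp]: "1 \<in> adj c" using adj_h[of 1] by simp
lemma adj_add [intro]: "a \<in> adj c \<Longrightarrow> b \<in> adj c \<Longrightarrow> a + b \<in> adj c"
  by (metis adjE ev.hom_add ev_in_adj)
lemma adj_mult [intro]: "a \<in> adj c \<Longrightarrow> b \<in> adj c \<Longrightarrow> a * b \<in> adj c"
  by (metis adjE ev.hom_mult ev_in_adj)
lemma adj_uminus [intro]: "a \<in> adj c \<Longrightarrow> - a \<in> adj c"
  by (metis adjE ev.hom_uminus ev_in_adj)
lemma adj_diff [intro]: "a \<in> adj c \<Longrightarrow> b \<in> adj c \<Longrightarrow> a - b \<in> adj c"
  by (metis adjE ev.hom_minus ev_in_adj)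
lemma adj_power [intro]: "a \<in> adj c \<Longrightarrow> a ^ n \<in> adj c"
  by (induction n) auto
lemma adj_sum [intro]: "(\<And>x. x \<in> A \<Longrightarrow> f x \<in> adj c) \<Longrightarrow> sum f A \<in> adj c"
  by (induction A rule: infinite_finite_induct) auto

lemma adj_ev: "a \<in> adj c \<Longrightarrow> ev a p \<in> adj c"
  by (metis adjE ev_pcompose ev_in_adj)

text \<open>With the minimal polynomial written as \<open>x + T q\<close>, minimality makes
  \<open>x\<close> nonzero, and \<open>- q(a) / x\<close> is the inverse of
  \<open>a\<close>.\<close>

lemma adj_inverse: assumes "a \<in> adj c" shows "inverse a \<in> adj c"
proof (cases "a = 0")
  case False
  obtain x q where m: "mpoly a = pCons x q" by (cases "mpoly a") auto
  have *: "h x + a * ev a q = 0" using mpoly_props(2)[of a] by (simp add: m ev_pCons)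
  have "x \<noteq> 0"
  proof
    assume "x = 0"
    then have "ev a q = 0" "q \<noteq> 0" using * False m mpoly_neq0[of a] by auto
    then show False using mpoly_le[of q a] m by simp
  qed
  then have "a * (- ev a q * h (inverse x)) = 1" using *
    by (simp add: hom_distribs field_simps) (metis add.commute add_eq_0_iff)
  then have "inverse a = - ev a q * h (inverse x)" by (simp add: inverse_unique)
  then show ?thesis using adj_mult[OF adj_uminus[OF adj_ev[OF assms, of q]] adj_h] by simp
qed (simp add: assms)

lemma adj_divide [intro]: "a \<in> adj c \<Longrightarrow> b \<in> adj c \<Longrightarrow> a / b \<in> adj c"
  by (simp add: divide_inverse adj_inverse adj_mult)

section \<open>Extension of a derivation to an algebraic extension\<close>

definition del :: "('a \<Rightarrow> 'b) \<Rightarrow> 'b \<Rightarrow> 'b" where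
  "del D c = - poly (map_poly D (mpoly c)) c / ev c (pderiv (mpoly c))"

text \<open>Differentiating \<open>m(c) = 0\<close> for the minimal polynomial \<open>m\<close>
  forces the value \<open>del D c\<close>. Here it serves as the derivative of the indeterminate,
  which makes \<open>delp D c\<close> a derivation on polynomials that vanishes on
  \<open>m\<close>.\<close>

definition delp :: "('a \<Rightarrow> 'b) \<Rightarrow> 'b \<Rightarrow> 'a poly \<Rightarrow> 'b" where
  "delp D c p = poly (map_poly D p) c + ev c (pderiv p) * del D c"

lemma delp_mpoly: "delp D c (mpoly c) = 0"
  by (simp add: delp_def del_def ev_pderiv_mpoly)

lemma derivation_along_map_poly:
  assumes D: "derivation_along h D"
  shows "derivation_along (ev c) (\<lambda>p. poly (map_poly D p) c)"
proof -
  have D0: "D 0 = 0" using D by simp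
  have add: "map_poly D (p + q) = map_poly D p + map_poly D q" for p q
    by (rule poly_eqI) (simp add: coeff_map_poly D0 derivation_alongD[OF D])
  have sm: "poly (map_poly D (smult a q)) c = h a * poly (map_poly D q) c + D a * ev c q" for a q
    by (induction q) (simp_all only: smult_pCons, simp_all add: D0 Polynomial.map_poly_pCons ev_pCons derivation_alongD[OF D] algebra_simps ev.hom_zero)
  have mult: "poly (map_poly D (p * q)) c = ev c p * poly (map_poly D q) c + ev c q * poly (map_poly D p) c" for p q
    by (induction p) (simp_all add: ev.hom_zero D0 add sm Polynomial.map_poly_pCons ev_pCons derivation_alongD[OF D] algebra_simps)
  show ?thesis by (simp add: derivation_along_def add mult)
qed

lemma derivation_along_delp:
  assumes D: "derivation_along h D"
  shows "derivation_along (ev c) (delp D c)"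
  using derivation_along_map_poly[OF D, of c]
  by (simp add: derivation_along_def delp_def pderiv_add pderiv_mult ev.hom_add ev.hom_mult algebra_simps)

text \<open>Each element gets its value from its own minimal polynomial, so compatibility has to be
  proved. The minimal polynomial of \<open>ev c p\<close>, composed with \<open>p\<close>, is a
  multiple of \<open>mpoly c\<close>, hence killed by \<open>delp D c\<close>; expanded by the chain
  rule this is the equation that defines \<open>del D (ev c p)\<close>.\<close>

lemma del_ev:
  assumes D: "derivation_along h D"
  shows "del D (ev c p) = delp D c p"
proof -
  let ?m = "mpoly (ev c p)"
  note d = derivation_along_delp[OF D, of c]
  have "ev c (?m \<circ>\<^sub>p p) = 0" by (simp add: ev_pcompose mpoly_props)
  then obtain r where r: "?m \<circ>\<^sub>p p = mpoly c * r" using mpoly_dvd by (meson dvdE)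
  have comp: "q \<circ>\<^sub>p p = poly (map_poly (\<lambda>a. [:a:]) q) p" for q :: "'a poly"
    by (induction q) (simp_all add: pcompose_pCons Polynomial.map_poly_pCons)
  have "0 = delp D c (?m \<circ>\<^sub>p p)"
    by (simp add: r derivation_alongD(2)[OF d] delp_mpoly mpoly_props)
  also have "\<dots> = delp D c (poly (map_poly (\<lambda>a. [:a:]) ?m) p)" by (simp only: comp)
  also have "\<dots> = poly (map_poly (\<lambda>a. delp D c [:a:]) ?m) (ev c p)
        + poly (map_poly (\<lambda>a. ev c [:a:]) (pderiv ?m)) (ev c p) * delp D c p"
    by (rule derivation_along_poly[OF d]) (unfold_locales, auto)
  also have "(\<lambda>a. delp D c [:a:]) = D"
    using D by (auto simp: delp_def Polynomial.map_poly_pCons pderiv_pCons ev.hom_zero)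
  finally have "poly (map_poly D ?m) (ev c p) + ev (ev c p) (pderiv ?m) * delp D c p = 0"
    unfolding ev_const by (simp add: ev_def)
  then have "ev (ev c p) (pderiv ?m) * delp D c p = - poly (map_poly D ?m) (ev c p)"
    by (simp add: eq_neg_iff_add_eq_0 add.commute)
  then show ?thesis using ev_pderiv_mpoly[of "ev c p"] unfolding del_def
    by (metis nonzero_mult_div_cancel_left)
qed

lemma del_in_adj_self: assumes D0: "D 0 = 0" and "\<And>a. D a \<in> range h" shows "del D c \<in> adj c"
proof -
  have "poly (map_poly D p) c \<in> adj c" for p
  proof -
    have "poly (map_poly D p) c = (\<Sum>i\<le>degree (map_poly D p). coeff (map_poly D p) i * c ^ i)" by (rule poly_altdef)
    also have "\<dots> \<in> adj c"
    proof (intro adj_sum adj_mult adj_power adj_self)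
      fix i show "coeff (map_poly D p) i \<in> adj c"
        using assms(2)[of "coeff p i"] by (auto simp: D0 coeff_map_poly)
    qed
    finally show ?thesis .
  qed
  then show ?thesis unfolding del_def by auto
qed

lemma del_in_adj:
  assumes D: "derivation_along h D" and "\<And>a. D a \<in> range h" "a \<in> adj c"
  shows "del D a \<in> adj c"
  using del_in_adj_self[of D a] derivation_along_0[OF D] assms(2,3) by (metis adjE adj_ev)

text \<open>Division by a monic polynomial stays within the ring generated by the coefficients. A
  set \<open>S\<close> is used because the subfield \<open>adj c\<close> is not a type of its
  own.\<close>

lemma subring_division:
  fixes S :: "'b set"
  assumes S: "0 \<in> S" "\<And>x y. x \<in> S \<Longrightarrow> y \<in> S \<Longrightarrow> x - y \<in> S" "\<And>x y. x \<in> S \<Longrightarrow> y \<in> S \<Longrightarrow> x * y \<in> S"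
    and q: "lead_coeff q = 1" "\<And>i. coeff q i \<in> S" "degree q > 0"
    and p: "\<And>i. coeff p i \<in> S"
  shows "\<exists>u. (\<forall>i. coeff (p - u * q) i \<in> S) \<and> degree (p - u * q) < degree q"
  using p
proof (induction "degree p" arbitrary: p rule: less_induct)
  case less
  show ?case
  proof (cases "degree p < degree q")
    case True
    then show ?thesis using less.prems by (intro exI[of _ 0]) simp
  next
    case False
    define m where "m = monom (lead_coeff p) (degree p - degree q)"
    have q0: "q \<noteq> 0" using q(1) by auto
    have p0: "p \<noteq> 0" using False q(3) by auto
    let ?r = "p - m * q"
    have cS: "coeff ?r i \<in> S" for i
      using S q(2) less.prems by (auto simp: m_def coeff_monom_mult)
    have dm: "degree m = degree p - degree q" "m \<noteq> 0" using p0 by (auto simp: m_def degree_monom_eq)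
    have *: "degree (m * q) = degree p" using False q0 dm by (simp add: degree_mult_eq)
    have lm: "lead_coeff m = lead_coeff p" unfolding m_def by (rule lead_coeff_monom)
    have **: "lead_coeff (m * q) = lead_coeff p" using q(1) lm by (simp add: lead_coeff_mult)
    have "degree ?r < degree p"
    proof -
      have "degree ?r \<le> degree p" using * by (simp add: degree_diff_le)
      moreover have "coeff ?r (degree p) = 0" using * ** by (metis coeff_diff diff_self)
      moreover have "degree ?r \<noteq> degree p \<or> ?r = 0" using \<open>coeff ?r (degree p) = 0\<close> by (metis leading_coeff_0_iff)
      ultimately show ?thesis using False q(3) by (cases "?r = 0") auto
    qed
    from less.hyps[OF this cS] obtain u where
      u: "\<And>i. coeff (?r - u * q) i \<in> S" "degree (?r - u * q) < degree q" by blast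
    have "?r - u * q = p - (m + u) * q" by (simp add: algebra_simps)
    then show ?thesis using u by (intro exI[of _ "m + u"]) (simp only:, simp)
  qed
qed

text \<open>The polynomials \<open>g(T)\<close> and \<open>f(\<gamma> - n T)\<close> have \<open>b\<close> as their only common root.\<close>

lemma primitive_element: "\<exists>c. a \<in> adj c \<and> b \<in> adj c"
proof -
  define f where "f = map_poly to_ac (map_poly h (mpoly a))"
  define g where "g = map_poly to_ac (map_poly h (mpoly b))"
  have f0: "f \<noteq> 0" "g \<noteq> 0" by (auto simp: f_def g_def map_poly_eq_0_iff)
  have char0: "of_nat n = (0::'b) \<longleftrightarrow> n = 0" for n
    by (metis hom_of_nat hom_0_iff of_nat_eq_0_iff)
  \<comment> \<open>Outside this finite set, \<open>x + N y = a + N b\<close> for conjugates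
    \<open>x\<close> of \<open>a\<close> and \<open>y\<close> of \<open>b\<close> forces
    \<open>y = b\<close>. Pairs with \<open>y = b\<close> contribute only 0, the value of division
    by zero.\<close>
  define bad where "bad = (\<lambda>(x, y). (x - to_ac a) / (to_ac b - y)) ` ({x. poly f x = 0} \<times> {y. poly g y = 0})"
  have "finite bad" unfolding bad_def using f0 by (intro finite_imageI finite_cartesian_product poly_roots_finite)
  moreover have "inj (\<lambda>n. to_ac (of_nat n :: 'b))"
  proof (rule injI)
    fix m n assume "to_ac (of_nat m :: 'b) = to_ac (of_nat n)"
    then have "h (of_nat m) = h (of_nat n)" by (simp only: hom_of_nat to_ac_eq_iff)
    then have "of_nat m = (of_nat n :: 'a)" by (rule injectivity)
    then show "m = n" by simp
  qed
  then have "infinite (range (\<lambda>n. to_ac (of_nat n :: 'b)))" by (rule range_inj_infinite)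
  ultimately have "\<not> range (\<lambda>n. to_ac (of_nat n :: 'b)) \<subseteq> bad" using finite_subset by blast
  then obtain n where n: "to_ac (of_nat n :: 'b) \<notin> bad" by blast
  define N :: 'b where "N = of_nat n"
  define c where "c = a + N * b"
  \<comment> \<open>The \<open>q\<close> of least degree with \<open>P q\<close> is the minimal
    polynomial of \<open>b\<close> over the subfield \<open>adj c\<close>; degree one means that
    \<open>b\<close> lies in that subfield.\<close>
  define P where "P q \<longleftrightarrow> lead_coeff q = 1 \<and> (\<forall>i. coeff q i \<in> adj c) \<and> poly q b = 0" for q
  have "P (map_poly h (mpoly b))" using mpoly_props(1,2)[of b] by (auto simp: P_def ev_def)
  from arg_min_nat_lemma[of P, OF this, of degree] obtain q where
    q: "P q" "\<And>p. P p \<Longrightarrow> degree q \<le> degree p" by blast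
  have q0: "q \<noteq> 0" and qm: "lead_coeff q = 1" and qb: "poly q b = 0" and qS: "\<And>i. coeff q i \<in> adj c"
    using q(1) by (auto simp: P_def)
  have qd: "degree q > 0"
  proof (rule ccontr)
    assume "\<not> ?thesis"
    then obtain x where "q = [:x:]" by (metis degree_eq_zeroE not_gr_zero)
    then show False using qb qm by simp
  qed
  have dvd: "q dvd p" if pS: "\<And>i. coeff p i \<in> adj c" and pb: "poly p b = 0" for p
  proof -
    obtain u where u: "\<And>i. coeff (p - u * q) i \<in> adj c" "degree (p - u * q) < degree q"
      using subring_division[OF adj_0 adj_diff adj_mult qm qS qd pS] by blast
    define r where "r = p - u * q"
    have rS: "coeff r i \<in> adj c" for i using u(1)[of i] by (simp only: r_def)
    have rb: "poly r b = 0" using pb qb by (simp add: r_def)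
    have rd: "degree r < degree q" using u(2) by (simp only: r_def)
    have "r = 0"
    proof (rule ccontr)
      assume r0: "r \<noteq> 0"
      have "P (smult (inverse (lead_coeff r)) r)"
        using r0 rb by (auto simp: P_def intro!: adj_mult adj_inverse rS)
      then have "degree q \<le> degree r" using q(2)[of "smult (inverse (lead_coeff r)) r"] r0 by simp
      then show False using rd by simp
    qed
    then show ?thesis by (simp add: r_def)
  qed
  have d1: "q dvd map_poly h (mpoly b)" using mpoly_props(2)[of b] by (intro dvd) (auto simp: ev_def)
  have N: "N \<in> adj c" unfolding N_def hom_of_nat[symmetric] by (rule adj_h)
  have "coeff (map_poly h p \<circ>\<^sub>p [:c, - N:]) i \<in> adj c" for p i
    by (rule coeff_pcompose_semiring_closed)
      (auto simp: coeff_pCons intro: adj_uminus N split: nat.splits)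
  then have d2: "q dvd map_poly h (mpoly a) \<circ>\<^sub>p [:c, - N:]"
    using mpoly_props(2)[of a] by (intro dvd) (auto simp: ev_def poly_pcompose c_def algebra_simps)
  interpret ac: field_hom "to_ac :: 'b \<Rightarrow> 'b alg_closure" by unfold_locales auto
  interpret acp: map_poly_inj_idom_hom "to_ac :: 'b \<Rightarrow> 'b alg_closure" ..
  define Q where "Q = map_poly to_ac q"
  have only: "y = to_ac b" if "poly Q y = 0" for y
  proof (rule ccontr)
    assume ne: "y \<noteq> to_ac b"
    have "poly g y = 0" using d1 that unfolding g_def Q_def by (metis acp.hom_mult dvdE mult_zero_left poly_mult)
    moreover have "poly (map_poly to_ac (map_poly h (mpoly a) \<circ>\<^sub>p [:c, - N:])) y = 0"
      using d2 that unfolding Q_def by (metis acp.hom_mult dvdE mult_zero_left poly_mult)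
    then have "poly f (to_ac c - to_ac N * y) = 0"
      by (simp add: ac.map_poly_pcompose poly_pcompose f_def hom_distribs mult.commute)
    moreover have "to_ac c - to_ac N * y - to_ac a = to_ac N * (to_ac b - y)" by (simp add: c_def algebra_simps)
    then have "to_ac N = (to_ac c - to_ac N * y - to_ac a) / (to_ac b - y)" using ne by (simp add: field_simps)
    ultimately show False using n unfolding bad_def N_def by force
  qed
  have "degree q = 1"
  proof (rule ccontr)
    assume "degree q \<noteq> 1"
    with qd have dq: "degree q > 1" by simp
    \<comment> \<open>A further root of \<open>q\<close> could only be \<open>b\<close> again, and a
      double root contradicts separability.\<close>
    obtain r where r: "q = [:- b, 1:] * r" using qb by (meson poly_eq_0_iff_dvd dvdE)
    have "r \<noteq> 0" using r q0 by (metis mult_zero_right)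
    then have "degree q = 1 + degree r" unfolding r by (subst degree_mult_eq) auto
    then have "degree r > 0" using dq by simp
    then obtain z where z: "poly (map_poly to_ac r) z = 0" using alg_closed_imp_poly_has_root[of "map_poly to_ac r"] by auto
    then have "poly Q z = 0" unfolding Q_def r acp.hom_mult by (simp del: mult_pCons_left)
    then have "z = to_ac b" by (rule only)
    then have "poly r b = 0" using z by simp
    then obtain r' where "r = [:- b, 1:] * r'" by (meson poly_eq_0_iff_dvd dvdE)
    moreover obtain s where "map_poly h (mpoly b) = q * s" using d1 unfolding dvd_def by blast
    ultimately have "map_poly h (mpoly b) = [:- b, 1:] * ([:- b, 1:] * (r' * s))" using r by (simp only: mult.assoc)
    then have "poly (pderiv (map_poly h (mpoly b))) b = 0" by (simp add: pderiv_mult del: mult_pCons_left)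
    moreover have "pderiv (map_poly h (mpoly b)) = map_poly h (pderiv (mpoly b))" by (simp add: map_poly_pderiv)
    ultimately show False using ev_pderiv_mpoly[of b] by (simp add: ev_def)
  qed
  then obtain x y where xy: "q = [:x, y:]" by (metis One_nat_def degree_eq_zeroE degree_pCons_eq_if nat.inject pCons_cases zero_neq_one)
  then have "y = 1" using qm \<open>degree q = 1\<close> by (auto split: if_splits)
  then have "b = - x" using qb xy by (simp add: add_eq_0_iff)
  moreover have "x \<in> adj c" using qS[of 0] xy by simp
  ultimately have b: "b \<in> adj c" by auto
  have "a = c - N * b" by (simp add: c_def)
  then have "a \<in> adj c" using adj_diff[OF adj_self adj_mult[OF N b]] by simp
  with b show ?thesis by blast
qed

lemma adj_trans: "a \<in> adj b \<Longrightarrow> b \<in> adj c \<Longrightarrow> a \<in> adj c"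
  by (metis adjE adj_ev)

lemma primitive_element_finite: "finite A \<Longrightarrow> \<exists>c. A \<subseteq> adj c"
proof (induction A rule: finite_induct)
  case (insert x A)
  then obtain c where "A \<subseteq> adj c" by blast
  moreover obtain e where "x \<in> adj e" "c \<in> adj e" using primitive_element by blast
  ultimately show ?case using adj_trans by blast
qed auto

text \<open>Two elements always lie in a common simple subextension, where \<open>del D\<close> is
  computed by the derivation \<open>delp D c\<close>.\<close>

lemma derivation_along_del:
  assumes D: "derivation_along h D"
  shows "derivation_along (\<lambda>x. x) (del D)"
  unfolding derivation_along_def
proof (intro conjI allI)
  fix a b
  obtain c where "a \<in> adj c" "b \<in> adj c" using primitive_element by blast
  then obtain p q where pq: "a = ev c p" "b = ev c q" by (metis adjE)
  note d = derivation_alongD[OF derivation_along_delp[OF D, of c]]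
  show "del D (a + b) = del D a + del D b"
    unfolding pq ev.hom_add[symmetric] del_ev[OF D] d ..
  show "del D (a * b) = a * del D b + b * del D a"
    unfolding pq ev.hom_mult[symmetric] unfolding del_ev[OF D] d ..
qed

lemma del_h [simp]: assumes D: "derivation_along h D" shows "del D (h a) = D a"
  using del_ev[OF D, of 0 "[:a:]"] D by (simp add: delp_def Polynomial.map_poly_pCons pderiv_pCons ev.hom_zero)

end

section \<open>Traces\<close>

text \<open>Newton's identities for the power sums of the roots of a monic polynomial.\<close>

fun psum :: "'a::comm_ring_1 poly \<Rightarrow> nat \<Rightarrow> 'a" where
  "psum m j = (if j = 0 then of_nat (degree m) else
     - of_nat j * coeff (reflect_poly m) j - (\<Sum>l\<in>{1..<j}. coeff (reflect_poly m) l * psum m (j - l)))"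

declare psum.simps [simp del]

lemma (in inj_comm_ring_hom) psum_hom: "psum (map_poly hom m) j = hom (psum m j)"
proof (induction j rule: less_induct)
  case (less j)
  have c: "coeff (reflect_poly (map_poly hom m)) l = hom (coeff (reflect_poly m) l)" for l
    by (simp add: coeff_reflect_poly)
  show ?case
    by (subst (1 2) psum.simps) (simp add: c less.IH hom_distribs)
qed

text \<open>The reversed polynomial is the product of the factors \<open>1 - r X\<close>; its
  logarithmic derivative generates the power sums of the roots, and comparing coefficients gives the
  recursion.\<close>

lemma psum_roots:
  fixes m :: "'a::field poly"
  assumes m: "m = (\<Prod>r\<leftarrow>rs. [:- r, 1:])"
  shows "psum m j = (\<Sum>r\<leftarrow>rs. r ^ j)"
proof -
  define P where "P = (\<lambda>rs :: 'a list. fps_of_poly (reflect_poly (\<Prod>r\<leftarrow>rs. [:- r, 1:])))"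
  define Q where "Q = (\<lambda>rs :: 'a list. Abs_fps (\<lambda>j. \<Sum>r\<leftarrow>rs. r ^ j))"
  have lin: "reflect_poly [:- r, 1:] = [:1, - r:]" for r :: 'a
    by (cases "r = 0") (simp_all add: reflect_poly_def)
  have deg: "degree (\<Prod>r\<leftarrow>rs. [:- r, 1:]) = length rs" for rs :: "'a list"
  proof (induction rs)
    case (Cons r rs)
    have "(\<Prod>r\<leftarrow>rs. [:- r, 1:]) \<noteq> 0" by (auto simp: prod_list_zero_iff)
    then show ?case using Cons by (simp add: degree_mult_eq del: mult_pCons_left)
  qed simp
  have log_deriv: "- (fps_X * fps_deriv (P rs)) = P rs * (Q rs - of_nat (length rs))" for rs
  proof (induction rs)
    case Nil
    then show ?case by (simp add: P_def Q_def fps_zero_def[symmetric])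
  next
    case (Cons r rs)
    let ?u = "1 - fps_const r * fps_X"
    define G where "G = Abs_fps (\<lambda>j. r ^ j)"
    have Pc: "P (r # rs) = ?u * P rs"
      by (simp add: P_def reflect_poly_mult lin fps_of_poly_mult fps_of_poly_pCons del: mult_pCons_left)
    have "?u * G = 1"
    proof (rule fps_ext)
      fix n show "(?u * G) $ n = 1 $ n"
        by (cases n) (simp_all add: G_def left_diff_distrib mult.assoc)
    qed
    moreover have "?u * P rs * G = P rs * (?u * G)" by (simp only: mult_ac)
    ultimately have uG: "?u * P rs * G = P rs" by simp
    have Qc: "Q (r # rs) = G + Q rs" by (simp add: Q_def G_def fps_eq_iff)
    have "- (fps_X * fps_deriv (P (r # rs))) = fps_const r * fps_X * P rs + ?u * (- (fps_X * fps_deriv (P rs)))"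
      by (simp add: Pc algebra_simps)
    also have "\<dots> = fps_const r * fps_X * P rs + ?u * P rs * (Q rs - of_nat (length rs))"
      by (simp only: Cons.IH mult.assoc)
    also have "\<dots> = ?u * P rs * G + ?u * P rs * (Q rs - of_nat (length rs)) - ?u * P rs"
      unfolding uG by (simp add: algebra_simps)
    also have "\<dots> = P (r # rs) * (Q (r # rs) - of_nat (length (r # rs)))"
      unfolding Pc Qc by (simp add: algebra_simps)
    finally show ?case .
  qed
  have Pn: "P rs $ l = coeff (reflect_poly m) l" for l by (simp add: P_def m)
  have P0: "P rs $ 0 = 1"
  proof -
    have "lead_coeff m = 1" unfolding m by (induction rs) (simp_all add: lead_coeff_mult del: mult_pCons_left)
    then show ?thesis by (simp add: Pn)
  qed
  define S where "S = (\<lambda>j. \<Sum>r\<leftarrow>rs. r ^ j)"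
  have S0: "S 0 = of_nat (length rs)" by (simp add: S_def sum_list_triv)
  have rec: "S j = - of_nat j * P rs $ j - (\<Sum>l\<in>{1..<j}. P rs $ l * S (j - l))" if "j > 0" for j
  proof -
    have QS: "(Q rs - of_nat (length rs)) $ i = (if i = 0 then 0 else S i)" for i
      using S0 by (simp add: Q_def S_def fps_nth_of_nat flip: fps_of_nat)
    have "- of_nat j * P rs $ j = (- (fps_X * fps_deriv (P rs))) $ j"
      using that by (cases j) (auto simp: algebra_simps)
    also have "\<dots> = (\<Sum>l=0..j. P rs $ l * (if j - l = 0 then 0 else S (j - l)))"
      by (subst log_deriv) (simp only: fps_mult_nth QS)
    also have "{0..j} = insert 0 (insert j {1..<j})" using that by auto
    finally show ?thesis using that P0 by simp
  qed
  have "psum m j = S j" for j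
  proof (induction j rule: less_induct)
    case (less j)
    show ?case
    proof (cases "j = 0")
      case True
      then show ?thesis using S0 deg[of rs] by (simp add: psum.simps m)
    next
      case False
      then show ?thesis using rec[of j] less.IH by (subst psum.simps) (simp add: Pn)
    qed
  qed
  then show ?thesis by (simp add: S_def)
qed

text \<open>The trace of \<open>p\<close> modulo \<open>m\<close>. Written through coefficients it
  lies in the base ring, and it can be evaluated in any field over which \<open>m\<close>
  splits.\<close>

definition trp :: "'a::comm_ring_1 poly \<Rightarrow> 'a poly \<Rightarrow> 'a" where
  "trp m p = (\<Sum>i\<le>degree p. coeff p i * psum m i)"

lemma trp_roots:
  fixes \<theta> :: "'a::field \<Rightarrow> 'c::field"
  assumes "field_hom \<theta>" and m: "map_poly \<theta> m = (\<Prod>r\<leftarrow>rs. [:- r, 1:])"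
  shows "\<theta> (trp m p) = (\<Sum>r\<leftarrow>rs. poly (map_poly \<theta> p) r)"
proof -
  interpret t: field_hom \<theta> by fact
  have "\<theta> (trp m p) = (\<Sum>i\<le>degree p. \<theta> (coeff p i) * psum (map_poly \<theta> m) i)"
    by (simp add: trp_def hom_distribs t.psum_hom)
  also have "\<dots> = (\<Sum>i\<le>degree p. \<theta> (coeff p i) * (\<Sum>r\<leftarrow>rs. r ^ i))"
    by (simp add: psum_roots[OF m])
  also have "\<dots> = (\<Sum>r\<leftarrow>rs. \<Sum>i\<le>degree p. \<theta> (coeff p i) * r ^ i)"
    by (induction rs) (simp_all add: sum.distrib algebra_simps)
  also have "\<dots> = (\<Sum>r\<leftarrow>rs. poly (map_poly \<theta> p) r)"
    by (simp add: poly_altdef)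
  finally show ?thesis .
qed

section \<open>The trace from a simple subextension to the base field\<close>

context alg_ext
begin

definition tr :: "'b \<Rightarrow> 'b \<Rightarrow> 'a" where
  "tr c a = trp (mpoly c) (SOME p. ev c p = a)"

lemma trp_mpoly_roots:
  obtains rs where "map_poly to_ac (mpoly c) = (\<Prod>r\<leftarrow>rs. [:- r, 1:])"
proof -
  interpret ac: field_hom "to_ac :: 'a \<Rightarrow> 'a alg_closure" by unfold_locales auto
  have "map_poly to_ac (mpoly c) \<noteq> 0" by simp
  from alg_closed_imp_factorization[OF this] obtain A where
    A: "map_poly to_ac (mpoly c) = smult (lead_coeff (map_poly to_ac (mpoly c))) (\<Prod>x\<in>#A. [:-x, 1:])" by blast
  obtain rs where "mset rs = A" using ex_mset by blast
  with A have "map_poly to_ac (mpoly c) = (\<Prod>r\<leftarrow>rs. [:- r, 1:])"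
    using mpoly_props(1)[of c] by (simp flip: prod_mset_prod_list)
  then show ?thesis by (rule that)
qed

text \<open>Independence of the chosen representative: two polynomial expressions of one element
  differ by a multiple of the minimal polynomial, which vanishes at every root in the sum.\<close>

lemma tr_ev: "tr c (ev c p) = trp (mpoly c) p"
proof -
  interpret ac: field_hom "to_ac :: 'a \<Rightarrow> 'a alg_closure" by unfold_locales auto
  interpret acp: map_poly_inj_idom_hom "to_ac :: 'a \<Rightarrow> 'a alg_closure" ..
  obtain rs where rs: "map_poly to_ac (mpoly c) = (\<Prod>r\<leftarrow>rs. [:- r, 1:])" by (rule trp_mpoly_roots)
  define q where "q = (SOME q. ev c q = ev c p)"
  have q: "ev c q = ev c p" unfolding q_def by (rule someI) simp
  then obtain u where u: "q = p + mpoly c * u" using mpoly_dvd[of c "q - p"]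
    by (auto simp: ev.hom_minus algebra_simps elim!: dvdE)
  have "poly (map_poly to_ac (mpoly c)) r = 0" if "r \<in> set rs" for r
    unfolding rs using that by (induction rs) auto
  then have "(\<Sum>r\<leftarrow>rs. poly (map_poly to_ac q) r) = (\<Sum>r\<leftarrow>rs. poly (map_poly to_ac p) r)"
    by (intro arg_cong[of _ _ sum_list] map_cong) (simp_all add: u acp.hom_add acp.hom_mult)
  then have "to_ac (trp (mpoly c) q) = to_ac (trp (mpoly c) p)"
    using trp_roots[OF ac.field_hom_axioms rs] by simp
  then show ?thesis by (simp add: tr_def q_def)
qed

lemma tr_transport:
  fixes \<theta> :: "'a \<Rightarrow> 'c::field"
  assumes "field_hom \<theta>" "map_poly \<theta> (mpoly c) = (\<Prod>r\<leftarrow>rs. [:- r, 1:])"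
  shows "\<theta> (tr c (ev c p)) = (\<Sum>r\<leftarrow>rs. poly (map_poly \<theta> p) r)"
  using trp_roots[OF assms] by (simp add: tr_ev)

lemma tr_add: assumes "a \<in> adj c" "b \<in> adj c" shows "tr c (a + b) = tr c a + tr c b"
proof -
  interpret ac: field_hom "to_ac :: 'a \<Rightarrow> 'a alg_closure" by unfold_locales auto
  interpret acp: map_poly_inj_idom_hom "to_ac :: 'a \<Rightarrow> 'a alg_closure" ..
  obtain rs where rs: "map_poly to_ac (mpoly c) = (\<Prod>r\<leftarrow>rs. [:- r, 1:])" by (rule trp_mpoly_roots)
  obtain p q where pq: "a = ev c p" "b = ev c q" using assms by (metis adjE)
  have "to_ac (tr c (ev c (p + q))) = to_ac (tr c (ev c p)) + to_ac (tr c (ev c q))"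
    by (simp only: tr_transport[OF ac.field_hom_axioms rs] acp.hom_add poly_add sum_list_addf)
  then show ?thesis by (simp add: pq ev.hom_add flip: to_ac_add)
qed

lemma tr_smult: assumes "a \<in> adj c" shows "tr c (h k * a) = k * tr c a"
proof -
  interpret ac: field_hom "to_ac :: 'a \<Rightarrow> 'a alg_closure" by unfold_locales auto
  obtain rs where rs: "map_poly to_ac (mpoly c) = (\<Prod>r\<leftarrow>rs. [:- r, 1:])" by (rule trp_mpoly_roots)
  obtain p where p: "a = ev c p" using assms by (metis adjE)
  have "to_ac (tr c (ev c (smult k p))) = to_ac k * to_ac (tr c (ev c p))"
    by (simp add: tr_transport[OF ac.field_hom_axioms rs] hom_distribs sum_list_const_mult)
  then show ?thesis by (simp add: p ev_smult flip: to_ac_mult)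
qed

lemma tr_0 [simp]: "tr c 0 = 0" using tr_smult[of 0 c 0] by simp

lemma tr_1: "tr c 1 = of_nat (degree (mpoly c))"
  using tr_ev[of c 1] by (simp add: trp_def psum.simps)

end

section \<open>Puiseux series\<close>

text \<open>Entry \<open>n\<close> holds the coefficients of the \<open>n\<close>-th power of the
  parameter in the two factors. The argument of \<open>sol\<close> is what the earlier entries leave
  over; the two end terms of the convolution are the unknowns.\<close>

fun hensel_seq :: "('f::comm_ring_1 poly \<Rightarrow> 'f poly \<times> 'f poly) \<Rightarrow> (nat \<Rightarrow> 'f poly) \<Rightarrow> 'f poly \<times> 'f poly \<Rightarrow> nat \<Rightarrow> 'f poly \<times> 'f poly"
  where "hensel_seq sol P gh n = (if n = 0 then gh else
    sol (P n - (\<Sum>i\<in>{1..<n}. fst (hensel_seq sol P gh i) * snd (hensel_seq sol P gh (n - i)))))"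

declare hensel_seq.simps [simp del]

text \<open>Hensel's lemma, one coefficient of the parameter at a time: each step is a Bezout
  equation for the residual factors. As \<open>P\<close> is monic, all right-hand sides have degree
  below that of \<open>P\<close>, and the corrections never touch the leading terms of
  \<open>g\<close> and \<open>h\<close>.\<close>

lemma hensel_fps:
  fixes P :: "'f::field fps poly"
  assumes monic: "lead_coeff P = 1"
    and P0: "map_poly (\<lambda>f. f $ 0) P = g * h" and g: "lead_coeff g = 1" "degree g > 0" and h: "lead_coeff h = 1" "degree h > 0"
    and sol: "\<And>e. degree e < degree g + degree h \<Longrightarrow> \<exists>u v. u * h + g * v = e \<and> degree u < degree g \<and> degree v < degree h"
  shows "\<exists>G H. P = G * H \<and> lead_coeff G = 1 \<and> lead_coeff H = 1 \<and> degree G = degree g \<and> degree H = degree h"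
proof -
  define Pn where "Pn n = map_poly (\<lambda>f. f $ n) P" for n
  have Pn: "coeff (Pn n) k = coeff P k $ n" for n k by (simp add: Pn_def coeff_map_poly)
  have gh0: "g \<noteq> 0" "h \<noteq> 0" using g h by auto
  have degP: "degree P = degree g + degree h"
  proof -
    have "degree (Pn 0) = degree P"
    proof (rule antisym)
      show "degree (Pn 0) \<le> degree P" by (rule degree_le) (simp add: Pn coeff_eq_0)
      show "degree P \<le> degree (Pn 0)" by (rule le_degree) (simp add: Pn monic)
    qed
    then show ?thesis using gh0 by (simp add: Pn_def P0 degree_mult_eq)
  qed
  define slv where "slv e = (SOME uv. fst uv * h + g * snd uv = e \<and> degree (fst uv) < degree g \<and> degree (snd uv) < degree h)" for e
  have slv: "fst (slv e) * h + g * snd (slv e) = e \<and> degree (fst (slv e)) < degree g \<and> degree (snd (slv e)) < degree h"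
    if "degree e < degree g + degree h" for e
    unfolding slv_def using sol[OF that] by (rule_tac someI_ex) auto
  define u where "u n = fst (hensel_seq slv Pn (g, h) n)" for n
  define v where "v n = snd (hensel_seq slv Pn (g, h) n)" for n
  have uv0: "u 0 = g" "v 0 = h" by (simp_all add: u_def v_def hensel_seq.simps)
  define e where "e n = Pn n - (\<Sum>i\<in>{1..<n}. u i * v (n - i))" for n
  have uvn: "u n = fst (slv (e n))" "v n = snd (slv (e n))" if "n > 0" for n
    unfolding u_def v_def e_def using that by (subst hensel_seq.simps, simp)+
  have main: "degree (u n) < degree g \<and> degree (v n) < degree h \<and> u n * h + g * v n = e n" if "n > 0" for n
    using that
  proof (induction n rule: less_induct)
    case (less n)
    have "degree (e n) < degree g + degree h"
      unfolding e_def
    proof (rule degree_diff_less)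
      show "degree (Pn n) < degree g + degree h"
      proof (rule degree_lessI)
        show "Pn n \<noteq> 0 \<or> 0 < degree g + degree h" using g by simp
        show "\<forall>k\<ge>degree g + degree h. coeff (Pn n) k = 0"
        proof (intro allI impI)
          fix k assume "k \<ge> degree g + degree h"
          then consider "k = degree P" | "k > degree P" using degP by linarith
          then show "coeff (Pn n) k = 0"
            using less.prems monic by cases (simp_all add: Pn coeff_eq_0)
        qed
      qed
      have "degree (\<Sum>i\<in>{1..<n}. u i * v (n - i)) \<le> degree g + degree h - 1"
      proof (rule degree_sum_le)
        fix i assume i: "i \<in> {1..<n}"
        then have "degree (u i) < degree g" "degree (v (n - i)) < degree h"
          using less.IH[of i] less.IH[of "n - i"] by auto
        then show "degree (u i * v (n - i)) \<le> degree g + degree h - 1"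
          using degree_mult_le[of "u i" "v (n - i)"] by linarith
      qed simp
      then show "degree (\<Sum>i\<in>{1..<n}. u i * v (n - i)) < degree g + degree h" using g by linarith
    qed
    from slv[OF this] show ?case using uvn[OF less.prems] by simp
  qed
  have conv: "(\<Sum>i\<le>n. u i * v (n - i)) = Pn n" for n
  proof (cases "n = 0")
    case True
    then show ?thesis by (simp add: uv0 Pn_def P0)
  next
    case False
    have "{..n} = insert 0 (insert n {1..<n})" using False by auto
    then have "(\<Sum>i\<le>n. u i * v (n - i)) = u 0 * v n + (u n * v 0 + (\<Sum>i\<in>{1..<n}. u i * v (n - i)))"
      using False by simp
    then show ?thesis using main[of n] False by (simp add: uv0 e_def algebra_simps)
  qed
  have du: "degree (u n) \<le> degree g" for n using main[of n] uv0 by (cases "n = 0") auto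
  have dv: "degree (v n) \<le> degree h" for n using main[of n] uv0 by (cases "n = 0") auto
  define G where "G = (\<Sum>k\<le>degree g. monom (Abs_fps (\<lambda>n. coeff (u n) k)) k)"
  define H where "H = (\<Sum>k\<le>degree h. monom (Abs_fps (\<lambda>n. coeff (v n) k)) k)"
  have cG: "coeff G k = Abs_fps (\<lambda>n. coeff (u n) k)" for k
  proof (cases "k \<le> degree g")
    case False
    then have "coeff (u n) k = 0" for n using du[of n] by (intro coeff_eq_0) simp
    then show ?thesis using False by (simp add: G_def coeff_sum fps_eq_iff)
  qed (simp add: G_def coeff_sum)
  have cH: "coeff H k = Abs_fps (\<lambda>n. coeff (v n) k)" for k
  proof (cases "k \<le> degree h")
    case False
    then have "coeff (v n) k = 0" for n using dv[of n] by (intro coeff_eq_0) simp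
    then show ?thesis using False by (simp add: H_def coeff_sum fps_eq_iff)
  qed (simp add: H_def coeff_sum)
  have "P = G * H"
  proof (rule poly_eqI, rule fps_ext)
    fix k n
    have "coeff (G * H) k $ n = (\<Sum>a\<le>k. \<Sum>i=0..n. coeff (u i) a * coeff (v (n - i)) (k - a))"
      by (simp add: coeff_mult fps_sum_nth fps_mult_nth cG cH)
    also have "\<dots> = (\<Sum>i\<le>n. \<Sum>a\<le>k. coeff (u i) a * coeff (v (n - i)) (k - a))"
      by (subst sum.swap) (simp add: atLeast0AtMost)
    also have "\<dots> = coeff (\<Sum>i\<le>n. u i * v (n - i)) k" by (simp add: coeff_sum coeff_mult)
    finally show "coeff P k $ n = coeff (G * H) k $ n" by (simp add: conv Pn)
  qed
  moreover have lG: "coeff G (degree g) = 1"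
    unfolding cG
  proof (rule fps_ext)
    fix n show "Abs_fps (\<lambda>n. coeff (u n) (degree g)) $ n = 1 $ n"
      using main[of n] g uv0 by (cases "n = 0") (simp_all add: coeff_eq_0)
  qed
  moreover have lH: "coeff H (degree h) = 1"
    unfolding cH
  proof (rule fps_ext)
    fix n show "Abs_fps (\<lambda>n. coeff (v n) (degree h)) $ n = 1 $ n"
      using main[of n] h uv0 by (cases "n = 0") (simp_all add: coeff_eq_0)
  qed
  moreover have "degree G = degree g"
  proof (rule antisym)
    show "degree G \<le> degree g" unfolding G_def
      by (rule degree_sum_le) (auto intro: order.trans[OF degree_monom_le])
    show "degree g \<le> degree G" by (rule le_degree) (simp add: lG)
  qed
  moreover have "degree H = degree h"
  proof (rule antisym)
    show "degree H \<le> degree h" unfolding H_def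
      by (rule degree_sum_le) (auto intro: order.trans[OF degree_monom_le])
    show "degree h \<le> degree H" by (rule le_degree) (simp add: lH)
  qed
  ultimately show ?thesis by (intro exI[of _ G] exI[of _ H]) simp
qed

text \<open>The quotient of \<open>e\<close> by \<open>h\<close> is expanded in powers of
  \<open>T - \<rho>\<close>, one digit per step, which is possible because \<open>h\<close> does not
  vanish at \<open>\<rho>\<close>. This supplies the Bezout equations for Hensel's lemma.\<close>

lemma linear_power_bezout:
  fixes h :: "'f::field poly"
  assumes h: "poly h \<rho> \<noteq> 0"
  shows "\<exists>u. (u = 0 \<or> degree u < k) \<and> [:- \<rho>, 1:] ^ k dvd e - u * h"
proof (induction k)
  case 0
  then show ?case by (intro exI[of _ 0]) simp
next
  case (Suc k)
  let ?l = "[:- \<rho>, 1:]"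
  obtain u w where u: "u = 0 \<or> degree u < k" and w: "e - u * h = ?l ^ k * w"
    using Suc.IH by (auto elim!: dvdE)
  define a where "a = poly w \<rho> / poly h \<rho>"
  have "poly (w - smult a h) \<rho> = 0" using h by (simp add: a_def)
  then obtain w' where w': "w - smult a h = ?l * w'" by (meson poly_eq_0_iff_dvd dvdE)
  have "e - (u + smult a (?l ^ k)) * h = ?l ^ k * w - smult a (?l ^ k) * h"
    using w by (simp add: algebra_simps)
  also have "\<dots> = ?l ^ k * (w - smult a h)" by (simp add: algebra_simps)
  also have "\<dots> = ?l ^ Suc k * w'" unfolding w' by (simp only: power_Suc mult_ac)
  finally have "?l ^ Suc k dvd e - (u + smult a (?l ^ k)) * h" by simp
  moreover have "degree (u + smult a (?l ^ k)) < Suc k"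
  proof (rule le_imp_less_Suc, rule degree_add_le)
    show "degree u \<le> k" using u by auto
    show "degree (smult a (?l ^ k)) \<le> k"
      by (rule order.trans[OF degree_smult_le]) (simp add: degree_linear_power)
  qed
  ultimately show ?case by blast
qed

text \<open>
  Puiseux series are represented by Laurent series in an \<open>N\<close>-th root of the parameter: \<open>cpw N\<close> embeds the
  Laurent series in the parameter itself.
\<close>

definition cpw :: "nat \<Rightarrow> 'f::field fls \<Rightarrow> 'f fls" where
  "cpw N f = fls_compose_power f N"

lemma field_hom_cpw: "N > 0 \<Longrightarrow> field_hom (cpw N :: 'f::field fls \<Rightarrow> 'f fls)"
  by unfold_locales (simp_all add: cpw_def)

lemma cpw_nth: "N > 0 \<Longrightarrow> fls_nth (cpw N f) n = (if int N dvd n then fls_nth f (n div int N) else 0)"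
  by (simp add: cpw_def fls_nth_compose_power)

lemma cpw_cpw: assumes "M > 0" "N > 0" shows "cpw M (cpw N f) = cpw (M * N) f"
proof (rule fls_eqI)
  fix n
  have "int M * int N dvd n \<longleftrightarrow> int M dvd n \<and> int N dvd n div int M"
    using assms by (auto elim!: dvdE simp: mult.assoc)
  then show "fls_nth (cpw M (cpw N f)) n = fls_nth (cpw (M * N) f) n"
    using assms by (auto simp: cpw_nth zdiv_zmult2_eq)
qed

definition puiseux_splits :: "'f::field fls poly \<Rightarrow> bool" where
  "puiseux_splits p \<longleftrightarrow> (\<exists>N>0. \<exists>rs. map_poly (cpw N) p = (\<Prod>r\<leftarrow>rs. [:- r, 1:]))"

lemma map_poly_cpw_cpw:
  assumes "M > 0" "N > 0" shows "map_poly (cpw M) (map_poly (cpw N) p) = map_poly (cpw (M * N)) (p :: 'f::field fls poly)"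
proof -
  interpret M: field_hom "cpw M :: 'f fls \<Rightarrow> _" by (rule field_hom_cpw) fact
  interpret N: field_hom "cpw N :: 'f fls \<Rightarrow> _" by (rule field_hom_cpw) fact
  interpret MN: field_hom "cpw (M * N) :: 'f fls \<Rightarrow> _" by (rule field_hom_cpw) (use assms in simp)
  show ?thesis by (rule poly_eqI) (simp add: cpw_cpw assms)
qed

lemma map_poly_linear_prod:
  fixes \<theta> :: "'a::field \<Rightarrow> 'b::field"
  assumes "field_hom \<theta>"
  shows "map_poly \<theta> (\<Prod>r\<leftarrow>rs. [:- r, 1:]) = (\<Prod>r\<leftarrow>map \<theta> rs. [:- r, 1:])"
proof -
  interpret t: field_hom \<theta> by fact
  interpret tp: map_poly_inj_idom_hom \<theta> ..
  show ?thesis by (induction rs) (simp_all add: tp.hom_mult hom_distribs del: mult_pCons_left mult_pCons_right)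
qed

lemma lead_coeff_linear_prod: "lead_coeff (\<Prod>r\<leftarrow>rs. [:- r, 1:]) = (1 :: 'a::idom)"
  by (induction rs) (simp_all add: lead_coeff_mult del: mult_pCons_left)

lemma puiseux_splits_cpw:
  assumes "N > 0" "puiseux_splits (map_poly (cpw N) p)" shows "puiseux_splits (p :: 'f::field fls poly)"
proof -
  obtain M rs where "M > 0" "map_poly (cpw M) (map_poly (cpw N) p) = (\<Prod>r\<leftarrow>rs. [:- r, 1:])"
    using assms(2) by (auto simp: puiseux_splits_def)
  then show ?thesis using assms(1) unfolding puiseux_splits_def
    by (intro exI[of _ "M * N"] conjI exI[of _ rs]) (simp_all add: map_poly_cpw_cpw)
qed

text \<open>Both factors are moved to the product of their ramification indices.\<close>

lemma puiseux_splits_mult: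
  fixes p q :: "'f::field fls poly"
  assumes "puiseux_splits p" "puiseux_splits q" shows "puiseux_splits (p * q)"
proof -
  obtain M rs where M: "M > 0" "map_poly (cpw M) p = (\<Prod>r\<leftarrow>rs. [:- r, 1:])"
    using assms(1) by (auto simp: puiseux_splits_def)
  obtain N ss where N: "N > 0" "map_poly (cpw N) q = (\<Prod>r\<leftarrow>ss. [:- r, 1:])"
    using assms(2) by (auto simp: puiseux_splits_def)
  have MN: "M * N > 0" using M N by simp
  interpret MN: field_hom "cpw (M * N) :: 'f fls \<Rightarrow> _" by (rule field_hom_cpw) fact
  interpret MNp: map_poly_inj_idom_hom "cpw (M * N) :: 'f fls \<Rightarrow> _" ..
  have "map_poly (cpw (M * N)) p = (\<Prod>r\<leftarrow>map (cpw N) rs. [:- r, 1:])"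
    using map_poly_cpw_cpw[OF N(1) M(1), of p] M(2) map_poly_linear_prod[OF field_hom_cpw[OF N(1)], of rs]
    by (simp add: mult.commute)
  moreover have "map_poly (cpw (M * N)) q = (\<Prod>r\<leftarrow>map (cpw M) ss. [:- r, 1:])"
    using map_poly_cpw_cpw[OF M(1) N(1), of q] N(2) map_poly_linear_prod[OF field_hom_cpw[OF M(1)], of ss]
    by simp
  ultimately have "map_poly (cpw (M * N)) (p * q) = (\<Prod>r\<leftarrow>map (cpw N) rs @ map (cpw M) ss. [:- r, 1:])"
    by (simp add: MNp.hom_mult)
  with MN show ?thesis unfolding puiseux_splits_def by blast
qed

text \<open>The roots of \<open>p\<close> are recovered as \<open>A + B r\<close>, and comparison of
  leading coefficients removes the scalars.\<close>

lemma puiseux_splits_affine: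
  fixes p :: "'f::field fls poly"
  assumes b: "b \<noteq> 0" and c: "c \<noteq> 0" and p: "lead_coeff p = 1" and s: "puiseux_splits (smult c (p \<circ>\<^sub>p [:a, b:]))"
  shows "puiseux_splits p"
proof -
  obtain N rs where N: "N > 0" "map_poly (cpw N) (smult c (p \<circ>\<^sub>p [:a, b:])) = (\<Prod>r\<leftarrow>rs. [:- r, 1:])"
    using s by (auto simp: puiseux_splits_def)
  interpret N: field_hom "cpw N :: 'f fls \<Rightarrow> _" by (rule field_hom_cpw) fact
  define P A B C where "P = map_poly (cpw N) p" and "A = cpw N a" and "B = cpw N b" and "C = cpw N c"
  have BC: "B \<noteq> 0" "C \<noteq> 0" using b c by (auto simp: B_def C_def)
  have "smult C (P \<circ>\<^sub>p [:A, B:]) = (\<Prod>r\<leftarrow>rs. [:- r, 1:])"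
    using N(2) by (simp add: hom_distribs P_def A_def B_def C_def)
  then have "smult C (P \<circ>\<^sub>p [:A, B:]) \<circ>\<^sub>p [:- A / B, inverse B:] = (\<Prod>r\<leftarrow>rs. [:- r, 1:]) \<circ>\<^sub>p [:- A / B, inverse B:]"
    by simp
  also have "smult C (P \<circ>\<^sub>p [:A, B:]) \<circ>\<^sub>p [:- A / B, inverse B:] = smult C P"
  proof -
    have "[:A, B:] \<circ>\<^sub>p [:- A / B, inverse B:] = [:0, 1:]" using BC by (simp add: pcompose_pCons)
    then show ?thesis by (simp add: pcompose_smult pcompose_assoc[symmetric] pcompose_idR del: pcompose_pCons)
  qed
  also have "(\<Prod>r\<leftarrow>rs. [:- r, 1:]) \<circ>\<^sub>p [:- A / B, inverse B:] = smult (inverse B ^ length rs) (\<Prod>r\<leftarrow>map (\<lambda>r. A + B * r) rs. [:- r, 1:])"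
  proof (induction rs)
    case (Cons r rs)
    have "[:- r, 1:] \<circ>\<^sub>p [:- A / B, inverse B:] = smult (inverse B) [:- (A + B * r), 1:]"
      using BC by (simp add: pcompose_pCons field_simps)
    then show ?case using Cons by (simp add: pcompose_mult mult_ac del: mult_pCons_left mult_pCons_right smult_pCons pcompose_pCons)
  qed simp
  finally have eq: "smult C P = smult (inverse B ^ length rs) (\<Prod>r\<leftarrow>map (\<lambda>r. A + B * r) rs. [:- r, 1:])" .
  define Q where "Q = (\<Prod>r\<leftarrow>map (\<lambda>r. A + B * r) rs. [:- r, 1:])"
  have lQ: "lead_coeff Q = 1" unfolding Q_def by (rule lead_coeff_linear_prod)
  have lP: "lead_coeff P = 1" using p by (simp add: P_def)
  have eq': "smult C P = smult (inverse B ^ length rs) Q" using eq by (simp only: Q_def)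
  have C: "C = inverse B ^ length rs" using arg_cong[OF eq', of lead_coeff]
    by (simp only: lead_coeff_smult lP lQ mult_1_right)
  have "smult C (P - Q) = 0" using eq' unfolding C[symmetric] by (simp add: smult_diff_right)
  then have "P = Q" using BC by simp
  then have "map_poly (cpw N) p = (\<Prod>r\<leftarrow>map (\<lambda>r. A + B * r) rs. [:- r, 1:])" by (simp only: P_def Q_def)
  then show ?thesis using N(1) unfolding puiseux_splits_def by blast
qed

section \<open>The Newton-Puiseux theorem\<close>

lemma fls_regpart_eq: "(\<And>n. n < 0 \<Longrightarrow> fls_nth f n = 0) \<Longrightarrow> fps_to_fls (fls_regpart f) = f"
  by (rule fls_eqI) (simp add: fls_regpart_as_fls_nth)

lemma linear_decomp:
  fixes p :: "'f::field poly"
  assumes "p \<noteq> 0" "poly p \<rho> = 0"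
  obtains k h where "k > 0" "p = [:- \<rho>, 1:] ^ k * h" "poly h \<rho> \<noteq> 0"
proof -
  obtain h where h: "p = [:- \<rho>, 1:] ^ order \<rho> p * h" "\<not> [:- \<rho>, 1:] dvd h"
    using order_decomp[OF assms(1), of \<rho>] by blast
  have "order \<rho> p > 0" using assms by (simp add: order_root)
  then show ?thesis using h by (intro that) (auto simp: poly_eq_0_iff_dvd)
qed

lemma pcompose_monom_power: "monom c n \<circ>\<^sub>p q = smult c (q ^ n)" for q :: "'a::comm_semiring_1 poly"
  by (induction n) (simp_all add: monom_0 monom_Suc pcompose_pCons)

lemma coeff_linear_power_subleading:
  "n > 0 \<Longrightarrow> coeff ([:a, 1:] ^ n) (n - 1) = of_nat n * (a :: 'a::comm_ring_1)"
  by (subst coeff_linear_poly_power) (cases n; simp)+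

lemma X_power: "[:0, 1:] ^ n = monom (1 :: 'a::comm_semiring_1) n"
  by (simp only: x_as_monom x_pow_n)

text \<open>For the Tschirnhaus shift: in characteristic zero a suitable \<open>a\<close> makes the
  subleading coefficient vanish.\<close>

lemma coeff_shift_subleading:
  fixes p :: "'f::idom poly"
  assumes n: "n > 0" and p: "degree p = n" "lead_coeff p = 1"
  shows "coeff (p \<circ>\<^sub>p [:a, 1:]) (n - 1) = of_nat n * a + coeff p (n - 1)"
proof -
  define r where "r = p - monom 1 n - monom (coeff p (n - 1)) (n - 1)"
  have "coeff r i = 0" if "i \<ge> n - 1" for i
    using that p n by (cases "i = n"; cases "i = n - 1") (auto simp: r_def coeff_eq_0)
  then have "r = 0 \<or> degree r < n - 1" by (metis leading_coeff_0_iff not_le)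
  then have r: "coeff (r \<circ>\<^sub>p [:a, 1:]) (n - 1) = 0"
    by (elim disjE) (simp, intro coeff_eq_0, simp add: degree_pcompose)
  have "p = monom 1 n + monom (coeff p (n - 1)) (n - 1) + r" by (simp add: r_def)
  then have "p \<circ>\<^sub>p [:a, 1:] = [:a, 1:] ^ n + smult (coeff p (n - 1)) ([:a, 1:] ^ (n - 1)) + r \<circ>\<^sub>p [:a, 1:]"
    by (metis pcompose_add pcompose_monom_power smult_1_left)
  then show ?thesis using r coeff_linear_power_subleading[OF n, of a] coeff_linear_power[of a "n - 1"] by simp
qed

text \<open>Induction on the degree. Shift away the subleading coefficient, then rescale by the
  Newton slope so that all coefficients are regular. The residual polynomial is then not a power of
  a linear one, so it has two coprime factors, which Hensel's lemma lifts.\<close>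

theorem newton_puiseux:
  fixes p :: "'f::{alg_closed_field, field_char_0} fls poly"
  assumes "lead_coeff p = 1"
  shows "puiseux_splits p"
  using assms
proof (induction "degree p" arbitrary: p rule: less_induct)
  case less
  define n where "n = degree p"
  show ?case
  proof (cases "n = 0")
    case True
    then have "p = 1" using less.prems by (metis degree_eq_zeroE lead_coeff_pCons(2) n_def one_pCons)
    interpret cpw1: field_hom "cpw 1 :: 'f fls \<Rightarrow> _" by (rule field_hom_cpw) simp
    show ?thesis unfolding puiseux_splits_def \<open>p = 1\<close>
      by (intro exI[of _ 1] conjI exI[of _ "[]"]) (simp_all add: one_pCons hom_distribs cpw_def)
  next
    case False
    then have n: "n > 0" by simp
    \<comment> \<open>The mean of the roots, so that the shifted polynomial has root sum
      zero.\<close>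
    define a where "a = - coeff p (n - 1) / of_nat n"
    define p1 where "p1 = p \<circ>\<^sub>p [:a, 1:]"
    have p1: "degree p1 = n" "lead_coeff p1 = 1"
      using less.prems lead_coeff_comp[of "[:a, 1:]" p] by (simp_all only: p1_def n_def degree_pcompose) simp_all
    have p1n: "coeff p1 (n - 1) = 0"
      unfolding p1_def using n less.prems by (subst coeff_shift_subleading) (auto simp: n_def a_def)
    have s1: "puiseux_splits p1 \<Longrightarrow> puiseux_splits p"
      using less.prems by (intro puiseux_splits_affine[of 1 1 p a]) (simp_all add: p1_def)
    define S where "S = {k. k < n \<and> coeff p1 k \<noteq> 0}"
    show ?thesis
    proof (cases "S = {}")
      case True
      have "coeff p1 k = coeff (monom 1 n) k" for k
      proof -
        consider "k < n" | "k = n" | "k > n" by linarith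
        then show ?thesis using p1 True by cases (auto simp: S_def coeff_eq_0)
      qed
      then have "p1 = monom 1 n" by (rule poly_eqI)
      also have "\<dots> = (\<Prod>r\<leftarrow>replicate n 0. [:- r, 1:])" by (simp add: prod_list_replicate X_power)
      finally have p1e: "p1 = (\<Prod>r\<leftarrow>replicate n 0. [:- r, 1:])" .
      have "map_poly (cpw 1) p1 = (\<Prod>r\<leftarrow>map (cpw 1) (replicate n 0). [:- r, 1:])"
        unfolding p1e by (rule map_poly_linear_prod[OF field_hom_cpw]) simp
      then show ?thesis using s1 unfolding puiseux_splits_def by blast
    next
      case ne: False
      have fS: "finite S" by (simp add: S_def)
      \<comment> \<open>Newton slopes: the least of these ratios is the smallest order of a root of
        \<open>p1\<close>. Below it is the fraction \<open>r / s\<close>.\<close>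
      define sl where "sl k = real_of_int (fls_subdegree (coeff p1 k)) / real (n - k)" for k
      obtain k0 where k0: "k0 \<in> S" "\<And>k. k \<in> S \<Longrightarrow> sl k0 \<le> sl k"
        using arg_min_if_finite[OF fS ne, of sl] by (metis linorder_not_less)
      define s where "s = n - k0"
      define r where "r = fls_subdegree (coeff p1 k0)"
      have s: "s > 0" using k0(1) by (simp add: s_def S_def)
      have slope: "int s * fls_subdegree (coeff p1 k) \<ge> r * int (n - k)" if "k \<in> S" for k
      proof -
        have "n - k > 0" using that by (simp add: S_def)
        then have "real_of_int r * real (n - k) \<le> real s * real_of_int (fls_subdegree (coeff p1 k))"
          using k0(2)[OF that] s unfolding sl_def r_def[symmetric] s_def[symmetric] by (simp add: field_simps)
        then have "real_of_int (r * int (n - k)) \<le> real_of_int (int s * fls_subdegree (coeff p1 k))" by simp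
        then show ?thesis by linarith
      qed
      interpret cs: field_hom "cpw s :: 'f fls \<Rightarrow> _" by (rule field_hom_cpw) fact
      \<comment> \<open>Once the parameter is replaced by its \<open>s\<close>-th power, scaling the
        unknown by \<open>b\<close> makes every coefficient regular and leaves that of index
        \<open>k0\<close> nonzero at the origin.\<close>
      define b :: "'f fls" where "b = fls_X_intpow r"
      have b: "b \<noteq> 0" by (simp add: b_def)
      have bpow: "b ^ k = fls_X_intpow (int k * r)" for k by (simp add: b_def fls_X_intpow_power mult.commute)
      define q where "q = smult (inverse (b ^ n)) (map_poly (cpw s) p1 \<circ>\<^sub>p [:0, b:])"
      have cq: "coeff q k = fls_X_intpow (- (int (n - k) * r)) * cpw s (coeff p1 k)" if "k \<le> n" for k
      proof -
        have "coeff q k = inverse (b ^ n) * b ^ k * cpw s (coeff p1 k)"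
          by (simp add: q_def coeff_pcompose_linear)
        also have "inverse (b ^ n) * b ^ k = inverse (b ^ (n - k))"
          using b that by (simp add: power_diff field_simps)
        also have "\<dots> = fls_X_intpow (- (int (n - k) * r))"
          by (rule inverse_unique) (simp only: bpow fls_X_intpow_times_fls_X_intpow, simp)
        finally show ?thesis .
      qed
      have qnth: "fls_nth (coeff q k) m = fls_nth (cpw s (coeff p1 k)) (m + int (n - k) * r)" if "k \<le> n" for k m
        by (simp only: cq[OF that] fls_X_intpow_times_conv_shift fls_shift_nth) simp
      have degq: "degree q = n" "lead_coeff q = 1"
      proof -
        show dq: "degree q = n" using b p1 by (simp add: q_def degree_pcompose)
        show "lead_coeff q = 1" unfolding dq using cq[of n] p1 by simp
      qed
      have reg: "fls_nth (coeff q k) m = 0" if "m < 0" for k m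
      proof (cases "k \<in> S")
        case True
        then have kn: "k \<le> n" by (simp add: S_def)
        show ?thesis
        proof (cases "int s dvd m + int (n - k) * r")
          case dv: True
          then obtain t where t: "m + int (n - k) * r = int s * t" unfolding dvd_def by blast
          have "int s * t < int s * fls_subdegree (coeff p1 k)"
            using slope[OF True] that t by (simp add: mult.commute)
          then have "t < fls_subdegree (coeff p1 k)" using s by simp
          then show ?thesis using s by (simp add: qnth[OF kn] cpw_nth t)
        qed (simp add: qnth[OF kn] cpw_nth s)
      next
        case nS: False
        show ?thesis
        proof (cases "k = n")
          case True
          then show ?thesis using degq that by simp
        next
          case False
          then have "coeff q k = 0" using nS degq cq[of k] by (cases "k < n") (auto simp: S_def coeff_eq_0)
          then show ?thesis by simp
        qed
      qed
      define Q where "Q = map_poly fls_regpart q"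
      have cQ: "coeff Q k = fls_regpart (coeff q k)" for k by (simp add: Q_def coeff_map_poly)
      have Qq: "map_poly fps_to_fls Q = q"
        by (rule poly_eqI) (simp add: coeff_map_poly cQ fls_regpart_eq reg)
      have degQ: "degree Q = n" "lead_coeff Q = 1"
      proof -
        have "coeff Q n = 1" using degq by (simp add: cQ)
        moreover have "degree Q \<le> n" by (rule degree_le) (use degq in \<open>auto simp: cQ coeff_eq_0\<close>)
        ultimately show "degree Q = n" by (metis le_antisym le_degree zero_neq_one)
        with \<open>coeff Q n = 1\<close> show "lead_coeff Q = 1" by simp
      qed
      define Q0 where "Q0 = map_poly (\<lambda>f. f $ 0) Q"
      have cQ0: "coeff Q0 k = fls_nth (coeff q k) 0" for k by (simp add: Q0_def coeff_map_poly cQ)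
      have degQ0: "degree Q0 = n" "lead_coeff Q0 = 1"
      proof -
        have "coeff Q0 n = 1" using degq by (simp add: cQ0)
        moreover have "degree Q0 \<le> n" by (rule degree_le) (use degq in \<open>auto simp: cQ0 coeff_eq_0\<close>)
        ultimately show "degree Q0 = n" by (metis le_antisym le_degree zero_neq_one)
        with \<open>coeff Q0 n = 1\<close> show "lead_coeff Q0 = 1" by simp
      qed
      have Q0n: "coeff Q0 (n - 1) = 0" using cq[of "n - 1"] p1n by (simp add: cQ0)
      have Q0k: "coeff Q0 k0 \<noteq> 0"
      proof -
        have k0n: "k0 \<le> n" "coeff p1 k0 \<noteq> 0" using k0(1) by (auto simp: S_def)
        have "coeff Q0 k0 = fls_nth (coeff p1 k0) r"
          using s unfolding cQ0 qnth[OF k0n(1)] by (simp add: cpw_nth s_def[symmetric])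
        then show ?thesis using k0n(2) by (simp add: r_def)
      qed
      have "Q0 \<noteq> 0" using degQ0 by auto
      obtain \<rho> where \<rho>: "poly Q0 \<rho> = 0" using alg_closed_imp_poly_has_root[of Q0] degQ0 n by auto
      obtain k h where k: "k > 0" "Q0 = [:- \<rho>, 1:] ^ k * h" "poly h \<rho> \<noteq> 0"
        using linear_decomp[OF \<open>Q0 \<noteq> 0\<close> \<rho>] by blast
      define g where "g = [:- \<rho>, 1:] ^ k"
      have g: "lead_coeff g = 1" "degree g = k" unfolding g_def
        by (simp_all add: degree_linear_power coeff_linear_power)
      have h0: "h \<noteq> 0" "g \<noteq> 0" using k(3) g by auto
      have Q0gh: "Q0 = g * h" using k(2) by (simp only: g_def)
      have hm: "lead_coeff h = 1" using degQ0(2) g unfolding Q0gh by (simp add: lead_coeff_mult)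
      have dh: "n = k + degree h" using degQ0(1) h0 g unfolding Q0gh by (simp add: degree_mult_eq)
      \<comment> \<open>A single residual root \<open>\<rho>\<close> would give the subleading
        coefficient \<open>- n \<rho> = 0\<close>, hence \<open>Q0 = T\<^sup>n\<close>, against the
        nonzero coefficient at \<open>k0\<close>.\<close>
      have "degree h > 0"
      proof (rule ccontr)
        assume "\<not> ?thesis"
        then have "degree h = 0" by simp
        then have "h = 1" using hm by (metis degree_eq_zeroE lead_coeff_pCons(2) one_pCons)
        then have Q0e: "Q0 = [:- \<rho>, 1:] ^ n" using Q0gh dh by (simp add: g_def)
        have "coeff Q0 (n - 1) = of_nat n * (- \<rho>)" unfolding Q0e
          by (rule coeff_linear_power_subleading[OF n])
        then have "\<rho> = 0" using Q0n n by simp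
        then have "Q0 = monom 1 n" using Q0e by (simp add: X_power)
        then show False using Q0k k0(1) by (simp add: S_def)
      qed
      have "\<exists>u v. u * h + g * v = e \<and> degree u < degree g \<and> degree v < degree h" if e: "degree e < degree g + degree h" for e
      proof -
        obtain u v where u: "u = 0 \<or> degree u < k" and v: "e - u * h = g * v"
          using linear_power_bezout[OF k(3), of k e] unfolding g_def dvd_def by blast
        have u': "degree u < k" using u k(1) by auto
        have "degree (u * h) < k + degree h"
          using degree_mult_le[of u h] u' by linarith
        then have *: "degree (g * v) < k + degree h" using e g unfolding v[symmetric]
          by (intro degree_diff_less) auto
        have "degree v < degree h"
        proof (cases "v = 0")
          case False
          then show ?thesis using * h0 g by (simp add: degree_mult_eq)
        qed (use \<open>degree h > 0\<close> in simp)
        moreover have "u * h + g * v = e" unfolding v[symmetric] by simp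
        ultimately show ?thesis using u' g by blast
      qed
      from hensel_fps[OF degQ(2) Q0gh[unfolded Q0_def] g(1) _ hm \<open>degree h > 0\<close> this] g k(1)
      obtain G H where GH: "Q = G * H" "lead_coeff G = 1" "lead_coeff H = 1" "degree G = degree g" "degree H = degree h"
        by auto
      interpret fl: inj_comm_ring_hom "fps_to_fls :: 'f fps \<Rightarrow> 'f fls"
        by unfold_locales (simp_all add: fls_times_fps_to_fls)
      interpret flp: map_poly_inj_comm_ring_hom "fps_to_fls :: 'f fps \<Rightarrow> 'f fls" ..
      have "puiseux_splits (map_poly fps_to_fls G)" "puiseux_splits (map_poly fps_to_fls H)"
        using GH g dh k(1) \<open>degree h > 0\<close> by (intro less.hyps; simp add: n_def[symmetric])+
      then have "puiseux_splits q" using puiseux_splits_mult by (simp add: GH flp.hom_mult flip: Qq)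
      then have "puiseux_splits (map_poly (cpw s) p1)"
        using b p1 unfolding q_def by (intro puiseux_splits_affine[of b "inverse (b ^ n)" "map_poly (cpw s) p1" 0]) simp_all
      then show ?thesis using s1 puiseux_splits_cpw[OF s] by blast
    qed
  qed
qed

section \<open>Power series in several variables\<close>

lemmas mps_nth_simps [simp] = zero_mps.rep_eq plus_mps.rep_eq minus_mps.rep_eq uminus_mps.rep_eq

lemma mps_nth_one: "mps_nth 1 a = (if a = (\<lambda>_. 0) then 1 else 0)" by (simp add: one_mps.rep_eq)

lemma mps_nth_sum [simp]: "mps_nth (sum f A) a = (\<Sum>x\<in>A. mps_nth (f x) a)"
  by (induction A rule: infinite_finite_induct) auto

lemma mps_nth_of_nat: "mps_nth (of_nat n) a = (if a = (\<lambda>_. 0) then of_nat n else 0)"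
  by (induction n) (auto simp: mps_nth_one)

instance mps :: (finite, "{idom, ring_char_0}") ring_char_0
proof
  show "inj (of_nat :: nat \<Rightarrow> ('a, 'b) mps)"
  proof (rule injI)
    fix x y assume "of_nat x = (of_nat y :: ('a, 'b) mps)"
    from arg_cong[OF this, of "\<lambda>f. mps_nth f (\<lambda>_. 0)"] show "x = y" by (simp add: mps_nth_of_nat)
  qed
qed

lemma to_fract_of_nat: "to_fract (of_nat n :: 'a::idom) = of_nat n"
  by (induction n) simp_all

instance fract :: ("{idom, ring_char_0}") field_char_0
proof
  show "inj (of_nat :: nat \<Rightarrow> 'a fract)"
    by (rule injI) (simp flip: to_fract_of_nat)
qed

definition mdeg :: "('n::finite \<Rightarrow> nat) \<Rightarrow> nat" where "mdeg a = (\<Sum>j\<in>UNIV. a j)"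

lemma mdeg_eq_0: "mdeg a = 0 \<longleftrightarrow> a = (\<lambda>_. 0)" by (auto simp: mdeg_def)

lemma mdeg_add_pairs: "(b, c) \<in> add_pairs a \<Longrightarrow> mdeg b + mdeg c = mdeg a"
  by (simp add: add_pairs_def mdeg_def sum.distrib[symmetric])

lift_definition mps_monom :: "('n \<Rightarrow> nat) \<Rightarrow> ('n, 'k::comm_ring_1) mps" is "\<lambda>m a. if a = m then 1 else 0" .

lemma mps_nth_monom_mult:
  "mps_nth (mps_monom m * f) a = (if \<forall>j. m j \<le> a j then mps_nth f (\<lambda>j. a j - m j) else 0)"
proof (cases "\<forall>j. m j \<le> a j")
  case True
  have "mps_nth (mps_monom m * f) a = (\<Sum>(b, c)\<in>{(m, \<lambda>j. a j - m j)}. mps_nth (mps_monom m) b * mps_nth f c)"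
    unfolding mps_nth_times
  proof (rule sum.mono_neutral_right)
    show "{(m, \<lambda>j. a j - m j)} \<subseteq> add_pairs a" using True by (simp add: add_pairs_def)
    show "\<forall>p\<in>add_pairs a - {(m, \<lambda>j. a j - m j)}. (case p of (b, c) \<Rightarrow> mps_nth (mps_monom m) b * mps_nth f c) = 0"
    proof
      fix p assume p: "p \<in> add_pairs a - {(m, \<lambda>j. a j - m j)}"
      obtain b c where bc: "p = (b, c)" by fastforce
      have "b j + c j = a j" for j using p bc by (auto simp: add_pairs_def)
      then have "c j = a j - b j" for j by (metis add_diff_cancel_left')
      then have "c = (\<lambda>j. a j - b j)" by (rule ext)
      then have "b \<noteq> m" using p bc by auto
      then show "(case p of (b, c) \<Rightarrow> mps_nth (mps_monom m) b * mps_nth f c) = 0"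
        by (simp add: bc mps_monom.rep_eq)
    qed
  qed simp
  then show ?thesis using True by (simp add: mps_monom.rep_eq)
next
  case False
  have "(case p of (b, c) \<Rightarrow> mps_nth (mps_monom m) b * mps_nth f c) = 0" if "p \<in> add_pairs a" for p
  proof -
    obtain b c where bc: "p = (b, c)" by fastforce
    have "b \<noteq> m"
    proof
      assume "b = m"
      then have "\<forall>j. m j + c j = a j" using that by (simp add: bc add_pairs_def)
      then have "\<forall>j. m j \<le> a j" by (metis le_add1)
      with False show False by blast
    qed
    then show ?thesis by (simp add: bc mps_monom.rep_eq)
  qed
  then show ?thesis unfolding mps_nth_times if_not_P[OF False] by (rule sum.neutral[OF ballI])
qed

lemma mps_monom_mult: "mps_monom m * mps_monom m' = mps_monom (\<lambda>j. m j + m' j)"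
proof (rule mps_eqI)
  fix a :: "'a \<Rightarrow> nat"
  have "(\<forall>j. m j \<le> a j) \<and> (\<lambda>j. a j - m j) = m' \<longleftrightarrow> a = (\<lambda>j. m j + m' j)"
    by (auto simp: fun_eq_iff) (metis le_add_diff_inverse)
  then show "mps_nth (mps_monom m * mps_monom m') a = mps_nth (mps_monom (\<lambda>j. m j + m' j) :: ('a, 'b) mps) a"
    unfolding mps_nth_monom_mult mps_monom.rep_eq by auto
qed

lemma mps_var_power: "mps_var i ^ t = mps_monom (\<lambda>j. if j = i then t else 0)"
proof (induction t)
  case 0
  then show ?case by (intro mps_eqI) (simp add: mps_nth_one mps_monom.rep_eq)
next
  case (Suc t)
  have "mps_var i = (mps_monom (\<lambda>j. if j = i then 1 else 0) :: ('a, 'b) mps)"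
    by (intro mps_eqI) (simp add: mps_var.rep_eq mps_monom.rep_eq)
  then show ?case using Suc by (simp add: mps_monom_mult) (rule arg_cong[of _ _ mps_monom], auto)
qed

lemma mps_nth_var_power_mult:
  "mps_nth (mps_var i ^ t * f) a = (if t \<le> a i then mps_nth f (a(i := a i - t)) else 0)"
proof -
  have "(\<lambda>j. a j - (if j = i then t else 0)) = a(i := a i - t)" by auto
  moreover have "(\<forall>j. (if j = i then t else 0) \<le> a j) \<longleftrightarrow> t \<le> a i" by auto
  ultimately show ?thesis by (simp add: mps_var_power mps_nth_monom_mult)
qed

text \<open>Each exponent of the support is charged to one variable of \<open>J\<close> whose
  \<open>t\<close>-th power divides the monomial; the monomials charged to \<open>j\<close> make up
  the summand of \<open>j\<close>.\<close>

lemma mps_monomial_ideal_decomp: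
  fixes f :: "('n::finite, 'k::comm_ring_1) mps"
  assumes f: "\<And>a. mps_nth f a \<noteq> 0 \<Longrightarrow> \<exists>j\<in>J. t \<le> a j"
  obtains g where "f = (\<Sum>j\<in>J. mps_var j ^ t * g j)"
proof -
  define c where "c a = (SOME j. j \<in> J \<and> t \<le> a j)" for a :: "'n \<Rightarrow> nat"
  have c: "c a \<in> J \<and> t \<le> a (c a)" if "mps_nth f a \<noteq> 0" for a
    unfolding c_def using someI_ex[of "\<lambda>j. j \<in> J \<and> t \<le> a j"] f[OF that] by blast
  define g where "g j = Abs_mps (\<lambda>b. if c (b(j := b j + t)) = j then mps_nth f (b(j := b j + t)) else 0)" for j
  have g: "mps_nth (g j) b = (if c (b(j := b j + t)) = j then mps_nth f (b(j := b j + t)) else 0)" for j b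
    by (simp add: g_def Abs_mps_inverse)
  have "f = (\<Sum>j\<in>J. mps_var j ^ t * g j)"
  proof (rule mps_eqI)
    fix a
    have "mps_nth (mps_var j ^ t * g j) a = (if j = c a then mps_nth f a else 0)" if "j \<in> J" for j
    proof (cases "t \<le> a j")
      case True
      then have upd: "(a(j := a j - t))(j := (a(j := a j - t)) j + t) = a" by simp
      have "mps_nth (mps_var j ^ t * g j) a = mps_nth (g j) (a(j := a j - t))"
        using True by (simp only: mps_nth_var_power_mult if_True)
      then show ?thesis unfolding g upd by auto
    next
      case False
      then have "j \<noteq> c a \<or> mps_nth f a = 0" using c[of a] by blast
      then show ?thesis using False by (auto simp: mps_nth_var_power_mult)
    qed
    then have "mps_nth (\<Sum>j\<in>J. mps_var j ^ t * g j) a = (\<Sum>j\<in>J. if j = c a then mps_nth f a else 0)"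
      by simp
    also have "\<dots> = mps_nth f a" using c[of a] by (auto simp: sum.delta)
    finally show "mps_nth f a = mps_nth (\<Sum>j\<in>J. mps_var j ^ t * g j) a" ..
  qed
  then show ?thesis by (rule that)
qed

section \<open>Coefficient changes and derivations\<close>

lift_definition mps_map :: "('a \<Rightarrow> 'b) \<Rightarrow> ('n, 'a) mps \<Rightarrow> ('n, 'b) mps" is "\<lambda>k f a. k (f a)" .

lemma comm_ring_hom_mps_map:
  fixes k :: "'a::comm_ring_1 \<Rightarrow> 'b::comm_ring_1"
  assumes "comm_ring_hom k"
  shows "comm_ring_hom (mps_map k :: ('n::finite, 'a) mps \<Rightarrow> ('n, 'b) mps)"
proof -
  interpret k: comm_ring_hom k by fact
  show ?thesis
    by unfold_locales
      (auto intro!: mps_eqI simp: mps_map.rep_eq mps_nth_one mps_nth_times hom_distribs case_prod_unfold)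
qed

definition mps_const :: "'k::comm_ring_1 \<Rightarrow> ('n::finite, 'k) mps" where
  "mps_const c = mps_map (\<lambda>x. c * x) 1"

lemma mps_nth_const: "mps_nth (mps_const c) a = (if a = (\<lambda>_. 0) then c else 0)"
  by (simp add: mps_const_def mps_map.rep_eq mps_nth_one)

lemma mps_nth_const_mult [simp]:
  fixes f :: "('n::finite, 'k::comm_ring_1) mps"
  shows "mps_nth (mps_const c * f) a = c * mps_nth f a"
proof -
  have "mps_const c * f = mps_map (\<lambda>x. c * x) f"
  proof -
    have "mps_map (\<lambda>x. c * x) u * v = mps_map (\<lambda>x. c * x) (u * v)" for u v :: "('n, 'k) mps"
      by (rule mps_eqI) (simp add: mps_map.rep_eq mps_nth_times sum_distrib_left case_prod_unfold mult.assoc)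
    then show ?thesis by (simp add: mps_const_def)
  qed
  then show ?thesis by (simp add: mps_map.rep_eq)
qed

lemma comm_ring_hom_mps_const: "comm_ring_hom (mps_const :: 'k::comm_ring_1 \<Rightarrow> ('n::finite, 'k) mps)"
proof unfold_locales
  fix x y :: 'k
  show "(mps_const (x * y) :: ('n, 'k) mps) = mps_const x * mps_const y"
    by (rule mps_eqI) (simp add: mps_nth_const)
qed (auto intro!: mps_eqI simp: mps_nth_const mps_nth_one)

section \<open>Partial derivatives of power series\<close>

lift_definition mps_deriv :: "'n \<Rightarrow> ('n, 'k::comm_ring_1) mps \<Rightarrow> ('n, 'k) mps"
  is "\<lambda>j f a. of_nat (Suc (a j)) * f (a(j := Suc (a j)))" .

lemma mps_deriv_add: "mps_deriv j (f + g) = mps_deriv j f + mps_deriv j g"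
  by (rule mps_eqI) (simp only: mps_deriv.rep_eq plus_mps.rep_eq distrib_left)

text \<open>The factor \<open>Suc (a j)\<close> splits as \<open>b j + c j\<close> on each pair of
  exponents, and each half is reindexed by lowering one exponent at \<open>j\<close>.\<close>

lemma mps_deriv_mult:
  fixes f g :: "('n::finite, 'k::comm_ring_1) mps"
  shows "mps_deriv j (f * g) = f * mps_deriv j g + g * mps_deriv j f"
proof (rule mps_eqI)
  fix a
  let ?a = "a(j := Suc (a j))"
  have half: "(\<Sum>(b, c)\<in>add_pairs ?a. of_nat (b j) * (mps_nth u b * mps_nth v c)) = mps_nth (mps_deriv j u * v) a"
    for u v :: "('n, 'k) mps"
  proof -
    have "(\<Sum>(b, c)\<in>add_pairs ?a. of_nat (b j) * (mps_nth u b * mps_nth v c))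
      = (\<Sum>(b, c)\<in>{p\<in>add_pairs ?a. fst p j \<noteq> 0}. of_nat (b j) * (mps_nth u b * mps_nth v c))"
      by (rule sum.mono_neutral_right) (auto intro!: Nat.gr0I)
    also have "\<dots> = (\<Sum>(b, c)\<in>add_pairs a. mps_nth (mps_deriv j u) b * mps_nth v c)"
      by (rule sum.reindex_bij_witness[of _ "\<lambda>(b, c). (b(j := Suc (b j)), c)" "\<lambda>(b, c). (b(j := b j - 1), c)"])
        (auto simp: add_pairs_def mps_deriv.rep_eq mult.assoc split: if_splits)
    finally show ?thesis by (simp add: mps_nth_times)
  qed
  have swap: "(\<Sum>(b, c)\<in>add_pairs ?a. of_nat (c j) * (mps_nth f b * mps_nth g c))
      = (\<Sum>(b, c)\<in>add_pairs ?a. of_nat (b j) * (mps_nth g b * mps_nth f c))"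
    by (rule sum.reindex_bij_witness[of _ prod.swap prod.swap]) (auto simp: add_pairs_def add.commute mult.commute)
  have "mps_nth (mps_deriv j (f * g)) a = (\<Sum>(b, c)\<in>add_pairs ?a. of_nat (Suc (a j)) * (mps_nth f b * mps_nth g c))"
    by (simp add: mps_deriv.rep_eq mps_nth_times sum_distrib_left case_prod_unfold)
  also have "\<dots> = (\<Sum>(b, c)\<in>add_pairs ?a. of_nat (b j) * (mps_nth f b * mps_nth g c) + of_nat (c j) * (mps_nth f b * mps_nth g c))"
  proof (rule sum.cong, rule refl, clarify)
    fix b c assume "(b, c) \<in> add_pairs ?a"
    then have "b j + c j = Suc (a j)" by (auto simp: add_pairs_def)
    then show "of_nat (Suc (a j)) * (mps_nth f b * mps_nth g c)
      = of_nat (b j) * (mps_nth f b * mps_nth g c) + of_nat (c j) * (mps_nth f b * mps_nth g c)"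
      by (metis distrib_right of_nat_add)
  qed
  also have "\<dots> = mps_nth (mps_deriv j f * g) a + mps_nth (mps_deriv j g * f) a"
    by (simp only: case_prod_unfold sum.distrib) (simp only: half[unfolded case_prod_unfold] swap[unfolded case_prod_unfold])
  finally show "mps_nth (mps_deriv j (f * g)) a = mps_nth (f * mps_deriv j g + g * mps_deriv j f) a"
    by (simp add: mult.commute add.commute)
qed

lemma derivation_along_mps_deriv: "derivation_along (\<lambda>x. x) (mps_deriv j :: ('n::finite, 'k::comm_ring_1) mps \<Rightarrow> _)"
  by (simp add: derivation_along_def mps_deriv_add mps_deriv_mult)

lemma mps_deriv_const_mult: "mps_deriv j (mps_const c * f) = mps_const c * mps_deriv j f"
  by (rule mps_eqI) (simp add: mps_deriv.rep_eq mult.left_commute)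

lemma mps_deriv_map:
  assumes "comm_ring_hom k"
  shows "mps_deriv j (mps_map k f) = mps_map k (mps_deriv j f)"
proof -
  interpret k: comm_ring_hom k by fact
  show ?thesis by (rule mps_eqI) (simp add: mps_deriv.rep_eq mps_map.rep_eq hom_distribs)
qed

lemma mps_deriv_var: "mps_deriv j (mps_var i) = (if i = j then 1 else 0)"
proof (rule mps_eqI)
  fix a :: "'a \<Rightarrow> nat"
  have "a(j := Suc (a j)) = (\<lambda>l. if l = i then 1 else 0) \<longleftrightarrow> i = j \<and> a = (\<lambda>_. 0)"
    by (auto simp: fun_eq_iff split: if_splits)
  then show "mps_nth (mps_deriv j (mps_var i) :: ('a, 'b) mps) a = mps_nth (if i = j then 1 else 0) a"
    by (auto simp: mps_deriv.rep_eq mps_var.rep_eq mps_nth_one)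
qed

lemma mps_var_dvd_iff: "mps_var i dvd f \<longleftrightarrow> (\<forall>a. a i = 0 \<longrightarrow> mps_nth f a = 0)"
proof
  assume "mps_var i dvd f"
  then obtain g where "f = mps_var i ^ 1 * g" by (auto elim!: dvdE)
  then show "\<forall>a. a i = 0 \<longrightarrow> mps_nth f a = 0" by (simp only: mps_nth_var_power_mult) simp
next
  assume *: "\<forall>a. a i = 0 \<longrightarrow> mps_nth f a = 0"
  obtain g where "f = (\<Sum>j\<in>{i}. mps_var j ^ 1 * g j)"
    by (rule mps_monomial_ideal_decomp[of f "{i}" 1]) (use * in \<open>auto simp: Suc_le_eq\<close>)
  then show "mps_var i dvd f" by simp
qed

section \<open>Weierstrass division along a parameter\<close>

text \<open>Filtration of the series in the parameter by degree in the variables alone; the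
  parameter itself has weight 0.\<close>

definition xadic :: "nat \<Rightarrow> ('n::finite, 'k::comm_ring_1) mps fps set" where
  "xadic N = {s. \<forall>k a. mdeg a < N \<longrightarrow> mps_nth (s $ k) a = 0}"

lemma xadicD: "s \<in> xadic N \<Longrightarrow> mdeg a < N \<Longrightarrow> mps_nth (s $ k) a = 0" by (simp add: xadic_def)

lemma xadic_0 [simp]: "xadic 0 = UNIV" by (auto simp: xadic_def)

lemma xadic_add: "s \<in> xadic N \<Longrightarrow> s' \<in> xadic N \<Longrightarrow> s + s' \<in> xadic N" by (simp add: xadic_def)

lemma xadic_mult: assumes "s \<in> xadic N" "g \<in> xadic M" shows "s * g \<in> xadic (N + M)"
  unfolding xadic_def
proof (clarify)
  fix k and a :: "'a \<Rightarrow> nat" assume a: "mdeg a < N + M"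
  have "mps_nth (s $ i * g $ l) a = 0" for i l
    unfolding mps_nth_times
  proof (rule sum.neutral, clarify)
    fix b c assume "(b, c) \<in> add_pairs a"
    then have "mdeg b < N \<or> mdeg c < M" using a mdeg_add_pairs by force
    then show "mps_nth (s $ i) b * mps_nth (g $ l) c = 0" using assms xadicD by fastforce
  qed
  then show "mps_nth ((s * g) $ k) a = 0" by (simp add: fps_mult_nth)
qed

lemma xadic_separated: "(\<And>N. s \<in> xadic N) \<Longrightarrow> s = 0"
  by (rule fps_ext, rule mps_eqI) (metis fps_zero_nth lessI xadicD zero_mps.rep_eq)

text \<open>Picard iteration of \<open>q \<mapsto> p - T q\<close>: as \<open>T\<close> raises the
  degree in the variables, successive stages agree to ever higher degree, and a solution of the
  homogeneous equation has infinite order.\<close>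

lemma xadic_contraction:
  fixes T :: "('n::finite, 'k::comm_ring_1) mps fps \<Rightarrow> ('n, 'k) mps fps"
  assumes T: "\<And>u v. T (u - v) = T u - T v" "\<And>N s. s \<in> xadic N \<Longrightarrow> T s \<in> xadic (Suc N)"
  shows "\<exists>q. q + T q = p" "q + T q = 0 \<Longrightarrow> q = 0"
proof -
  define Q where "Q N = rec_nat 0 (\<lambda>_ q. p - T q) N" for N :: nat
  have Q: "Q 0 = 0" "Q (Suc N) = p - T (Q N)" for N by (simp_all add: Q_def)
  have step: "Q (Suc N) - Q N \<in> xadic N" for N
  proof (induction N)
    case (Suc N)
    have "Q (Suc (Suc N)) - Q (Suc N) = - (T (Q (Suc N) - Q N))" by (simp add: Q(2) T(1))
    then show ?case using T(2)[OF Suc] by (simp add: xadic_def)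
  qed simp
  have stable: "mps_nth (Q M $ k) a = mps_nth (Q N $ k) a" if "mdeg a < N" "N \<le> M" for M N k a
    using that(2)
  proof (induction M rule: dec_induct)
    case (step M)
    then show ?case using xadicD[OF \<open>\<And>N. Q (Suc N) - Q N \<in> xadic N\<close>[of M], of a k] that(1) by simp
  qed simp
  \<comment> \<open>The coefficient at \<open>a\<close> is final from stage
    \<open>mdeg a + 1\<close> on.\<close>
  define q where "q = Abs_fps (\<lambda>k. Abs_mps (\<lambda>a. mps_nth (Q (Suc (mdeg a)) $ k) a))"
  have q: "mps_nth (q $ k) a = mps_nth (Q (Suc (mdeg a)) $ k) a" for k a
    by (simp add: q_def Abs_mps_inverse)
  have qQ: "q - Q N \<in> xadic N" for N
    unfolding xadic_def
  proof (clarify)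
    fix k and a :: "'n \<Rightarrow> nat" assume "mdeg a < N"
    then show "mps_nth ((q - Q N) $ k) a = 0"
      using stable[of a "Suc (mdeg a)" N k] by (simp add: q)
  qed
  have "q + T q = p"
  proof -
    have "q + T q - p \<in> xadic N" for N
    proof -
      have "q + T q - p = (q - Q (Suc N)) + T (q - Q N)" by (simp add: Q(2) T(1))
      also have "\<dots> \<in> xadic N"
      proof (rule xadic_add)
        show "q - Q (Suc N) \<in> xadic N" using qQ[of "Suc N"] by (auto simp: xadic_def)
        show "T (q - Q N) \<in> xadic N" using T(2)[OF qQ[of N]] by (auto simp: xadic_def)
      qed
      finally show ?thesis .
    qed
    then have "q + T q - p = 0" by (rule xadic_separated)
    then show ?thesis by simp
  qed
  then show "\<exists>q. q + T q = p" ..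
  show "q + T q = 0 \<Longrightarrow> q = 0" for q
  proof -
    assume "q + T q = 0"
    then have e: "q = - T q" by (simp add: eq_neg_iff_add_eq_0)
    have "q \<in> xadic N" for N
    proof (induction N)
      case (Suc N)
      then show ?case by (subst e) (use T(2) in \<open>simp add: xadic_def\<close>)
    qed simp
    then show "q = 0" by (rule xadic_separated)
  qed
qed

text \<open>Geometric series: after the constant term is normalised to 1, inversion is a contraction
  problem. The series is regarded as constant in the parameter so that
  \<open>xadic_contraction\<close> applies.\<close>

lemma mps_unit:
  fixes f :: "('n::finite, 'k::field) mps"
  assumes "mps_nth f (\<lambda>_. 0) \<noteq> 0"
  shows "\<exists>g. f * g = 1"
proof -
  define c where "c = mps_nth f (\<lambda>_. 0)"
  interpret mc: comm_ring_hom "mps_const :: 'k \<Rightarrow> ('n, 'k) mps" by (rule comm_ring_hom_mps_const)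
  define n where "n = mps_const (inverse c) * f - 1"
  have n: "fps_const n \<in> xadic 1"
    using assms by (auto simp: xadic_def n_def mdeg_eq_0 mps_nth_one c_def)
  obtain q where q: "q + q * fps_const n = 1"
    using xadic_contraction(1)[of "\<lambda>q. q * fps_const n" 1] xadic_mult[OF _ n]
    by (auto simp: left_diff_distrib)
  have "(q + q * fps_const n) $ 0 = q $ 0 * (1 + n)" by (simp add: algebra_simps)
  then have "q $ 0 * (1 + n) = 1" unfolding q by simp
  then have "f * (mps_const (inverse c) * q $ 0) = 1" by (simp add: n_def mult_ac)
  then show ?thesis ..
qed

lemma comm_ring_hom_comp:
  assumes "comm_ring_hom f" "comm_ring_hom g" shows "comm_ring_hom (\<lambda>x. f (g x))"
proof -
  interpret f: comm_ring_hom f by fact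
  interpret g: comm_ring_hom g by fact
  show ?thesis by unfold_locales (simp_all only: g.hom_add g.hom_mult g.hom_one g.hom_zero f.hom_add f.hom_mult f.hom_one f.hom_zero)
qed

lemma fps_unit:
  fixes f :: "'a::comm_ring_1 fps"
  assumes "f $ 0 * y = 1" shows "\<exists>g. f * g = 1"
  using fps_right_inverse[OF assms] by blast

lemma xadic_shift: "s \<in> xadic N \<Longrightarrow> fps_shift d s \<in> xadic N" by (simp add: xadic_def)

lemma fps_of_poly_cutoff: "\<exists>r. fps_of_poly r = fps_cutoff d (s :: 'a::comm_ring_1 fps) \<and> (\<forall>k\<ge>d. coeff r k = 0)"
proof -
  define r where "r = (\<Sum>k<d. monom (s $ k) k)"
  have "coeff r k = (if k < d then s $ k else 0)" for k
    by (simp add: r_def coeff_sum)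
  then show ?thesis by (intro exI[of _ r]) (auto simp: fps_eq_iff)
qed

text \<open>Regularity of order \<open>d\<close>: with all variables set to 0, \<open>G\<close>
  becomes a unit times the \<open>d\<close>-th power of the parameter.\<close>

locale weierstrass =
  fixes G :: "('n::finite, 'q::field) mps fps" and d :: nat
  assumes low: "k < d \<Longrightarrow> mps_nth (G $ k) (\<lambda>_. 0) = 0" and top: "mps_nth (G $ d) (\<lambda>_. 0) \<noteq> 0"
begin

text \<open>Write \<open>G = U t\<^sup>d + L\<close> with \<open>U\<close> invertible, with inverse
  \<open>V\<close>, and \<open>L\<close> without constant terms in the variables. For a quotient of
  the form \<open>q V\<close> the part of degree at least \<open>d\<close> in \<open>t\<close> reads
  \<open>q + T q\<close>, where \<open>T\<close> gains one degree in the variables; existence and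
  uniqueness both come from the contraction.\<close>

lemma division:
  "\<exists>q r. s = q * G + fps_of_poly r \<and> (\<forall>k\<ge>d. coeff r k = 0)"
  "s = q * G + fps_of_poly r \<Longrightarrow> s = q' * G + fps_of_poly r' \<Longrightarrow> \<forall>k\<ge>d. coeff r k = 0 \<Longrightarrow> \<forall>k\<ge>d. coeff r' k = 0 \<Longrightarrow> r = r'"
proof -
  define U where "U = fps_shift d G"
  define L where "L = fps_cutoff d G"
  obtain e where "U $ 0 * e = 1" using mps_unit[OF top] by (auto simp: U_def)
  then obtain V where V: "U * V = 1" using fps_unit by blast
  have G: "G = U * fps_X ^ d + L" by (simp add: U_def L_def fps_shift_cutoff)
  have L: "L \<in> xadic 1" using low by (auto simp: L_def xadic_def mdeg_eq_0)
  define T where "T q = fps_shift d (q * (V * L))" for q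
  have T1: "T (u - v) = T u - T v" for u v by (simp add: T_def left_diff_distrib fps_shift_diff)
  have T2: "T s \<in> xadic (Suc N)" if "s \<in> xadic N" for N s
  proof -
    have "V * L \<in> xadic 1" using xadic_mult[of V 0 L 1] L by simp
    from xadic_mult[OF that this] show ?thesis unfolding T_def by (intro xadic_shift) simp
  qed
  have sh: "fps_shift d (q * V * G) = q + T q" for q
  proof -
    have "q * V * G = q * (U * V) * fps_X ^ d + q * (V * L)" unfolding G by (simp add: algebra_simps)
    then show ?thesis unfolding V by (simp add: T_def fps_shift_add fps_shift_times_fps_X_power)
  qed
  show "\<exists>q r. s = q * G + fps_of_poly r \<and> (\<forall>k\<ge>d. coeff r k = 0)"
  proof -
    obtain q where q: "q + T q = fps_shift d s" using xadic_contraction(1)[OF T1 T2] by blast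
    define u where "u = s - q * V * G"
    have "fps_shift d u = 0" unfolding u_def fps_shift_diff sh q by simp
    then have "u = fps_cutoff d u" by (metis add_0 fps_shift_cutoff mult_zero_left)
    moreover obtain r where "fps_of_poly r = fps_cutoff d u" "\<forall>k\<ge>d. coeff r k = 0"
      using fps_of_poly_cutoff by blast
    ultimately show ?thesis by (intro exI[of _ "q * V"] exI[of _ r]) (simp add: u_def)
  qed
  assume s: "s = q * G + fps_of_poly r" "s = q' * G + fps_of_poly r'" and r: "\<forall>k\<ge>d. coeff r k = 0" "\<forall>k\<ge>d. coeff r' k = 0"
  define p where "p = (q - q') * U"
  have "fps_shift d (fps_of_poly (r' - r)) = 0" using r by (auto simp: fps_eq_iff)
  moreover have "fps_of_poly (r' - r) = p * V * G"
  proof -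
    have "p * V * G = (q - q') * (U * V) * G" by (simp only: p_def mult_ac)
    also have "\<dots> = q * G - q' * G" unfolding V by (simp add: left_diff_distrib)
    also have "\<dots> = fps_of_poly (r' - r)" using s by (simp add: fps_of_poly_diff algebra_simps)
    finally show ?thesis ..
  qed
  ultimately have "p + T p = 0" using sh[of p] by simp
  then have "p = 0" using xadic_contraction(2)[OF T1 T2] by blast
  then have "fps_of_poly (r' - r) = 0" using \<open>fps_of_poly (r' - r) = p * V * G\<close> by simp
  then show "r = r'" by simp
qed

definition wrem where "wrem s = (SOME r. (\<forall>k\<ge>d. coeff r k = 0) \<and> (\<exists>q. s = q * G + fps_of_poly r))"

lemma wrem: "\<forall>k\<ge>d. coeff (wrem s) k = 0" "\<exists>q. s = q * G + fps_of_poly (wrem s)"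
  using someI_ex[of "\<lambda>r. (\<forall>k\<ge>d. coeff r k = 0) \<and> (\<exists>q. s = q * G + fps_of_poly r)"] division(1)[of s]
  unfolding wrem_def by blast+

lemma wrem_eqI: assumes "s = q * G + fps_of_poly r" "\<forall>k\<ge>d. coeff r k = 0" shows "wrem s = r"
  using wrem division(2)[OF assms(1) _ assms(2)] by metis

text \<open>The Weierstrass polynomial: subtracting from \<open>t\<^sup>d\<close> its remainder
  leaves a multiple of \<open>G\<close>.\<close>

definition W where "W = monom 1 d - wrem (fps_X ^ d)"

lemma W_monic: "lead_coeff W = 1" "degree W = d"
proof -
  have c: "coeff W d = 1" using wrem(1)[of "fps_X ^ d"] by (simp add: W_def)
  have "degree W \<le> d" by (rule degree_le) (use wrem(1)[of "fps_X ^ d"] in \<open>auto simp: W_def\<close>)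
  moreover have "d \<le> degree W" by (rule le_degree) (simp add: c)
  ultimately show "degree W = d" by simp
  with c show "lead_coeff W = 1" by simp
qed

lemma W_neq0: "W \<noteq> 0"
proof
  assume "W = 0"
  then show False using W_monic(1) by simp
qed

text \<open>The cofactor is a unit: at \<open>t\<^sup>d\<close>, with the variables set to 0, the
  left side is 1, while on the right only the constant term of \<open>q\<close> times the first
  nonzero coefficient of \<open>G\<close> survives.\<close>

lemma W_assoc: obtains q v where "fps_of_poly W = q * G" "q * v = 1"
proof -
  obtain q where q: "fps_X ^ d = q * G + fps_of_poly (wrem (fps_X ^ d))" using wrem(2) by blast
  have W: "fps_of_poly W = q * G"
    using q unfolding W_def fps_of_poly_diff fps_of_poly_monom' diff_eq_eq .
  have "1 = mps_nth (coeff W d) (\<lambda>_. 0)" using W_monic by (simp add: mps_nth_one)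
  also have "coeff W d = (\<Sum>i=0..d. q $ i * G $ (d - i))" by (metis W fps_mult_nth fps_of_poly_nth)
  also have "mps_nth \<dots> (\<lambda>_. 0) = (\<Sum>i=0..d. mps_nth (q $ i) (\<lambda>_. 0) * mps_nth (G $ (d - i)) (\<lambda>_. 0))"
  proof -
    have "add_pairs (\<lambda>_ :: 'n. 0) = {(\<lambda>_. 0, \<lambda>_. 0)}" by (auto simp: add_pairs_def)
    then show ?thesis by (simp add: mps_nth_times)
  qed
  also have "\<dots> = (\<Sum>i\<in>{0}. mps_nth (q $ i) (\<lambda>_. 0) * mps_nth (G $ (d - i)) (\<lambda>_. 0))"
    by (rule sum.mono_neutral_right) (auto simp: low)
  finally have "mps_nth (q $ 0) (\<lambda>_. 0) \<noteq> 0" by auto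
  then obtain e where "q $ 0 * e = 1" using mps_unit by blast
  then obtain v where "q * v = 1" using fps_unit by blast
  with W show ?thesis by (rule that)
qed

end

lemma monic_poly_division:
  fixes p q :: "'a::idom poly"
  assumes "lead_coeff q = 1"
  shows "\<exists>u r. p = u * q + r \<and> (\<forall>k\<ge>degree q. coeff r k = 0)"
proof -
  obtain u r where ur: "pseudo_divmod p q = (u, r)" by fastforce
  have q0: "q \<noteq> 0" using assms by auto
  from pseudo_divmod[OF q0 ur] assms have "p = q * u + r" "r = 0 \<or> degree r < degree q" by simp_all
  then show ?thesis by (intro exI[of _ u] exI[of _ r]) (auto simp: mult.commute coeff_eq_0)
qed

locale weierstrass_point = weierstrass G d + j: inj_comm_ring_hom j
  for G :: "('n::finite, 'q::field) mps fps" and d and j :: "('n, 'q) mps \<Rightarrow> 'f::field_char_0" +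
  fixes \<eta> :: 'f
  assumes root: "poly (map_poly j W) \<eta> = 0"
begin

sublocale jp: map_poly_inj_comm_ring_hom j ..

text \<open>Substitution of \<open>\<eta>\<close> for the parameter. As no convergence is available,
  it is defined on remainders, that is, on the quotient by \<open>G\<close>; this is consistent
  because \<open>\<eta>\<close> is a root of \<open>W\<close>.\<close>

definition pev where "pev s = poly (map_poly j (wrem s)) \<eta>"

lemma pev_eqI: assumes "s = q * G + fps_of_poly p" shows "pev s = poly (map_poly j p) \<eta>"
proof -
  obtain u r where ur: "p = u * W + r" "\<forall>k\<ge>d. coeff r k = 0"
    using monic_poly_division[OF W_monic(1), of p] W_monic(2) by auto
  obtain v where v: "fps_of_poly W = v * G" using W_assoc by blast
  have "s = (q + fps_of_poly u * v) * G + fps_of_poly r"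
    using assms by (simp add: ur(1) fps_of_poly_add fps_of_poly_mult v algebra_simps)
  then have "wrem s = r" using wrem_eqI ur(2) by blast
  then show ?thesis using root by (simp add: pev_def ur(1) jp.hom_add jp.hom_mult)
qed

lemma pev_poly: "pev (fps_of_poly p) = poly (map_poly j p) \<eta>"
  by (rule pev_eqI[of _ 0]) simp

sublocale pev: comm_ring_hom pev
proof
  fix x y
  obtain q r q' r' where x: "x = q * G + fps_of_poly r" and y: "y = q' * G + fps_of_poly r'"
    using division(1) by metis
  show "pev (x + y) = pev x + pev y"
    unfolding pev_eqI[OF x] pev_eqI[OF y]
    by (subst pev_eqI[of _ "q + q'" "r + r'"]) (simp_all add: x y fps_of_poly_add jp.hom_add algebra_simps)
  show "pev (x * y) = pev x * pev y"
    unfolding pev_eqI[OF x] pev_eqI[OF y]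
    by (subst pev_eqI[of _ "q * y + fps_of_poly r * q'" "r * r'"]) (simp_all add: x y fps_of_poly_mult jp.hom_mult algebra_simps)
next
  show "pev 1 = 1" using pev_poly[of 1] by simp
  show "pev 0 = 0" using pev_poly[of 0] by simp
qed

end

section \<open>Taylor expansion along a derivation\<close>

text \<open>The exponential of \<open>D\<close> followed by \<open>e\<close>. The inverse factorials
  are passed as \<open>c\<close>, since the target may be a power series ring rather than a
  field.\<close>

definition taylor :: "('a \<Rightarrow> 'a) \<Rightarrow> ('a \<Rightarrow> 'b) \<Rightarrow> (nat \<Rightarrow> 'b) \<Rightarrow> 'a \<Rightarrow> 'b::comm_ring_1 fps" where
  "taylor D e c s = Abs_fps (\<lambda>k. c k * e ((D ^^ k) s))"

locale taylor_data =
  fixes D :: "'a::comm_ring_1 \<Rightarrow> 'a" and e :: "'a \<Rightarrow> 'b::{idom, ring_char_0}" and c :: "nat \<Rightarrow> 'b"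
  assumes D: "derivation_along (\<lambda>x. x) D" and e: "comm_ring_hom e" and c: "c k * of_nat (fact k) = 1"
begin

interpretation e: comm_ring_hom e by (rule e)

lemma c_Suc: "of_nat (Suc k) * c (Suc k) = c k"
proof -
  have "(of_nat (Suc k) * c (Suc k)) * of_nat (fact k) = c k * of_nat (fact k)"
    using c[of "Suc k"] c[of k] by (simp add: algebra_simps)
  then show ?thesis by simp
qed

lemma c_0: "c 0 = 1" using c[of 0] by simp

lemma deriv_taylor: "fps_deriv (taylor D e c s) = taylor D e c (D s)"
  by (rule fps_ext) (simp add: taylor_def mult.assoc[symmetric] c_Suc[unfolded of_nat_Suc] funpow_swap1 add.commute)

lemma taylor_0: "taylor D e c s $ 0 = e s" by (simp add: taylor_def c_0)

lemma taylor_add: "taylor D e c (s + t) = taylor D e c s + taylor D e c t"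
proof -
  have "(D ^^ k) (s + t) = (D ^^ k) s + (D ^^ k) t" for k
    by (induction k) (simp_all add: derivation_alongD[OF D])
  then show ?thesis by (simp add: taylor_def fps_eq_iff hom_distribs distrib_left)
qed

text \<open>In place of binomial sums the derivatives by the parameter are compared: coefficient
  \<open>k + 1\<close> is determined by coefficient \<open>k\<close> of the derivative because
  \<open>k + 1\<close> can be cancelled.\<close>

lemma taylor_mult_nth: "taylor D e c (s * t) $ k = (taylor D e c s * taylor D e c t) $ k"
proof (induction k arbitrary: s t)
  case 0
  then show ?case by (simp add: taylor_0 hom_distribs)
next
  case (Suc k)
  let ?T = "taylor D e c"
  have "of_nat (Suc k) * ?T (s * t) $ Suc k = fps_deriv (?T (s * t)) $ k" by simp
  also have "\<dots> = ?T (s * D t) $ k + ?T (t * D s) $ k"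
    unfolding deriv_taylor derivation_alongD(2)[OF D] taylor_add by simp
  also have "\<dots> = (?T s * ?T (D t)) $ k + (?T t * ?T (D s)) $ k" by (simp only: Suc.IH)
  also have "\<dots> = fps_deriv (?T s * ?T t) $ k"
    by (simp only: fps_deriv_mult deriv_taylor fps_add_nth) (simp only: mult.commute)
  also have "\<dots> = of_nat (Suc k) * (?T s * ?T t) $ Suc k" by (simp only: fps_deriv_nth Suc_eq_plus1)
  finally show ?case by (simp only: mult_cancel_left of_nat_eq_0_iff) simp
qed

sublocale t: comm_ring_hom "taylor D e c"
proof
  show "taylor D e c (s * t) = taylor D e c s * taylor D e c t" for s t
    by (rule fps_ext) (rule taylor_mult_nth)
  have D1: "(D ^^ k) 1 = (if k = 0 then 1 else 0)" for k
  proof (induction k)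
    case (Suc k)
    have "D 1 = 0" using derivation_alongD(2)[OF D, of 1 1] by simp
    then show ?case using Suc D by simp
  qed simp
  show "taylor D e c 1 = 1" by (rule fps_ext) (simp add: taylor_def D1 c_0)
qed (use taylor_add[of 0 0] in \<open>simp_all add: taylor_add\<close>)

lemma comm_ring_hom_taylor: "comm_ring_hom (taylor D e c)" by (rule t.comm_ring_hom_axioms)

end

text \<open>Over an algebraically closed field divisibility is tested root by root; the induction
  strips off one root with its full multiplicity.\<close>

lemma order_dvd_imp_dvd:
  fixes w r :: "'f::alg_closed_field poly"
  assumes "w \<noteq> 0" "\<And>\<eta>. poly w \<eta> = 0 \<Longrightarrow> [:- \<eta>, 1:] ^ order \<eta> w dvd r"
  shows "w dvd r"
  using assms
proof (induction "degree w" arbitrary: w r rule: less_induct)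
  case less
  show ?case
  proof (cases "degree w = 0")
    case True
    then obtain a where "w = [:a:]" "a \<noteq> 0" using less.prems(1) by (metis degree_eq_zeroE pCons_0_0)
    then have "r = w * smult (inverse a) r" by simp
    then show ?thesis by (metis dvd_triv_left)
  next
    case False
    then obtain \<eta> where \<eta>: "poly w \<eta> = 0" using alg_closed_imp_poly_has_root[of w] by auto
    define \<mu> where "\<mu> = order \<eta> w"
    obtain v where v: "w = [:- \<eta>, 1:] ^ \<mu> * v" "\<not> [:- \<eta>, 1:] dvd v"
      using order_decomp[OF less.prems(1), of \<eta>] unfolding \<mu>_def by blast
    have \<mu>: "\<mu> > 0" using \<eta> less.prems(1) by (simp add: \<mu>_def order_root)
    obtain r' where r': "r = [:- \<eta>, 1:] ^ \<mu> * r'" using less.prems(2)[OF \<eta>] unfolding \<mu>_def dvd_def by blast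
    have v0: "v \<noteq> 0" using v less.prems(1) by auto
    have "degree w = \<mu> + degree v" unfolding v(1) using v0 by (subst degree_mult_eq) (auto simp: degree_linear_power)
    then have "degree v < degree w" using \<mu> by simp
    moreover have "[:- \<xi>, 1:] ^ order \<xi> v dvd r'" if "poly v \<xi> = 0" for \<xi>
    proof -
      have ne: "\<xi> \<noteq> \<eta>" using that v(2) by (auto simp: poly_eq_0_iff_dvd)
      have "poly w \<xi> = 0" using that by (simp add: v(1))
      then have "[:- \<xi>, 1:] ^ order \<xi> w dvd r" by (rule less.prems(2))
      moreover have "[:- \<xi>, 1:] ^ order \<xi> v dvd w" using order_1[of \<xi> v] unfolding v(1) by (rule dvd_mult)
      then have "order \<xi> v \<le> order \<xi> w" using less.prems(1) by (simp add: order_divides)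
      ultimately have d: "[:- \<xi>, 1:] ^ order \<xi> v dvd r" by (meson dvd_trans le_imp_power_dvd)
      show ?thesis
      proof (cases "r = 0")
        case True
        then show ?thesis using r' by simp
      next
        case False
        have r0: "r' \<noteq> 0" using False r' by auto
        have "order \<xi> r = order \<xi> ([:- \<eta>, 1:] ^ \<mu>) + order \<xi> r'" using False unfolding r' by (rule order_mult)
        also have "order \<xi> ([:- \<eta>, 1:] ^ \<mu>) = 0" using ne by (intro order_0I) simp
        finally show ?thesis using d False r0 by (simp add: order_divides)
      qed
    qed
    ultimately have "v dvd r'" using less.hyps[OF _ v0] by blast
    then show ?thesis unfolding v(1) r' by (rule mult_dvd_mono[OF dvd_refl])
  qed
qed

context weierstrass_point
begin

lemma taylor_data_pev: "taylor_data (fps_deriv :: ('n, 'q) mps fps \<Rightarrow> _) pev (\<lambda>k. inverse (fact k) :: 'f)"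
proof (rule taylor_data.intro)
  show "derivation_along (\<lambda>x. x) (fps_deriv :: ('n, 'q) mps fps \<Rightarrow> _)"
    by (simp add: derivation_along_def algebra_simps)
  show "comm_ring_hom pev" by (rule pev.comm_ring_hom_axioms)
  show "inverse (fact k) * of_nat (fact k) = (1 :: 'f)" for k
    by (simp only: of_nat_fact left_inverse fact_nonzero not_False_eq_True)
qed

lemma comm_ring_hom_taylor_pev: "comm_ring_hom (taylor fps_deriv pev (\<lambda>k. inverse (fact k) :: 'f))"
  by (rule taylor_data.comm_ring_hom_taylor[OF taylor_data_pev])

lemma pev_const: "pev (fps_const a) = j a"
proof -
  have "map_poly j [:a:] = [:j a:]" by (simp only: j.map_poly_pCons_hom) simp
  then show ?thesis using pev_poly[of "[:a:]"] by (simp only: fps_of_poly_const) simp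
qed

lemma pev_X: "pev fps_X = \<eta>"
proof -
  have "map_poly j [:0, 1:] = [:0, 1:]" by (simp only: j.map_poly_pCons_hom j.hom_one j.hom_zero) simp
  then show ?thesis using pev_poly[of "[:0, 1:]"] by (simp only: fps_of_poly_fps_X) simp
qed

text \<open>Expansion at the point substitutes \<open>\<eta> + t\<close> for the parameter. Both
  sides are multiplicative, so constants and the parameter decide.\<close>

lemma taylor_pev_poly:
  "taylor fps_deriv pev (\<lambda>k. inverse (fact k) :: 'f) (fps_of_poly p) = fps_of_poly (map_poly j p \<circ>\<^sub>p [:\<eta>, 1:])"
proof -
  let ?T = "taylor fps_deriv pev (\<lambda>k. inverse (fact k) :: 'f)"
  interpret T: comm_ring_hom ?T by (rule comm_ring_hom_taylor_pev)
  have const: "?T (fps_const a) = fps_const (j a)" for a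
  proof (rule fps_ext)
    fix k
    have "(fps_deriv ^^ k) (fps_const a) = (if k = 0 then fps_const a else 0)" by (induction k) simp_all
    then show "?T (fps_const a) $ k = fps_const (j a) $ k"
      by (cases "k = 0") (simp_all add: taylor_def pev_const)
  qed
  have X: "?T fps_X = fps_const \<eta> + fps_X"
  proof (rule fps_ext)
    fix k
    have "(fps_deriv ^^ k) (fps_X :: ('n, 'q) mps fps) = (if k = 0 then fps_X else if k = 1 then 1 else 0)"
      by (induction k) auto
    then show "?T fps_X $ k = (fps_const \<eta> + fps_X) $ k"
      by (cases "k = 0"; cases "k = 1") (simp_all add: taylor_def pev_X)
  qed
  show ?thesis
  proof (induction p)
    case (pCons a p)
    have lin: "fps_of_poly [:\<eta>, 1:] = fps_const \<eta> + fps_X"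
      by (simp add: fps_of_poly_pCons add.commute)
    have "?T (fps_of_poly (pCons a p)) = fps_const (j a) + (fps_const \<eta> + fps_X) * ?T (fps_of_poly p)"
      by (simp only: fps_of_poly_pCons T.hom_add T.hom_mult const X mult.commute)
    also have "\<dots> = fps_const (j a) + (fps_const \<eta> + fps_X) * fps_of_poly (map_poly j p \<circ>\<^sub>p [:\<eta>, 1:])"
      by (rule arg_cong[OF pCons.IH])
    also have "\<dots> = fps_of_poly ([:j a:] + [:\<eta>, 1:] * (map_poly j p \<circ>\<^sub>p [:\<eta>, 1:]))"
      by (simp only: fps_of_poly_add fps_of_poly_mult lin fps_of_poly_const)
    also have "[:j a:] + [:\<eta>, 1:] * (map_poly j p \<circ>\<^sub>p [:\<eta>, 1:]) = map_poly j (pCons a p) \<circ>\<^sub>p [:\<eta>, 1:]"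
      by (simp only: j.map_poly_pCons_hom pcompose_pCons)
    finally show ?case .
  qed (simp add: T.hom_zero)
qed

end

section \<open>Divisibility in codimension one\<close>

lemma finite_mdeg: "finite {a :: 'n::finite \<Rightarrow> nat. mdeg a = d}"
proof (rule finite_subset)
  show "{a :: 'n \<Rightarrow> nat. mdeg a = d} \<subseteq> {a. \<forall>i. a i \<in> {..d}}"
    by (auto simp: mdeg_def intro: member_le_sum)
  have "finite (Pi\<^sub>E (UNIV :: 'n set) (\<lambda>i. {..d}))" by (intro finite_PiE) auto
  moreover have "Pi\<^sub>E UNIV (\<lambda>i. {..d}) = {a :: 'n \<Rightarrow> nat. \<forall>i. a i \<in> {..d}}"
    by (auto simp: PiE_def Pi_def extensional_def)
  ultimately show "finite {a :: 'n \<Rightarrow> nat. \<forall>i. a i \<in> {..d}}" by simp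
qed

text \<open>The value at \<open>Y\<close> of the homogeneous component of degree
  \<open>d\<close>.\<close>

definition mps_at :: "('n::finite \<Rightarrow> 'q::comm_ring_1) \<Rightarrow> nat \<Rightarrow> ('n, 'q) mps \<Rightarrow> 'q" where
  "mps_at Y d f = (\<Sum>a | mdeg a = d. mps_nth f a * (\<Prod>j\<in>UNIV. Y j ^ a j))"

definition mps_ddir :: "('n::finite \<Rightarrow> 'q::comm_ring_1) \<Rightarrow> ('n, 'q) mps \<Rightarrow> ('n, 'q) mps" where
  "mps_ddir Y f = (\<Sum>j\<in>UNIV. mps_const (Y j) * mps_deriv j f)"

lemma derivation_along_mps_ddir: "derivation_along (\<lambda>x. x) (mps_ddir Y)"
  unfolding derivation_along_def
proof (intro conjI allI)
  fix f g
  show "mps_ddir Y (f + g) = mps_ddir Y f + mps_ddir Y g"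
    by (simp only: mps_ddir_def mps_deriv_add distrib_left sum.distrib)
  show "mps_ddir Y (f * g) = f * mps_ddir Y g + g * mps_ddir Y f"
    by (simp only: mps_ddir_def mps_deriv_mult distrib_left sum.distrib sum_distrib_left mult.left_commute)
qed

lemma mps_ddir_const_mult: "mps_ddir Y (mps_const c * f) = mps_const c * mps_ddir Y f"
  by (simp add: mps_ddir_def mps_deriv_const_mult sum_distrib_left mult.left_commute)

lemma mdeg_upd: "mdeg (a(j := Suc (a j))) = Suc (mdeg a)"
proof -
  have "mdeg (a(j := Suc (a j))) = (\<Sum>i\<in>UNIV. a i + (if i = j then 1 else 0))"
    unfolding mdeg_def by (rule sum.cong) auto
  then show ?thesis by (simp add: mdeg_def sum.distrib)
qed

text \<open>Euler's identity for the form of degree \<open>d + 1\<close>: the derivative in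
  direction \<open>Y\<close>, taken at \<open>Y\<close> itself, multiplies by the degree.\<close>

lemma mps_at_ddir:
  fixes Y :: "'n::finite \<Rightarrow> 'q::comm_ring_1"
  shows "mps_at Y d (mps_ddir Y f) = of_nat (Suc d) * mps_at Y (Suc d) f"
proof -
  let ?Y = "\<lambda>a. \<Prod>j\<in>UNIV. Y j ^ a j"
  have Yup: "?Y (a(j := Suc (a j))) = Y j * ?Y a" for a j
  proof -
    have "?Y (a(j := Suc (a j))) = (\<Prod>i\<in>UNIV. (if i = j then Y j else 1) * Y i ^ a i)"
      by (rule prod.cong) auto
    then show ?thesis by (simp add: prod.distrib)
  qed
  have one: "(\<Sum>a | mdeg a = d. Y j * mps_nth (mps_deriv j f) a * ?Y a)
      = (\<Sum>b | mdeg b = Suc d. of_nat (b j) * (mps_nth f b * ?Y b))" for j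
  proof -
    have "(\<Sum>b | mdeg b = Suc d. of_nat (b j) * (mps_nth f b * ?Y b))
      = (\<Sum>b | mdeg b = Suc d \<and> b j > 0. of_nat (b j) * (mps_nth f b * ?Y b))"
      by (rule sum.mono_neutral_right) (auto simp: finite_mdeg)
    also have "\<dots> = (\<Sum>a | mdeg a = d. Y j * mps_nth (mps_deriv j f) a * ?Y a)"
    proof (rule sum.reindex_bij_witness[of _ "\<lambda>a. a(j := Suc (a j))" "\<lambda>b. b(j := b j - 1)"])
      fix b :: "'n \<Rightarrow> nat" assume "b \<in> {b. mdeg b = Suc d \<and> 0 < b j}"
      then have b: "mdeg b = Suc d" "b j > 0" by auto
      then have eq: "b = (b(j := b j - 1))(j := Suc ((b(j := b j - 1)) j))" by auto
      then show "(b(j := b j - 1))(j := Suc ((b(j := b j - 1)) j)) = b" by simp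
      have "Suc d = Suc (mdeg (b(j := b j - 1)))" using b(1) eq mdeg_upd by metis
      then show "b(j := b j - 1) \<in> {a. mdeg a = d}" by simp
      show "Y j * mps_nth (mps_deriv j f) (b(j := b j - 1)) * ?Y (b(j := b j - 1)) = of_nat (b j) * (mps_nth f b * ?Y b)"
      proof -
        have "?Y b = Y j * ?Y (b(j := b j - 1))" using Yup[of "b(j := b j - 1)" j] unfolding eq[symmetric] .
        moreover have "mps_nth (mps_deriv j f) (b(j := b j - 1)) = of_nat (b j) * mps_nth f b"
          using b(2) by (simp add: mps_deriv.rep_eq del: of_nat_Suc)
        ultimately show ?thesis by (simp add: mult_ac)
      qed
    next
      fix a :: "'n \<Rightarrow> nat" assume "a \<in> {a. mdeg a = d}"
      then show "a(j := Suc (a j)) \<in> {b. mdeg b = Suc d \<and> 0 < b j}" by (simp add: mdeg_upd)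
    qed simp
    finally show ?thesis ..
  qed
  have "mps_at Y d (mps_ddir Y f) = (\<Sum>a | mdeg a = d. \<Sum>j\<in>UNIV. Y j * mps_nth (mps_deriv j f) a * ?Y a)"
    by (simp add: mps_at_def mps_ddir_def sum_distrib_right)
  also have "\<dots> = (\<Sum>j\<in>UNIV. \<Sum>b | mdeg b = Suc d. of_nat (b j) * (mps_nth f b * ?Y b))"
    by (subst sum.swap) (simp only: one)
  also have "\<dots> = (\<Sum>b | mdeg b = Suc d. \<Sum>j\<in>UNIV. of_nat (b j) * (mps_nth f b * ?Y b))"
    by (rule sum.swap)
  also have "\<dots> = (\<Sum>b | mdeg b = Suc d. of_nat (mdeg b) * (mps_nth f b * ?Y b))"
    by (simp only: mdeg_def of_nat_sum sum_distrib_right)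
  also have "\<dots> = of_nat (Suc d) * mps_at Y (Suc d) f"
    unfolding mps_at_def sum_distrib_left by (rule sum.cong) auto
  finally show ?thesis .
qed

lemma mps_at_0: "mps_at Y 0 f = mps_nth f (\<lambda>_. 0)"
  by (simp add: mps_at_def mdeg_eq_0)

lemma mps_at_ddir_power: "of_nat (fact e) * mps_at Y e ((mps_ddir Y ^^ k) f) = of_nat (fact (e + k)) * mps_at Y (e + k) f"
proof (induction k arbitrary: e)
  case (Suc k)
  have "of_nat (fact e) * mps_at Y e ((mps_ddir Y ^^ Suc k) f) = of_nat (fact (Suc e)) * mps_at Y (Suc e) ((mps_ddir Y ^^ k) f)"
    by (simp add: mps_at_ddir algebra_simps)
  then show ?case using Suc.IH[of "Suc e"] by simp
qed simp

text \<open>The coordinates \<open>Y\<close> are algebraically independent over \<open>'k\<close>, so every nonzero power series over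
  \<open>'k\<close> is regular in the direction \<open>Y\<close>.\<close>

locale generic_direction = \<kappa>: field_hom \<kappa>
  for \<kappa> :: "'k::field_char_0 \<Rightarrow> 'q::field_char_0" and Y :: "'n::finite \<Rightarrow> 'q" +
  assumes indep: "mps_at Y d (mps_map \<kappa> w) = 0 \<Longrightarrow> mdeg a = d \<Longrightarrow> mps_nth w a = 0"
begin

abbreviation \<iota> :: "('n, 'k) mps \<Rightarrow> ('n, 'q) mps" where "\<iota> \<equiv> mps_map \<kappa>"

sublocale \<iota>: inj_comm_ring_hom \<iota>
proof -
  interpret comm_ring_hom \<iota> by (rule comm_ring_hom_mps_map) (rule \<kappa>.comm_ring_hom_axioms)
  show "inj_comm_ring_hom \<iota>"
  proof unfold_locales
    fix x assume "\<iota> x = 0"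
    then have "\<kappa> (mps_nth x a) = 0" for a by (metis mps_map.rep_eq zero_mps.rep_eq)
    then show "x = 0" by (intro mps_eqI) simp
  qed
qed

text \<open>The substitution \<open>s(X + t Y)\<close>, as the exponential of the directional
  derivative.\<close>

definition flow :: "('n, 'q) mps \<Rightarrow> ('n, 'q) mps fps" where
  "flow = taylor (mps_ddir Y) (\<lambda>x. x) (\<lambda>k. mps_const (inverse (fact k)))"

sublocale flow: taylor_data "mps_ddir Y" "\<lambda>x. x" "\<lambda>k. mps_const (inverse (fact k))"
proof
  interpret mc: comm_ring_hom "mps_const :: 'q \<Rightarrow> ('n, 'q) mps" by (rule comm_ring_hom_mps_const)
  show "mps_const (inverse (fact k)) * of_nat (fact k) = (1 :: ('n, 'q) mps)" for k
  proof -
    have "mps_const (inverse (fact k)) * of_nat (fact k) = (mps_const (inverse (fact k) * of_nat (fact k)) :: ('n, 'q) mps)"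
      by (simp only: mc.hom_mult mc.hom_of_nat)
    then show ?thesis by simp
  qed
qed (simp_all add: derivation_along_mps_ddir)

lemma flow_hom: "comm_ring_hom flow" unfolding flow_def by (rule flow.t.comm_ring_hom_axioms)

lemma flow_0: "flow s $ 0 = s" by (simp add: flow_def flow.taylor_0)

lemma deriv_flow: "fps_deriv (flow s) = flow (mps_ddir Y s)" by (simp add: flow_def flow.deriv_taylor)

lemma flow_const: "mps_nth (flow s $ d) (\<lambda>_. 0) = mps_at Y d s"
proof -
  have "mps_nth (flow s $ d) (\<lambda>_. 0) = inverse (fact d) * mps_at Y 0 ((mps_ddir Y ^^ d) s)"
    by (simp add: flow_def taylor_def mps_at_0)
  also have "mps_at Y 0 ((mps_ddir Y ^^ d) s) = fact d * mps_at Y d s"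
    using mps_at_ddir_power[of 0 Y d s] by simp
  finally show ?thesis by simp
qed

text \<open>At \<open>X = 0\<close> the flow is \<open>w(t Y)\<close>, whose coefficients are the
  homogeneous components of \<open>w\<close> at \<open>Y\<close>. Independence of the
  \<open>Y\<^sub>j\<close> keeps one of them nonzero, and the first such degree is
  \<open>d\<close>.\<close>

lemma flow_regular: assumes "w \<noteq> 0" shows "\<exists>d. weierstrass (flow (\<iota> w)) d"
proof -
  have ex: "\<exists>d. mps_at Y d (\<iota> w) \<noteq> 0"
  proof (rule ccontr)
    assume "\<not> ?thesis"
    then have "mps_nth w a = 0" for a using indep[of "mdeg a" w a] by simp
    then have "w = 0" by (intro mps_eqI) simp
    with assms show False ..
  qed
  define d where "d = (LEAST d. mps_at Y d (\<iota> w) \<noteq> 0)"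
  have "mps_at Y d (\<iota> w) \<noteq> 0" unfolding d_def using ex by (rule LeastI_ex)
  moreover have "mps_at Y k (\<iota> w) = 0" if "k < d" for k using not_less_Least[of k] that unfolding d_def by blast
  ultimately show ?thesis by (intro exI[of _ d]) (unfold_locales, auto simp: flow_const)
qed

text \<open>Restriction to the line in direction \<open>Y\<close> through the point given by
  \<open>\<epsilon>\<close>, as a series in the line parameter.\<close>

definition germ :: "(('n, 'q) mps \<Rightarrow> 'f::field_char_0) \<Rightarrow> ('n, 'q) mps \<Rightarrow> 'f fps" where
  "germ \<epsilon> = taylor (mps_ddir Y) \<epsilon> (\<lambda>k. inverse (fact k))"

lemma taylor_data_germ: "comm_ring_hom \<epsilon> \<Longrightarrow> taylor_data (mps_ddir Y) (\<epsilon> :: _ \<Rightarrow> 'f::field_char_0) (\<lambda>k. inverse (fact k))"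
  by (rule taylor_data.intro)
    (simp_all only: derivation_along_mps_ddir of_nat_fact left_inverse fact_nonzero not_False_eq_True)

text \<open>A point of the hypersurface \<open>w = 0\<close> reached from the generic point by translation in the direction \<open>Y\<close>
  is a root of the Weierstrass polynomial of \<open>w(X + t Y)\<close>.\<close>

theorem purity:
  fixes w :: "('n, 'k) mps" and j :: "('n, 'q) mps \<Rightarrow> 'f::{alg_closed_field, field_char_0}"
  assumes w: "w \<noteq> 0" and j: "inj_comm_ring_hom j"
    and points: "\<And>\<epsilon> :: ('n, 'q) mps \<Rightarrow> 'f. comm_ring_hom \<epsilon> \<Longrightarrow> (\<And>s. s \<noteq> 0 \<Longrightarrow> germ \<epsilon> (\<iota> s) \<noteq> 0) \<Longrightarrow>
      germ \<epsilon> (\<iota> w) dvd germ \<epsilon> U"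
  shows "\<iota> w dvd U"
proof -
  interpret j: inj_comm_ring_hom j by fact
  interpret jp: map_poly_inj_comm_ring_hom j ..
  interpret fl: comm_ring_hom flow by (rule flow_hom)
  define G where "G = flow (\<iota> w)"
  obtain d where "weierstrass G d" using flow_regular[OF w] by (auto simp: G_def)
  then interpret G: weierstrass G d .
  obtain q r where qr: "flow U = q * G + fps_of_poly r" "\<forall>k\<ge>d. coeff r k = 0" using G.division(1) by blast
  obtain qW v where qW: "fps_of_poly G.W = qW * G" "qW * v = 1" by (rule G.W_assoc)
  have "map_poly j G.W dvd map_poly j r"
  proof (rule order_dvd_imp_dvd)
    show "map_poly j G.W \<noteq> 0" unfolding jp.hom_0_iff by (rule G.W_neq0)
    fix \<eta> assume \<eta>: "poly (map_poly j G.W) \<eta> = 0"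
    interpret P: weierstrass_point G d j \<eta> by unfold_locales (rule \<eta>)
    define \<Psi> where "\<Psi> = taylor fps_deriv P.pev (\<lambda>k. inverse (fact k) :: 'f)"
    interpret Ph: comm_ring_hom \<Psi> unfolding \<Psi>_def by (rule P.comm_ring_hom_taylor_pev)
    \<comment> \<open>The generic point translated by \<open>\<eta> Y\<close>.\<close>
    define \<epsilon> where "\<epsilon> s = P.pev (flow s)" for s
    have \<epsilon>: "comm_ring_hom \<epsilon>" unfolding \<epsilon>_def
      by (rule comm_ring_hom_comp[OF P.pev.comm_ring_hom_axioms flow_hom])
    have germ: "germ \<epsilon> s = \<Psi> (flow s)" for s
    proof -
      have "(fps_deriv ^^ k) (flow s) = flow ((mps_ddir Y ^^ k) s)" for k
        by (induction k) (simp_all add: deriv_flow)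
      then show ?thesis by (simp add: germ_def \<Psi>_def taylor_def \<epsilon>_def)
    qed
    have \<Psi>poly: "\<Psi> (fps_of_poly p) = fps_of_poly (map_poly j p \<circ>\<^sub>p [:\<eta>, 1:])" for p
      unfolding \<Psi>_def by (rule P.taylor_pev_poly)
    \<comment> \<open>The flow of \<open>s\<close> divides a monic polynomial in the parameter, and
      the expansion of the latter at \<open>\<eta>\<close> is not zero.\<close>
    have nz: "germ \<epsilon> (\<iota> s) \<noteq> 0" if s0: "s \<noteq> 0" for s
    proof -
      obtain e where "weierstrass (flow (\<iota> s)) e" using flow_regular[OF s0] by blast
      then interpret S: weierstrass "flow (\<iota> s)" e .
      obtain q' v' where q': "fps_of_poly S.W = q' * flow (\<iota> s)" "q' * v' = 1" by (rule S.W_assoc)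
      have "map_poly j S.W \<noteq> 0" unfolding jp.hom_0_iff by (rule S.W_neq0)
      then have "map_poly j S.W \<circ>\<^sub>p [:\<eta>, 1:] \<noteq> 0" by (simp add: pcompose_eq_0_iff)
      then have "\<Psi> (fps_of_poly S.W) \<noteq> 0" unfolding \<Psi>poly by simp
      then show ?thesis unfolding germ q'(1) Ph.hom_mult by auto
    qed
    have "\<Psi> G dvd \<Psi> (flow U)" using points[OF \<epsilon> nz] by (simp add: germ G_def)
    moreover have "\<Psi> (flow U) = \<Psi> q * \<Psi> G + \<Psi> (fps_of_poly r)" unfolding qr(1) by (simp add: Ph.hom_add Ph.hom_mult)
    ultimately have dr: "\<Psi> G dvd \<Psi> (fps_of_poly r)" by (metis dvd_add_right_iff dvd_triv_right)
    have "\<Psi> G = \<Psi> (fps_of_poly G.W) * \<Psi> v"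
    proof -
      have "\<Psi> (fps_of_poly G.W) * \<Psi> v = \<Psi> (G * (qW * v))" unfolding qW(1) by (simp add: Ph.hom_mult mult_ac)
      then show ?thesis unfolding qW(2) by simp
    qed
    then have WG: "\<Psi> (fps_of_poly G.W) dvd \<Psi> G" by simp
    \<comment> \<open>The multiplicity of the root becomes a power of the line parameter that
      divides the germ of \<open>w\<close>, hence that of the remainder.\<close>
    let ?\<mu> = "order \<eta> (map_poly j G.W)"
    obtain z where z: "map_poly j G.W = [:- \<eta>, 1:] ^ ?\<mu> * z" using order_1[of \<eta> "map_poly j G.W"] unfolding dvd_def by blast
    have lin: "[:- \<eta>, 1:] \<circ>\<^sub>p [:\<eta>, 1:] = [:0, 1:]" by (simp add: pcompose_pCons)
    have "map_poly j G.W \<circ>\<^sub>p [:\<eta>, 1:] = [:0, 1:] ^ ?\<mu> * (z \<circ>\<^sub>p [:\<eta>, 1:])"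
      by (subst z) (simp only: pcompose_mult pcompose_hom.hom_power lin)
    then have "fps_X ^ ?\<mu> dvd \<Psi> (fps_of_poly G.W)"
      unfolding \<Psi>poly by (simp add: fps_of_poly_mult fps_of_poly_power fps_of_poly_fps_X)
    then have "fps_X ^ ?\<mu> dvd \<Psi> (fps_of_poly r)" using WG dr by (meson dvd_trans)
    then have "fps_X ^ ?\<mu> dvd fps_of_poly (map_poly j r \<circ>\<^sub>p [:\<eta>, 1:])" by (simp only: \<Psi>poly)
    then obtain g where g: "fps_of_poly (map_poly j r \<circ>\<^sub>p [:\<eta>, 1:]) = fps_X ^ ?\<mu> * g" unfolding dvd_def by blast
    define R where "R = map_poly j r \<circ>\<^sub>p [:\<eta>, 1:]"
    have "coeff R k = 0" if "k < ?\<mu>" for k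
    proof -
      have "coeff R k = fps_of_poly R $ k" by simp
      also have "\<dots> = 0" using that unfolding R_def g by (simp add: fps_X_power_mult_nth)
      finally show ?thesis .
    qed
    then have "monom 1 ?\<mu> dvd R" by (simp add: monom_1_dvd_iff')
    then obtain R' where R': "R = [:0, 1:] ^ ?\<mu> * R'" unfolding X_power dvd_def by blast
    have "map_poly j r = R \<circ>\<^sub>p [:- \<eta>, 1:]"
    proof -
      have "[:\<eta>, 1:] \<circ>\<^sub>p [:- \<eta>, 1:] = [:0, 1:]" by (simp add: pcompose_pCons)
      then show ?thesis unfolding R_def by (simp add: pcompose_assoc[symmetric] pcompose_idR)
    qed
    also have "\<dots> = [:- \<eta>, 1:] ^ ?\<mu> * (R' \<circ>\<^sub>p [:- \<eta>, 1:])"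
      unfolding R' by (simp only: pcompose_mult pcompose_hom.hom_power) (simp add: pcompose_pCons)
    finally show "[:- \<eta>, 1:] ^ ?\<mu> dvd map_poly j r" by simp
  qed
  moreover have "r = 0 \<or> degree r < d"
  proof (cases "r = 0")
    case False
    then have "\<not> d \<le> degree r" using qr(2) by (metis leading_coeff_0_iff)
    then show ?thesis by simp
  qed simp
  ultimately have "r = 0"
    using G.W_monic(2) dvd_imp_degree_le[of "map_poly j G.W" "map_poly j r"] by fastforce
  \<comment> \<open>At parameter 0 the flow is the identity, so the division without remainder
    specialises to divisibility of \<open>U\<close> by \<open>w\<close>.\<close>
  then have "flow U $ 0 = q $ 0 * G $ 0" by (simp add: qr(1))
  then show ?thesis by (simp add: flow_0 G_def)
qed

end

lemma comm_ring_hom_zero_hom: "comm_ring_hom f \<Longrightarrow> zero_hom f"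
proof -
  assume "comm_ring_hom f"
  then interpret comm_ring_hom f .
  show ?thesis by unfold_locales
qed

lemma field_hom_comp:
  assumes "field_hom f" "field_hom g" shows "field_hom (\<lambda>x. f (g x))"
proof -
  interpret f: field_hom f by fact
  interpret g: field_hom g by fact
  show ?thesis by unfold_locales (simp_all only: g.hom_add g.hom_mult g.hom_one g.hom_zero f.hom_add f.hom_mult f.hom_one f.hom_zero)
qed

section \<open>Integrality of traces of differentials\<close>

definition fract_lift :: "('a::idom \<Rightarrow> 'b::field) \<Rightarrow> 'a fract \<Rightarrow> 'b" where
  "fract_lift f q = (SOME y. \<exists>a b. b \<noteq> 0 \<and> q = Fract a b \<and> y = f a / f b)"

lemma fract_lift_Fract:
  assumes "inj_comm_ring_hom f" "b \<noteq> 0"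
  shows "fract_lift f (Fract a b) = f a / f b"
proof -
  interpret f: inj_comm_ring_hom f by fact
  have "\<exists>a' b'. b' \<noteq> 0 \<and> Fract a b = Fract a' b' \<and> fract_lift f (Fract a b) = f a' / f b'"
    unfolding fract_lift_def by (rule someI_ex) (use assms(2) in blast)
  then obtain a' b' where *: "b' \<noteq> 0" "Fract a b = Fract a' b'" "fract_lift f (Fract a b) = f a' / f b'" by blast
  then have "a * b' = a' * b" using assms(2) by (simp add: eq_fract)
  then have "f a * f b' = f a' * f b" by (metis f.hom_mult)
  then show ?thesis using * assms(2) by (simp add: frac_eq_eq)
qed

lemma to_fract_eq: "to_fract a = Fract a 1" by (simp add: to_fract_def)

lemma Fract_eq_divide: "b \<noteq> 0 \<Longrightarrow> Fract a b = to_fract a / to_fract b"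
  by (simp add: to_fract_def divide_fract)

lemma fract_lift_to_fract [simp]: "inj_comm_ring_hom f \<Longrightarrow> fract_lift f (to_fract a) = f a"
proof -
  assume f: "inj_comm_ring_hom f"
  interpret f: inj_comm_ring_hom f by fact
  show ?thesis using fract_lift_Fract[OF f, of 1 a] by (simp add: to_fract_def)
qed

lemma field_hom_fract_lift:
  assumes f: "inj_comm_ring_hom f"
  shows "field_hom (fract_lift f)"
proof -
  interpret f: inj_comm_ring_hom f by fact
  show ?thesis
  proof unfold_locales
    fix p q :: "'a fract"
    obtain a b where p: "p = Fract a b" "b \<noteq> 0" by (cases p) auto
    obtain c d where q: "q = Fract c d" "d \<noteq> 0" by (cases q) auto
    show "fract_lift f (p + q) = fract_lift f p + fract_lift f q"
      using p(2) q(2) by (simp add: p q fract_lift_Fract[OF f] f.hom_add f.hom_mult add_frac_eq)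
    show "fract_lift f (p * q) = fract_lift f p * fract_lift f q"
      using p(2) q(2) by (simp add: p q fract_lift_Fract[OF f] f.hom_mult)
  next
    show "fract_lift f 1 = 1" using fract_lift_to_fract[OF f, of 1] by simp
    show "fract_lift f 0 = 0" using fract_lift_to_fract[OF f, of 0] by simp
  qed
qed

text \<open>The quotient rule; independence of the representing fraction follows by differentiating
  the cross-multiplied identity.\<close>

lemma fract_exists_derivation:
  fixes D :: "'a::idom \<Rightarrow> 'a"
  assumes D: "derivation_along (\<lambda>x. x) D"
  shows "\<exists>D'. derivation_along (\<lambda>x. x) D' \<and> (\<forall>a. D' (to_fract a) = to_fract (D a))"
proof -
  let ?t = "to_fract :: 'a \<Rightarrow> 'a fract"
  define Q where "Q a b = (?t b * ?t (D a) - ?t a * ?t (D b)) / (?t b * ?t b)" for a b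
  define D' where "D' q = (SOME y. \<exists>a b. b \<noteq> 0 \<and> q = Fract a b \<and> y = Q a b)" for q
  have D': "D' (Fract a b) = Q a b" if b: "b \<noteq> 0" for a b
  proof -
    have "\<exists>a' b'. b' \<noteq> 0 \<and> Fract a b = Fract a' b' \<and> D' (Fract a b) = Q a' b'"
      unfolding D'_def by (rule someI_ex) (use b in blast)
    then obtain a' b' where *: "b' \<noteq> 0" "Fract a b = Fract a' b'" "D' (Fract a b) = Q a' b'" by blast
    then have e: "a * b' = a' * b" using b by (simp add: eq_fract)
    have "D (a * b') = D (a' * b)" by (simp only: e)
    then have dd: "a * D b' + b' * D a = a' * D b + b * D a'" by (simp add: derivation_alongD[OF D])
    have e': "?t a * ?t b' = ?t a' * ?t b" by (metis e to_fract_mult)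
    have dd': "?t a * ?t (D b') + ?t b' * ?t (D a) = ?t a' * ?t (D b) + ?t b * ?t (D a')"
      by (metis dd to_fract_mult to_fract_add)
    have nz: "?t b \<noteq> 0" "?t b' \<noteq> 0" using b * by auto
    have "(?t b * ?t (D a) - ?t a * ?t (D b)) * (?t b' * ?t b') = (?t b' * ?t (D a') - ?t a' * ?t (D b')) * (?t b * ?t b)"
    proof -
      have "(?t b * ?t (D a) - ?t a * ?t (D b)) * (?t b' * ?t b')
          = ?t b * ?t b' * (?t b' * ?t (D a)) - (?t a * ?t b') * ?t b' * ?t (D b)" by (simp add: algebra_simps)
      also have "\<dots> = ?t b * ?t b' * (?t a' * ?t (D b) + ?t b * ?t (D a') - ?t a * ?t (D b')) - (?t a' * ?t b) * ?t b' * ?t (D b)"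
      proof -
        have "?t b' * ?t (D a) = ?t a' * ?t (D b) + ?t b * ?t (D a') - ?t a * ?t (D b')"
          using dd' by (simp add: algebra_simps)
        then show ?thesis by (simp only: e')
      qed
      also have "\<dots> = ?t b * ?t b' * (?t b * ?t (D a')) - ?t b * (?t a * ?t b') * ?t (D b')" by (simp add: algebra_simps)
      also have "\<dots> = (?t b' * ?t (D a') - ?t a' * ?t (D b')) * (?t b * ?t b)" unfolding e' by (simp add: algebra_simps)
      finally show ?thesis .
    qed
    then have "Q a' b' = Q a b" unfolding Q_def using nz by (simp add: frac_eq_eq)
    then show ?thesis using * by simp
  qed
  have "derivation_along (\<lambda>x. x) D'"
    unfolding derivation_along_def
  proof (intro conjI allI)
    fix p q :: "'a fract"
    obtain a b where p: "p = Fract a b" "b \<noteq> 0" by (cases p) auto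
    obtain c d where q: "q = Fract c d" "d \<noteq> 0" by (cases q) auto
    have nz: "?t b \<noteq> 0" "?t d \<noteq> 0" using p q by auto
    have "D' (p + q) = Q (a * d + c * b) (b * d)" using p q by (simp add: D')
    also have "\<dots> = Q a b + Q c d" unfolding Q_def derivation_alongD[OF D] to_fract_add to_fract_mult
      using nz by (simp add: field_simps)
    finally show "D' (p + q) = D' p + D' q" using p q by (simp add: D')
    have "D' (p * q) = Q (a * c) (b * d)" using p q by (simp add: D')
    also have "\<dots> = ?t a / ?t b * Q c d + ?t c / ?t d * Q a b" unfolding Q_def derivation_alongD[OF D] to_fract_add to_fract_mult
      using nz by (simp add: field_simps)
    finally have *: "D' (p * q) = ?t a / ?t b * Q c d + ?t c / ?t d * Q a b" .
    have "p = ?t a / ?t b" "q = ?t c / ?t d" "D' p = Q a b" "D' q = Q c d"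
      using Fract_eq_divide[OF p(2)] Fract_eq_divide[OF q(2)] D'[OF p(2)] D'[OF q(2)] by (simp_all only: p(1) q(1))
    with * show "D' (p * q) = p * D' q + q * D' p" by simp
  qed
  moreover have "D' (to_fract a) = to_fract (D a)" for a
  proof -
    have "D 1 = D 1 + D 1" using derivation_alongD(2)[OF D, of 1 1] by simp
    then have "D 1 = 0" by (rule add_cancel_right_right[THEN iffD1])
    then show ?thesis using D'[of 1 a] by (simp add: Q_def to_fract_eq[symmetric])
  qed
  ultimately show ?thesis by blast
qed

lemma derivation_along_fract_eqI:
  fixes \<theta> :: "'a::idom fract \<Rightarrow> 'b::field"
  assumes "field_hom \<theta>" and D: "derivation_along \<theta> D1" "derivation_along \<theta> D2"
    and eq: "\<And>a. D1 (to_fract a) = D2 (to_fract a)"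
  shows "D1 q = D2 q"
proof -
  interpret t: field_hom \<theta> by fact
  obtain a b where q: "q = Fract a b" "b \<noteq> 0" by (cases q) auto
  have m: "q * to_fract b = to_fract a" using q by (simp add: Fract_eq_divide)
  have "\<theta> (to_fract b) * D1 q = \<theta> (to_fract b) * D2 q"
    using derivation_alongD(2)[OF D(1), of q "to_fract b"] derivation_alongD(2)[OF D(2), of q "to_fract b"] eq
    unfolding m by auto
  moreover have "\<theta> (to_fract b) \<noteq> 0" using q(2) by simp
  ultimately show ?thesis by simp
qed

lemma fract_common_denominator:
  fixes q :: "'n::finite \<Rightarrow> 'a::idom fract"
  obtains w u where "w \<noteq> 0" "\<And>j. q j * to_fract w = to_fract (u j)"
proof -
  have "\<exists>w u. w \<noteq> 0 \<and> (\<forall>j\<in>A. q j * to_fract w = to_fract (u j))" for A :: "'n set"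
    using finite[of A]
  proof (induction A rule: finite_induct)
    case (insert x A)
    then obtain w u where w: "w \<noteq> 0" "\<forall>j\<in>A. q j * to_fract w = to_fract (u j)" by blast
    obtain a b where ab: "q x = Fract a b" "b \<noteq> 0" by (cases "q x") auto
    have "q x * to_fract (w * b) = to_fract (w * a)"
      using ab by (simp add: Fract_eq_divide)
    moreover have "q j * to_fract (w * b) = to_fract (u j * b)" if "j \<in> A" for j
      using w(2) that by (simp add: mult.assoc[symmetric])
    ultimately show ?case using w(1) ab(2) insert.hyps
      by (intro exI[of _ "w * b"] exI[of _ "\<lambda>j. if j = x then w * a else u j * b"]) auto
  qed (intro exI[of _ 1], simp)
  from this[of UNIV] show ?thesis using that by auto
qed

text \<open>With a pole in \<open>x\<close>, the term \<open>x\<^sup>n\<close> of the integral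
  equation would have strictly smaller order than all other terms and could not be
  cancelled.\<close>

lemma fls_integral_nonneg:
  fixes x :: "'f::field fls"
  assumes P: "lead_coeff P = 1" "\<And>i. fls_subdegree (coeff P i) \<ge> 0" and x: "poly P x = 0"
  shows "fls_subdegree x \<ge> 0"
proof (rule ccontr)
  assume neg: "\<not> ?thesis"
  then have x0: "x \<noteq> 0" by auto
  define n where "n = degree P"
  define s where "s = fls_subdegree x"
  have s: "s < 0" using neg by (simp add: s_def)
  have "x ^ n + (\<Sum>i<n. coeff P i * x ^ i) = 0"
    using x P(1) unfolding poly_altdef n_def[symmetric] lessThan_Suc_atMost[symmetric] by (simp add: n_def add.commute)
  moreover have "fls_nth (\<Sum>i<n. coeff P i * x ^ i) (int n * s) = 0"
  proof -
    have "fls_nth (coeff P i * x ^ i) (int n * s) = 0" if "i < n" for i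
    proof (rule fls_times_nth_eq0)
      have "int n * s < int i * s" using that s by simp
      then show "int n * s < fls_subdegree (coeff P i) + fls_subdegree (x ^ i)"
        using P(2)[of i] by (simp add: fls_subdegree_pow s_def)
    qed
    then show ?thesis by (simp add: fls_nth_sum)
  qed
  ultimately have "fls_nth (x ^ n) (int n * s) = 0" by (metis add.right_neutral fls_plus_nth fls_zero_nth)
  moreover have "fls_nth (x ^ n) (int n * s) = fls_nth x s ^ n" unfolding s_def by (rule fls_pow_base)
  ultimately show False using x0 by (simp add: s_def)
qed

text \<open>The factor \<open>1/N\<close> makes this \<open>x d/dx\<close> for the original parameter \<open>x = t\<^sup>N\<close>.\<close>

definition puiseux_logderiv :: "nat \<Rightarrow> 'f::field_char_0 fls \<Rightarrow> 'f fls" where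
  "puiseux_logderiv N f = fls_const (inverse (of_nat N)) * (fls_X * fls_deriv f)"

lemma puiseux_logderiv_nth: "fls_nth (puiseux_logderiv N f) n = inverse (of_nat N) * (of_int n * fls_nth f n)"
  by (simp add: puiseux_logderiv_def fls_X_times_conv_shift)

lemma puiseux_logderiv_cpw:
  assumes "N > 0" shows "puiseux_logderiv N (cpw N f) = cpw N (fls_X * fls_deriv f)"
proof (rule fls_eqI)
  fix n
  show "fls_nth (puiseux_logderiv N (cpw N f)) n = fls_nth (cpw N (fls_X * fls_deriv f)) n"
    using assms by (auto simp: puiseux_logderiv_nth cpw_nth fls_X_times_conv_shift elim!: dvdE)
qed

lemma derivation_along_puiseux_logderiv: "derivation_along (\<lambda>x. x) (puiseux_logderiv N)"
  unfolding derivation_along_def puiseux_logderiv_def by (simp add: algebra_simps)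

lemma inj_comm_ring_hom_fps_to_fls: "inj_comm_ring_hom (fps_to_fls :: 'f::field fps \<Rightarrow> 'f fls)"
  by unfold_locales (simp_all add: fls_times_fps_to_fls)

section \<open>Germs as embeddings into Laurent series\<close>

lemma (in generic_direction) comm_ring_hom_germ:
  "comm_ring_hom \<epsilon> \<Longrightarrow> comm_ring_hom (germ \<epsilon> :: _ \<Rightarrow> 'f::field_char_0 fps)"
  unfolding germ_def by (rule taylor_data.comm_ring_hom_taylor[OF taylor_data_germ])

lemma (in generic_direction) inj_comm_ring_hom_germ_fls:
  fixes \<epsilon> :: "('n, 'q) mps \<Rightarrow> 'f::field_char_0"
  assumes \<epsilon>: "comm_ring_hom \<epsilon>" and nz: "\<And>s. s \<noteq> 0 \<Longrightarrow> germ \<epsilon> (\<iota> s) \<noteq> 0"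
  shows "inj_comm_ring_hom (\<lambda>s. fps_to_fls (germ \<epsilon> (\<iota> s)))"
proof -
  have "comm_ring_hom (\<lambda>s. fps_to_fls (germ \<epsilon> (\<iota> s)))"
    using comm_ring_hom_comp[OF inj_comm_ring_hom_fps_to_fls[unfolded inj_comm_ring_hom_def, THEN conjunct1]
        comm_ring_hom_comp[OF comm_ring_hom_germ[OF \<epsilon>] \<iota>.comm_ring_hom_axioms]] .
  moreover have "s = 0" if "fps_to_fls (germ \<epsilon> (\<iota> s)) = 0" for s
    using that nz[of s] by (metis fps_to_fls_eq_0_iff)
  ultimately show ?thesis unfolding inj_comm_ring_hom_def zero_hom_0_def zero_hom_0_axioms_def
    using comm_ring_hom.axioms by (auto simp: comm_ring_hom_def Ring_Hom.ring_hom_def semiring_hom_def comm_monoid_add_hom_def monoid_add_hom_def)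
qed

lemma mps_ddir_const: "mps_ddir Y (mps_const c) = 0"
proof -
  have "mps_ddir Y 1 = mps_ddir Y 1 + mps_ddir Y 1"
    using derivation_alongD(2)[OF derivation_along_mps_ddir[of Y], of 1 1] by simp
  then have "mps_ddir Y 1 = 0" by (rule add_cancel_right_right[THEN iffD1])
  then show ?thesis using mps_ddir_const_mult[of Y c 1] by simp
qed

lemma (in generic_direction) germ_const:
  fixes \<epsilon> :: "('n, 'q) mps \<Rightarrow> 'f::field_char_0"
  assumes "comm_ring_hom \<epsilon>"
  shows "germ \<epsilon> (mps_const c) = fps_const (\<epsilon> (mps_const c))"
proof (rule fps_ext)
  fix k
  have e0: "\<epsilon> 0 = 0" using assms by (rule zero_hom.hom_zero[OF comm_ring_hom_zero_hom])
  have "(mps_ddir Y ^^ Suc k) (mps_const c) = 0" for k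
    by (induction k) (simp_all add: mps_ddir_const derivation_along_0[OF derivation_along_mps_ddir])
  then show "germ \<epsilon> (mps_const c) $ k = fps_const (\<epsilon> (mps_const c)) $ k"
    by (cases k) (simp_all add: germ_def taylor_def e0 del: funpow.simps(2))
qed

lemma (in generic_direction) deriv_germ:
  fixes \<epsilon> :: "('n, 'q) mps \<Rightarrow> 'f::field_char_0"
  assumes "comm_ring_hom \<epsilon>"
  shows "fps_deriv (germ \<epsilon> s) = germ \<epsilon> (mps_ddir Y s)"
  unfolding germ_def by (rule taylor_data.deriv_taylor[OF taylor_data_germ[OF assms]])

section \<open>Traces of differential forms and their poles\<close>

locale differential_trace = generic_direction \<kappa> Y + alg_ext h
  for \<kappa> :: "'k::field_char_0 \<Rightarrow> 'q::field_char_0" and Y :: "'n::finite \<Rightarrow> 'q"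
    and h :: "('n, 'k) mps fract \<Rightarrow> 'l::field"
begin

definition \<phi> :: "('n, 'k) mps \<Rightarrow> 'l" where "\<phi> r = h (to_fract r)"

definition kd :: "'n \<Rightarrow> ('n, 'k) mps fract \<Rightarrow> ('n, 'k) mps fract" where
  "kd j = (SOME D. derivation_along (\<lambda>x. x) D \<and> (\<forall>a. D (to_fract a) = to_fract (mps_deriv j a)))"

lemma kd: "derivation_along (\<lambda>x. x) (kd j)" "kd j (to_fract a) = to_fract (mps_deriv j a)"
proof -
  have "derivation_along (\<lambda>x. x) (kd j) \<and> (\<forall>a. kd j (to_fract a) = to_fract (mps_deriv j a))"
    unfolding kd_def by (rule someI_ex[OF fract_exists_derivation[OF derivation_along_mps_deriv]])
  then show "derivation_along (\<lambda>x. x) (kd j)" "kd j (to_fract a) = to_fract (mps_deriv j a)" by simp_all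
qed

lemma derivation_along_h_kd: "derivation_along h (\<lambda>a. h (kd j a))"
  unfolding derivation_along_def derivation_alongD[OF kd(1)] hom_add hom_mult by simp

definition ld :: "'n \<Rightarrow> 'l \<Rightarrow> 'l" where "ld j = del (\<lambda>a. h (kd j a))"

lemma derivation_along_ld: "derivation_along (\<lambda>x. x) (ld j)"
  unfolding ld_def by (rule derivation_along_del[OF derivation_along_h_kd])

lemma ld_h: "ld j (h a) = h (kd j a)"
  unfolding ld_def by (rule del_h[OF derivation_along_h_kd])

lemma ld_\<phi>: "ld j (\<phi> r) = \<phi> (mps_deriv j r)"
  by (simp add: \<phi>_def ld_h kd)

lemma ld_in_adj: "a \<in> adj c \<Longrightarrow> ld j a \<in> adj c"
  unfolding ld_def by (rule del_in_adj[OF derivation_along_h_kd]) auto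

definition \<iota>K :: "('n, 'k) mps fract \<Rightarrow> ('n, 'q) mps fract" where
  "\<iota>K = fract_lift (\<lambda>s. to_fract (\<iota> s))"

lemma inj_to_fract_\<iota>: "inj_comm_ring_hom (\<lambda>s. to_fract (\<iota> s) :: ('n, 'q) mps fract)"
  by unfold_locales (simp_all only: \<iota>.hom_add \<iota>.hom_mult \<iota>.hom_zero \<iota>.hom_one to_fract_0 to_fract_1
      to_fract_add to_fract_mult to_fract_eq_0_iff \<iota>.hom_0_iff)

sublocale \<iota>K: field_hom \<iota>K
  unfolding \<iota>K_def by (rule field_hom_fract_lift[OF inj_to_fract_\<iota>])

lemma \<iota>K_to_fract: "\<iota>K (to_fract s) = to_fract (\<iota> s)"
  unfolding \<iota>K_def by (rule fract_lift_to_fract[OF inj_to_fract_\<iota>])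

text \<open>
  The trace from \<open>h(K)(\<gamma>)\<close> of the differential form \<open>\<Sum>\<^sub>j v\<^sub>j dX\<^sub>j\<close>, contracted with the direction \<open>Y\<close>.
\<close>

definition dtr :: "'l \<Rightarrow> ('n \<Rightarrow> 'l) \<Rightarrow> ('n, 'q) mps fract" where
  "dtr \<gamma> v = (\<Sum>j\<in>UNIV. to_fract (mps_const (Y j)) * \<iota>K (tr \<gamma> (v j)))"

text \<open>Over Puiseux series the minimal polynomial of \<open>\<gamma>\<close> splits, its roots
  give the conjugate embeddings of \<open>adj \<gamma>\<close>, and the trace is the sum over them.
  Integral elements have nonnegative order and logarithmic derivatives of them have positive order,
  so the parameter times the contracted trace has positive order. As that trace is a Laurent series
  in the unramified parameter, it has no pole.\<close>

lemma germ_no_pole: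
  fixes \<epsilon> :: "('n, 'q) mps \<Rightarrow> 'f::{alg_closed_field, field_char_0}"
  assumes \<epsilon>: "comm_ring_hom \<epsilon>" and nz: "\<And>s. s \<noteq> 0 \<Longrightarrow> germ \<epsilon> (\<iota> s) \<noteq> 0"
    and b: "b \<in> adj \<gamma>" "b \<in> integral_closure \<phi>" and c: "c \<in> adj \<gamma>" "c \<in> integral_closure \<phi>"
    and w: "w \<noteq> 0" "\<And>j. tr \<gamma> (b * ld j c) * to_fract w = to_fract (u j)"
  shows "germ \<epsilon> (\<iota> w) dvd germ \<epsilon> (\<Sum>j\<in>UNIV. mps_const (Y j) * \<iota> (u j))"
proof -
  interpret g: comm_ring_hom "germ \<epsilon>" 
    by (rule comm_ring_hom_germ[OF \<epsilon>])
  interpret fl: inj_comm_ring_hom "fps_to_fls :: 'f fps \<Rightarrow> 'f fls"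
    by (rule inj_comm_ring_hom_fps_to_fls)
  define \<psi> where "\<psi> s = fps_to_fls (germ \<epsilon> (\<iota> s))" for s
  have \<psi>: "inj_comm_ring_hom \<psi>"
    unfolding \<psi>_def by (rule inj_comm_ring_hom_germ_fls[OF \<epsilon> nz])
  define \<Psi> where "\<Psi> = fract_lift \<psi>"
  interpret \<Psi>: field_hom \<Psi> unfolding \<Psi>_def by (rule field_hom_fract_lift[OF \<psi>])
  have \<Psi>tf: "\<Psi> (to_fract s) = \<psi> s" for s unfolding \<Psi>_def by (rule fract_lift_to_fract[OF \<psi>])
  define y where "y j = fls_const (\<epsilon> (mps_const (Y j)))" for j
  have gY: "germ \<epsilon> (mps_const (Y j)) = fps_const (\<epsilon> (mps_const (Y j)))" for j
    by (rule germ_const[OF \<epsilon>])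
  have d\<psi>: "fls_deriv (\<psi> s) = (\<Sum>j\<in>UNIV. y j * \<psi> (mps_deriv j s))" for s
  proof -
    have "fps_deriv (germ \<epsilon> (\<iota> s)) = germ \<epsilon> (mps_ddir Y (\<iota> s))"
      by (rule deriv_germ[OF \<epsilon>])
    also have "\<dots> = (\<Sum>j\<in>UNIV. fps_const (\<epsilon> (mps_const (Y j))) * germ \<epsilon> (\<iota> (mps_deriv j s)))"
      by (simp only: mps_ddir_def g.hom_sum g.hom_mult gY mps_deriv_map[OF \<kappa>.comm_ring_hom_axioms])
    finally have "fps_to_fls (fps_deriv (germ \<epsilon> (\<iota> s))) = (\<Sum>j\<in>UNIV. y j * \<psi> (mps_deriv j s))"
      by (simp only: fl.hom_sum fl.hom_mult y_def \<psi>_def fps_const_to_fls)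
    then show ?thesis by (simp add: \<psi>_def fls_deriv_fps_to_fls)
  qed
  have d\<Psi>: "fls_deriv (\<Psi> k) = (\<Sum>j\<in>UNIV. y j * \<Psi> (kd j k))" for k
  proof (rule derivation_along_fract_eqI[OF \<Psi>.field_hom_axioms])
    show "derivation_along \<Psi> (\<lambda>k. fls_deriv (\<Psi> k))"
      by (simp add: derivation_along_def \<Psi>.hom_add \<Psi>.hom_mult algebra_simps)
    show "derivation_along \<Psi> (\<lambda>k. \<Sum>j\<in>UNIV. y j * \<Psi> (kd j k))"
      unfolding derivation_along_def
    proof (intro conjI allI)
      fix p q
      show "(\<Sum>j\<in>UNIV. y j * \<Psi> (kd j (p + q))) = (\<Sum>j\<in>UNIV. y j * \<Psi> (kd j p)) + (\<Sum>j\<in>UNIV. y j * \<Psi> (kd j q))"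
        by (simp only: derivation_alongD[OF kd(1)] \<Psi>.hom_add distrib_left sum.distrib)
      show "(\<Sum>j\<in>UNIV. y j * \<Psi> (kd j (p * q))) = \<Psi> p * (\<Sum>j\<in>UNIV. y j * \<Psi> (kd j q)) + \<Psi> q * (\<Sum>j\<in>UNIV. y j * \<Psi> (kd j p))"
        by (simp only: derivation_alongD[OF kd(1)] \<Psi>.hom_add \<Psi>.hom_mult distrib_left sum.distrib sum_distrib_left mult.left_commute)
    qed
    show "fls_deriv (\<Psi> (to_fract a)) = (\<Sum>j\<in>UNIV. y j * \<Psi> (kd j (to_fract a)))" for a
      by (simp only: \<Psi>tf d\<psi> kd(2))
  qed
  have "lead_coeff (map_poly \<Psi> (mpoly \<gamma>)) = 1" using mpoly_props(1)[of \<gamma>] by simp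
  from newton_puiseux[OF this] obtain N rs where N: "N > 0"
    and rs': "map_poly (cpw N) (map_poly \<Psi> (mpoly \<gamma>)) = (\<Prod>r\<leftarrow>rs. [:- r, 1:])"
    unfolding puiseux_splits_def by blast
  interpret cN: field_hom "cpw N :: 'f fls \<Rightarrow> _" by (rule field_hom_cpw[OF N])
  define \<Theta> where "\<Theta> k = cpw N (\<Psi> k)" for k
  interpret \<Theta>: field_hom \<Theta>
    unfolding \<Theta>_def by (rule field_hom_comp[OF cN.field_hom_axioms \<Psi>.field_hom_axioms])
  interpret \<Theta>p: map_poly_inj_idom_hom \<Theta> ..
  have rs: "map_poly \<Theta> (mpoly \<gamma>) = (\<Prod>r\<leftarrow>rs. [:- r, 1:])"
    unfolding rs'[symmetric] by (rule poly_eqI) (simp add: \<Theta>_def)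
  let ?\<Delta> = "puiseux_logderiv N :: 'f fls \<Rightarrow> 'f fls"
  note \<Delta> = derivation_alongD[OF derivation_along_puiseux_logderiv[of N]]
  \<comment> \<open>The extra factor of the parameter turns the derivative into the logarithmic
    one.\<close>
  define y' where "y' j = cpw N (fls_X * y j)" for j
  have \<Delta>\<Theta>: "?\<Delta> (\<Theta> k) = (\<Sum>j\<in>UNIV. y' j * \<Theta> (kd j k))" for k
    unfolding \<Theta>_def puiseux_logderiv_cpw[OF N] d\<Psi> y'_def
    by (simp only: sum_distrib_left cN.hom_sum cN.hom_mult mult.assoc)
  define er where "er r p = poly (map_poly \<Theta> p) r" for r p
  have er_hom: "er r (p + q) = er r p + er r q" "er r (p * q) = er r p * er r q" "er r 0 = 0" "er r 1 = 1" "er r [:a:] = \<Theta> a"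
    "er r [:0, 1:] = r" for r p q a
    by (simp_all add: er_def \<Theta>p.hom_add \<Theta>p.hom_mult \<Theta>.map_poly_pCons_hom)
  \<comment> \<open>The embedding of \<open>adj \<gamma>\<close> that sends \<open>\<gamma>\<close>
    to the root \<open>r\<close>, through a chosen polynomial representative.\<close>
  define \<chi> where "\<chi> r a = er r (SOME p. ev \<gamma> p = a)" for r a
  have root: "er r (mpoly \<gamma>) = 0" if "r \<in> set rs" for r
    unfolding er_def rs using that by (induction rs) auto
  have \<chi>: "\<chi> r (ev \<gamma> p) = er r p" if r: "r \<in> set rs" for r p
  proof -
    define q where "q = (SOME q. ev \<gamma> q = ev \<gamma> p)"
    have "ev \<gamma> q = ev \<gamma> p" unfolding q_def by (rule someI) simp
    then have "ev \<gamma> (q - p) = 0" by (simp add: ev.hom_minus)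
    then obtain v where "q - p = mpoly \<gamma> * v" using mpoly_dvd unfolding dvd_def by blast
    then have "q = p + mpoly \<gamma> * v" by (simp add: algebra_simps)
    then show ?thesis using root[OF r] by (simp add: \<chi>_def q_def[symmetric] er_hom)
  qed
  have \<chi>_mult: "\<chi> r (a * a') = \<chi> r a * \<chi> r a'" if "r \<in> set rs" "a \<in> adj \<gamma>" "a' \<in> adj \<gamma>" for r a a'
    using that by (metis \<chi> adjE er_hom(2) ev.hom_mult)
  have \<chi>_poly: "poly (map_poly \<Theta> q) (\<chi> r a) = \<chi> r (ev a q)" if r: "r \<in> set rs" and a: "a \<in> adj \<gamma>" for r a q
  proof -
    obtain p where p: "a = ev \<gamma> p" using a by (metis adjE)
    have "\<chi> r (ev a q) = er r (q \<circ>\<^sub>p p)" unfolding p ev_pcompose[symmetric] by (rule \<chi>[OF r])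
    also have "\<dots> = poly (map_poly \<Theta> q) (er r p)" by (simp add: er_def \<Theta>.map_poly_pcompose poly_pcompose)
    finally show ?thesis by (simp add: p \<chi>[OF r])
  qed
  have \<Delta>\<chi>: "?\<Delta> (\<chi> r a) = (\<Sum>j\<in>UNIV. y' j * \<chi> r (ld j a))" if r: "r \<in> set rs" and a: "a \<in> adj \<gamma>" for r a
  proof -
    \<comment> \<open>Uniqueness of the extension of a derivation: the difference
      \<open>\<delta>\<close> of the two candidates vanishes on constants, so it is a multiple of
      its value at the indeterminate; the minimal polynomial, having a nonvanishing derivative at
      \<open>r\<close>, makes that value 0.\<close>
    define \<delta> where "\<delta> p = ?\<Delta> (er r p) - (\<Sum>j\<in>UNIV. y' j * \<chi> r (ld j (ev \<gamma> p)))" for p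
    have \<chi>ld: "\<chi> r (ld j (ev \<gamma> (p + q))) = \<chi> r (ld j (ev \<gamma> p)) + \<chi> r (ld j (ev \<gamma> q))"
      "\<chi> r (ld j (ev \<gamma> (p * q))) = er r p * \<chi> r (ld j (ev \<gamma> q)) + er r q * \<chi> r (ld j (ev \<gamma> p))" for j p q
    proof -
      obtain p' where p': "ld j (ev \<gamma> p) = ev \<gamma> p'" using ld_in_adj[of "ev \<gamma> p" \<gamma> j] by (auto elim: adjE)
      obtain q' where q': "ld j (ev \<gamma> q) = ev \<gamma> q'" using ld_in_adj[of "ev \<gamma> q" \<gamma> j] by (auto elim: adjE)
      have "ld j (ev \<gamma> (p + q)) = ev \<gamma> (p' + q')"
        unfolding ev.hom_add derivation_alongD(1)[OF derivation_along_ld] p' q' ..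
      then show "\<chi> r (ld j (ev \<gamma> (p + q))) = \<chi> r (ld j (ev \<gamma> p)) + \<chi> r (ld j (ev \<gamma> q))"
        unfolding p' q' by (simp only: \<chi>[OF r] er_hom)
      have "ld j (ev \<gamma> (p * q)) = ev \<gamma> (p * q' + q * p')"
        unfolding ev.hom_mult ev.hom_add derivation_alongD(2)[OF derivation_along_ld] p' q' ..
      then show "\<chi> r (ld j (ev \<gamma> (p * q))) = er r p * \<chi> r (ld j (ev \<gamma> q)) + er r q * \<chi> r (ld j (ev \<gamma> p))"
        unfolding p' q' by (simp only: \<chi>[OF r] er_hom)
    qed
    have \<delta>_add: "\<delta> (p + q) = \<delta> p + \<delta> q" for p q
      unfolding \<delta>_def \<chi>ld(1) er_hom(1) \<Delta>(1) distrib_left sum.distrib by simp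
    have \<delta>_mult: "\<delta> (p * q) = er r p * \<delta> q + er r q * \<delta> p" for p q
    proof -
      have "(\<Sum>j\<in>UNIV. y' j * \<chi> r (ld j (ev \<gamma> (p * q)))) =
          er r p * (\<Sum>j\<in>UNIV. y' j * \<chi> r (ld j (ev \<gamma> q))) + er r q * (\<Sum>j\<in>UNIV. y' j * \<chi> r (ld j (ev \<gamma> p)))"
        by (simp only: \<chi>ld(2) distrib_left sum.distrib sum_distrib_left mult.left_commute)
      then show ?thesis unfolding \<delta>_def er_hom(2) \<Delta>(2) by (simp add: algebra_simps)
    qed
    have \<delta>_const: "\<delta> [:k:] = 0" for k
    proof -
      have "\<chi> r (ld j (ev \<gamma> [:k:])) = \<Theta> (kd j k)" for j
        using \<chi>[OF r, of "[:kd j k:]"] by (simp add: ld_h er_hom)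
      then show ?thesis by (simp add: \<delta>_def er_hom \<Delta>\<Theta>)
    qed
    have \<delta>_pderiv: "\<delta> p = er r (pderiv p) * \<delta> [:0, 1:]" for p
    proof (induction p)
      case 0
      then show ?case using \<delta>_const[of 0] by (simp add: er_hom)
    next
      case (pCons a p)
      have e: "pCons a p = [:a:] + [:0, 1:] * p" by simp
      have "\<delta> (pCons a p) = r * \<delta> p + er r p * \<delta> [:0, 1:]"
        unfolding e \<delta>_add \<delta>_mult \<delta>_const er_hom by simp
      moreover have "er r (pderiv (pCons a p)) = er r p + r * er r (pderiv p)"
      proof -
        have "pderiv (pCons a p) = p + [:0, 1:] * pderiv p" by (simp add: pderiv_pCons)
        then show ?thesis by (simp only: er_hom)
      qed
      ultimately show ?case by (subst (asm) pCons.IH) (simp add: algebra_simps)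
    qed
    have "\<delta> (mpoly \<gamma>) = 0"
    proof -
      have z: "ld j 0 = 0" for j by (rule derivation_along_0[OF derivation_along_ld])
      have z2: "\<chi> r 0 = 0" using \<chi>[OF r, of 0] by (simp add: er_hom ev.hom_zero)
      have z3: "?\<Delta> 0 = 0" by (rule derivation_along_0[OF derivation_along_puiseux_logderiv])
      show ?thesis unfolding \<delta>_def root[OF r] mpoly_props(2) z z2 z3 by simp
    qed
    then have *: "er r (pderiv (mpoly \<gamma>)) * \<delta> [:0, 1:] = 0" using \<delta>_pderiv[of "mpoly \<gamma>"] by simp
    have "inverse (ev \<gamma> (pderiv (mpoly \<gamma>))) \<in> adj \<gamma>" by (rule adj_inverse) simp
    then obtain q where q: "inverse (ev \<gamma> (pderiv (mpoly \<gamma>))) = ev \<gamma> q" by (auto elim: adjE)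
    have "ev \<gamma> (q * pderiv (mpoly \<gamma>)) = 1" unfolding ev.hom_mult q[symmetric] using ev_pderiv_mpoly[of \<gamma>] by simp
    then have "er r (q * pderiv (mpoly \<gamma>)) = er r 1" using \<chi>[OF r, of "q * pderiv (mpoly \<gamma>)"] \<chi>[OF r, of 1]
      by (simp add: ev.hom_one)
    then have "er r (pderiv (mpoly \<gamma>)) \<noteq> 0" unfolding er_hom by auto
    then have "\<delta> [:0, 1:] = 0" using * by simp
    then have "\<delta> p = 0" for p using \<delta>_pderiv[of p] by simp
    moreover obtain p where "a = ev \<gamma> p" using a by (metis adjE)
    ultimately show ?thesis using \<chi>[OF r, of p] by (simp add: \<delta>_def)
  qed
  have nonneg: "fls_subdegree (\<chi> r a) \<ge> 0" if r: "r \<in> set rs" and a: "a \<in> adj \<gamma>" "a \<in> integral_closure \<phi>" for r a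
  proof -
    obtain P where P: "lead_coeff P = 1" "poly (map_poly \<phi> P) a = 0" using a(2) by (auto simp: integral_closure_def)
    define P' where "P' = map_poly to_fract P"
    have "map_poly h P' = map_poly \<phi> P" by (rule poly_eqI) (simp add: P'_def \<phi>_def coeff_map_poly)
    then have "ev a P' = 0" using P(2) by (simp add: ev_def)
    then have P0: "poly (map_poly \<Theta> P') (\<chi> r a) = 0" using \<chi>_poly[OF r a(1), of P'] \<chi>[OF r, of 0] by (simp add: er_hom ev.hom_zero)
    have P1: "lead_coeff (map_poly \<Theta> P') = 1"
    proof -
      have "degree P' = degree P" unfolding P'_def by (rule degree_map_poly) simp
      then show ?thesis using P(1) by (simp add: P'_def coeff_map_poly)
    qed
    have P2: "fls_subdegree (coeff (map_poly \<Theta> P') i) \<ge> 0" for i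
    proof -
      have "fls_nth (cpw N (fps_to_fls f)) n = 0" if "n < 0" for n and f :: "'f fps"
        using that N by (auto simp: cpw_nth elim!: dvdE) (simp add: mult_less_0_iff)
      then have "fls_subdegree (cpw N (fps_to_fls f)) \<ge> 0" for f :: "'f fps"
        by (metis fls_zero_subdegree linorder_not_le nth_fls_subdegree_nonzero order.refl)
      then show ?thesis by (simp add: P'_def coeff_map_poly \<Theta>_def \<Psi>tf \<psi>_def)
    qed
    show ?thesis by (rule fls_integral_nonneg[OF P1 P2 P0])
  qed
  define Gf where "Gf = (\<Sum>j\<in>UNIV. y j * \<Psi> (tr \<gamma> (b * ld j c)))"
  have "cpw N (fls_X * Gf) = (\<Sum>j\<in>UNIV. y' j * \<Theta> (tr \<gamma> (b * ld j c)))"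
    unfolding Gf_def y'_def \<Theta>_def by (simp only: sum_distrib_left cN.hom_sum cN.hom_mult mult.assoc)
  also have "\<dots> = (\<Sum>j\<in>UNIV. y' j * (\<Sum>r\<leftarrow>rs. \<chi> r b * \<chi> r (ld j c)))"
  proof (rule sum.cong, rule refl)
    fix j
    have "b * ld j c \<in> adj \<gamma>" using b(1) ld_in_adj[OF c(1)] by (rule adj_mult)
    then obtain p where p: "b * ld j c = ev \<gamma> p" by (metis adjE)
    have "\<Theta> (tr \<gamma> (b * ld j c)) = (\<Sum>r\<leftarrow>rs. er r p)"
      unfolding p er_def by (rule tr_transport[OF \<Theta>.field_hom_axioms rs])
    also have "\<dots> = (\<Sum>r\<leftarrow>rs. \<chi> r b * \<chi> r (ld j c))"
      by (rule arg_cong[of _ _ sum_list], rule map_cong[OF refl])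
        (metis \<chi> \<chi>_mult b(1) c(1) ld_in_adj p)
    finally show "y' j * \<Theta> (tr \<gamma> (b * ld j c)) = y' j * (\<Sum>r\<leftarrow>rs. \<chi> r b * \<chi> r (ld j c))" by simp
  qed
  also have "\<dots> = (\<Sum>r\<leftarrow>rs. \<chi> r b * (\<Sum>j\<in>UNIV. y' j * \<chi> r (ld j c)))"
  proof -
    have "(\<Sum>j\<in>UNIV. y' j * (\<Sum>r\<leftarrow>rs'. \<chi> r b * \<chi> r (ld j c))) = (\<Sum>r\<leftarrow>rs'. \<chi> r b * (\<Sum>j\<in>UNIV. y' j * \<chi> r (ld j c)))" for rs'
      by (induction rs') (simp_all add: distrib_left sum.distrib sum_distrib_left mult.left_commute)
    then show ?thesis .
  qed
  also have "\<dots> = (\<Sum>r\<leftarrow>rs. \<chi> r b * ?\<Delta> (\<chi> r c))"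
    by (rule arg_cong[of _ _ sum_list], rule map_cong[OF refl]) (simp only: \<Delta>\<chi> c(1))
  finally have XG: "cpw N (fls_X * Gf) = (\<Sum>r\<leftarrow>rs. \<chi> r b * ?\<Delta> (\<chi> r c))" .
  have zero: "fls_nth (\<chi> r b * ?\<Delta> (\<chi> r c)) n = 0" if r: "r \<in> set rs" and n: "n \<le> 0" for r n
  proof (cases "?\<Delta> (\<chi> r c) = 0")
    case False
    \<comment> \<open>The logarithmic derivative multiplies the coefficient at \<open>m\<close> by a
      multiple of \<open>m\<close>, so the constant term disappears.\<close>
    have "fls_nth (?\<Delta> (\<chi> r c)) m = 0" if "m \<le> 0" for m
      using that nonneg[OF r c] by (cases "m = 0") (simp_all add: puiseux_logderiv_nth)
    then have "fls_subdegree (?\<Delta> (\<chi> r c)) > 0"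
      using False by (metis linorder_not_le nth_fls_subdegree_nonzero)
    then show ?thesis using nonneg[OF r b] n by (intro fls_times_nth_eq0) linarith
  qed simp
  have zeros: "fls_nth (cpw N (fls_X * Gf)) n = 0" if "n \<le> 0" for n
  proof -
    have "set rs' \<subseteq> set rs \<Longrightarrow> fls_nth (\<Sum>r\<leftarrow>rs'. \<chi> r b * ?\<Delta> (\<chi> r c)) n = 0" for rs'
      using zero that by (induction rs') auto
    then show ?thesis unfolding XG by blast
  qed
  have "fls_nth Gf i = 0" if "i < 0" for i
  proof -
    \<comment> \<open>Coefficient \<open>i\<close> of \<open>Gf\<close> sits at
      \<open>N (i + 1)\<close>: the shift by one is the factor of the parameter, the factor
      \<open>N\<close> the ramification.\<close>
    have "fls_nth (cpw N (fls_X * Gf)) (int N * (i + 1)) = 0"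
      using that N by (intro zeros) (simp add: mult_le_0_iff)
    then show ?thesis using N by (simp add: cpw_nth fls_X_times_conv_shift)
  qed
  then have reg: "fps_to_fls (fls_regpart Gf) = Gf" by (rule fls_regpart_eq)
  have "fps_to_fls (germ \<epsilon> (\<Sum>j\<in>UNIV. mps_const (Y j) * \<iota> (u j))) = (\<Sum>j\<in>UNIV. y j * \<psi> (u j))"
    by (simp only: g.hom_sum g.hom_mult gY fl.hom_sum fl.hom_mult y_def \<psi>_def fps_const_to_fls)
  also have "\<dots> = Gf * \<psi> w"
    unfolding Gf_def by (simp only: sum_distrib_right mult.assoc \<Psi>tf[symmetric] w(2)[symmetric] \<Psi>.hom_mult)
  also have "\<dots> = fps_to_fls (germ \<epsilon> (\<iota> w) * fls_regpart Gf)"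
    unfolding fl.hom_mult reg \<psi>_def by (simp only: mult.commute)
  finally have "germ \<epsilon> (\<Sum>j\<in>UNIV. mps_const (Y j) * \<iota> (u j)) = germ \<epsilon> (\<iota> w) * fls_regpart Gf" by simp
  then show ?thesis by simp
qed

text \<open>The denominator \<open>w\<close> has coefficients in the small field, as
  \<open>purity\<close> demands. The Weierstrass roots live in the algebraic closure of the fraction
  field over the larger coefficients, and \<open>germ_no_pole\<close> checks each point.\<close>

theorem dtr_integral:
  assumes b: "b \<in> adj \<gamma>" "b \<in> integral_closure \<phi>" and c: "c \<in> adj \<gamma>" "c \<in> integral_closure \<phi>"
  obtains \<rho> where "dtr \<gamma> (\<lambda>j. b * ld j c) = to_fract \<rho>"
proof -
  obtain w u where w: "w \<noteq> 0" "\<And>j. tr \<gamma> (b * ld j c) * to_fract w = to_fract (u j)"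
    by (rule fract_common_denominator[of "\<lambda>j. tr \<gamma> (b * ld j c)"]) blast
  define U where "U = (\<Sum>j\<in>UNIV. mps_const (Y j) * \<iota> (u j))"
  have j: "inj_comm_ring_hom (\<lambda>s. to_ac (to_fract s) :: ('n, 'q) mps fract alg_closure)"
    by unfold_locales simp_all
  have "\<iota> w dvd U"
    unfolding U_def by (rule purity[OF w(1) j]) (rule germ_no_pole[OF _ _ b c w])
  then obtain \<rho> where \<rho>: "U = \<iota> w * \<rho>" by (auto elim: dvdE)
  have "dtr \<gamma> (\<lambda>j. b * ld j c) * to_fract (\<iota> w) = to_fract U"
    unfolding dtr_def sum_distrib_right mult.assoc \<iota>K_to_fract[symmetric] \<iota>K.hom_mult[symmetric] w(2)
    by (simp add: \<iota>K_to_fract U_def)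
  also have "\<dots> = to_fract \<rho> * to_fract (\<iota> w)" by (simp add: \<rho> mult.commute)
  finally have "dtr \<gamma> (\<lambda>j. b * ld j c) = to_fract \<rho>" using w(1) by simp
  then show ?thesis by (rule that)
qed

end

section \<open>Integral closures\<close>

text \<open>Determinant trick: the relations make the vector of the \<open>g i\<close> an
  eigenvector with eigenvalue \<open>z\<close>, so \<open>z\<close> is a root of a monic
  characteristic polynomial.\<close>

lemma integral_closureI_module:
  fixes f :: "'a::comm_ring_1 \<Rightarrow> 'b::field"
  assumes f: "comm_ring_hom f" and i: "i < (N :: nat)" "g i \<noteq> 0"
    and A: "\<And>i. i < N \<Longrightarrow> z * g i = (\<Sum>j<N. f (A i j) * g j)"
  shows "z \<in> integral_closure f"
proof -
  interpret f: comm_ring_hom f by fact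
  define M where "M = mat N N (\<lambda>(i, j). A i j)"
  have M: "M \<in> carrier_mat N N" by (simp add: M_def)
  define v where "v = vec N g"
  have "eigenvector (map_mat f M) v z"
    unfolding eigenvector_def
  proof (intro conjI)
    show "v \<in> carrier_vec (dim_row (map_mat f M))" using M by (simp add: v_def)
    show "v \<noteq> 0\<^sub>v (dim_row (map_mat f M))"
    proof
      assume "v = 0\<^sub>v (dim_row (map_mat f M))"
      then have "vec_index v i = vec_index (0\<^sub>v N) i" using M by simp
      then show False using i by (simp add: v_def)
    qed
    show "map_mat f M *\<^sub>v v = z \<cdot>\<^sub>v v"
    proof (rule eq_vecI)
      fix k assume k: "k < dim_vec (z \<cdot>\<^sub>v v)"
      then have "k < N" by (simp add: v_def)
      then show "vec_index (map_mat f M *\<^sub>v v) k = vec_index (z \<cdot>\<^sub>v v) k"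
        using A[of k] by (simp add: M_def v_def scalar_prod_def atLeast0LessThan)
    qed (simp add: M_def v_def)
  qed
  then have "eigenvalue (map_mat f M) z" unfolding eigenvalue_def by blast
  then have "poly (char_poly (map_mat f M)) z = 0"
    using eigenvalue_root_char_poly[of "map_mat f M" N z] M by simp
  then have "poly (map_poly f (char_poly M)) z = 0" by (simp add: f.char_poly_hom[OF M])
  moreover have "lead_coeff (char_poly M) = 1" using degree_monic_char_poly[OF M] by simp
  ultimately show ?thesis unfolding integral_closure_def by blast
qed

lemma integral_closure_hom [intro]:
  assumes "comm_ring_hom (f :: 'a::comm_ring_1 \<Rightarrow> 'b::comm_ring_1)" shows "f r \<in> integral_closure f"
proof -
  interpret f: comm_ring_hom f by fact
  have "lead_coeff [:- r, 1:] = 1" "poly (map_poly f [:- r, 1:]) (f r) = 0"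
    by (simp_all add: f.map_poly_pCons_hom f.hom_uminus)
  then show ?thesis unfolding integral_closure_def by blast
qed

lemma integral_power_relation:
  fixes f :: "'a::comm_ring_1 \<Rightarrow> 'b::comm_ring_1"
  assumes f: "comm_ring_hom f" and a: "a \<in> integral_closure f"
  obtains d c where "d > 0" "a ^ d = (\<Sum>i<d. f (c i) * a ^ i)"
proof -
  interpret f: comm_ring_hom f by fact
  obtain p where p: "lead_coeff p = 1" "poly (map_poly f p) a = 0" using a by (auto simp: integral_closure_def)
  define d where "d = degree p"
  have cd: "coeff p d = 1" using p by (simp add: d_def)
  have "degree (map_poly f p) = d"
  proof (rule antisym)
    show "degree (map_poly f p) \<le> d" by (rule degree_le) (simp add: d_def coeff_eq_0)
    show "d \<le> degree (map_poly f p)" by (rule le_degree) (simp add: cd)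
  qed
  then have "(\<Sum>i\<le>d. f (coeff p i) * a ^ i) = 0" using p(2) by (simp add: poly_altdef)
  then have s: "(\<Sum>i<d. f (coeff p i) * a ^ i) + a ^ d = 0"
    unfolding lessThan_Suc_atMost[symmetric] by (simp add: cd)
  have "d > 0"
  proof (rule ccontr)
    assume "\<not> ?thesis" then show False using s by simp
  qed
  moreover have "a ^ d = (\<Sum>i<d. f (- coeff p i) * a ^ i)"
    using s by (simp add: f.hom_uminus sum_negf eq_neg_iff_add_eq_0 add.commute)
  ultimately show ?thesis by (rule that)
qed

text \<open>The span \<open>S\<close> of the products \<open>a\<^sup>i b\<^sup>j\<close> with
  \<open>i < d\<close>, \<open>j < e\<close> is mapped into itself by \<open>a\<close> and
  \<open>b\<close>, hence by their sum and product. The products are numbered by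
  \<open>k = i e + j\<close>.\<close>

lemma integral_closure_add_mult:
  fixes f :: "'a::comm_ring_1 \<Rightarrow> 'b::field"
  assumes f: "comm_ring_hom f" and ab: "a \<in> integral_closure f" "b \<in> integral_closure f"
  shows "a + b \<in> integral_closure f" "a * b \<in> integral_closure f"
proof -
  interpret f: comm_ring_hom f by fact
  obtain d ca where d: "d > 0" "a ^ d = (\<Sum>i<d. f (ca i) * a ^ i)" using integral_power_relation[OF f ab(1)] by blast
  obtain e cb where e: "e > 0" "b ^ e = (\<Sum>i<e. f (cb i) * b ^ i)" using integral_power_relation[OF f ab(2)] by blast
  define N where "N = d * e"
  define g where "g k = a ^ (k div e) * b ^ (k mod e)" for k
  define S where "S = {x. \<exists>r. x = (\<Sum>k<N. f (r k) * g k)}"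
  have N: "0 < N" "g 0 \<noteq> 0" using d e by (simp_all add: N_def g_def)
  have S_add: "x + y \<in> S" if xy: "x \<in> S" "y \<in> S" for x y
  proof -
    obtain r s where "x = (\<Sum>k<N. f (r k) * g k)" "y = (\<Sum>k<N. f (s k) * g k)" using xy unfolding S_def by blast
    then have "x + y = (\<Sum>k<N. f (r k + s k) * g k)" by (simp add: f.hom_add distrib_right sum.distrib)
    then show ?thesis unfolding S_def by (intro CollectI exI[of _ "\<lambda>k. r k + s k"])
  qed
  have S_scale: "f c * x \<in> S" if x: "x \<in> S" for c x
  proof -
    obtain r where "x = (\<Sum>k<N. f (r k) * g k)" using x unfolding S_def by blast
    then have "f c * x = (\<Sum>k<N. f (c * r k) * g k)" by (simp add: f.hom_mult sum_distrib_left mult.assoc)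
    then show ?thesis unfolding S_def by (intro CollectI exI[of _ "\<lambda>k. c * r k"])
  qed
  have S_0: "0 \<in> S" unfolding S_def by (rule CollectI, rule exI[of _ "\<lambda>_. 0"]) simp
  have S_sum: "(\<And>x. x \<in> B \<Longrightarrow> u x \<in> S) \<Longrightarrow> sum u B \<in> S" for u and B :: "nat set"
    by (induction B rule: infinite_finite_induct) (auto simp: S_0 S_add)
  have S_g: "a ^ i * b ^ j \<in> S" if ij: "i < d" "j < e" for i j
  proof -
    define k0 where "k0 = i * e + j"
    have k0: "k0 < N" "g k0 = a ^ i * b ^ j"
    proof -
      have "k0 < Suc i * e" using ij by (simp add: k0_def)
      also have "\<dots> \<le> N" unfolding N_def using ij(1) by (intro mult_right_mono) auto
      finally show "k0 < N" .
      show "g k0 = a ^ i * b ^ j" using ij(2) by (simp add: g_def k0_def)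
    qed
    have "(\<Sum>k<N. f (if k = k0 then 1 else 0) * g k) = (\<Sum>k<N. if k = k0 then g k else 0)"
      by (rule sum.cong) auto
    also have "\<dots> = a ^ i * b ^ j" using k0 by simp
    finally have eq: "a ^ i * b ^ j = (\<Sum>k<N. f (if k = k0 then 1 else 0) * g k)" ..
    show ?thesis unfolding S_def by (rule CollectI) (rule exI, rule eq)
  qed
  have S_a: "a * g k \<in> S" and S_b: "b * g k \<in> S" if k: "k < N" for k
  proof -
    have ij: "k div e < d" "k mod e < e"
      using k e(1) by (simp_all add: N_def less_mult_imp_div_less)
    show "a * g k \<in> S"
    proof (cases "Suc (k div e) < d")
      case True
      then show ?thesis using S_g[OF True ij(2)] by (simp add: g_def mult.assoc)
    next
      case False
      then have "d = Suc (k div e)" using ij by simp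
      then have "a * g k = a ^ d * b ^ (k mod e)" by (simp add: g_def mult.assoc)
      also have "\<dots> = (\<Sum>i<d. f (ca i) * (a ^ i * b ^ (k mod e)))" by (simp add: d(2) sum_distrib_right mult.assoc)
      also have "\<dots> \<in> S" using S_g ij by (intro S_sum S_scale) auto
      finally show ?thesis .
    qed
    show "b * g k \<in> S"
    proof (cases "Suc (k mod e) < e")
      case True
      then show ?thesis using S_g[OF ij(1) True] by (simp add: g_def mult.left_commute)
    next
      case False
      then have "e = Suc (k mod e)" using ij by simp
      then have "b ^ e = b * b ^ (k mod e)" by (metis power_Suc)
      then have "b * g k = a ^ (k div e) * b ^ e" by (simp add: g_def mult.left_commute)
      also have "\<dots> = (\<Sum>i<e. f (cb i) * (a ^ (k div e) * b ^ i))" by (simp add: e(2) sum_distrib_left mult.left_commute)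
      also have "\<dots> \<in> S" using S_g ij by (intro S_sum S_scale) auto
      finally show ?thesis .
    qed
  qed
  have mult_S: "u * x \<in> S" if u: "\<And>k. k < N \<Longrightarrow> u * g k \<in> S" and x: "x \<in> S" for u x
  proof -
    obtain r where "x = (\<Sum>k<N. f (r k) * g k)" using x unfolding S_def by blast
    then have "u * x = (\<Sum>k<N. f (r k) * (u * g k))" by (simp add: sum_distrib_left mult.left_commute)
    also have "\<dots> \<in> S" using u by (intro S_sum S_scale) auto
    finally show ?thesis .
  qed
  have crit: "z \<in> integral_closure f" if z: "\<And>k. k < N \<Longrightarrow> z * g k \<in> S" for z
  proof -
    have "\<forall>k. \<exists>r. k < N \<longrightarrow> z * g k = (\<Sum>j<N. f (r j) * g j)" using z unfolding S_def by blast
    then obtain A where "\<And>k. k < N \<Longrightarrow> z * g k = (\<Sum>j<N. f (A k j) * g j)" by metis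
    from integral_closureI_module[OF f N this] show ?thesis .
  qed
  show "a + b \<in> integral_closure f"
    by (rule crit) (simp add: distrib_right S_add S_a S_b)
  show "a * b \<in> integral_closure f"
  proof (rule crit)
    fix k assume k: "k < N"
    have "a * (b * g k) \<in> S" by (rule mult_S[OF S_a S_b[OF k]])
    then show "a * b * g k \<in> S" by (simp add: mult.assoc)
  qed
qed

lemma integral_closure_uminus:
  fixes f :: "'a::comm_ring_1 \<Rightarrow> 'b::field"
  assumes f: "comm_ring_hom f" and a: "a \<in> integral_closure f"
  shows "- a \<in> integral_closure f"
proof -
  interpret f: comm_ring_hom f by fact
  show ?thesis using integral_closure_add_mult(2)[OF f integral_closure_hom[OF f, of "-1"] a] by (simp add: f.hom_uminus)
qed

section \<open>Torsion subcomplexes of an exact complex\<close>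

abbreviation rta :: "'a::comm_ring_1 ring" where "rta \<equiv> ring_of_type_algebra"

lemma rta_simps [simp]: "carrier rta = UNIV" "a \<otimes>\<^bsub>rta\<^esub> b = a * b" "a \<oplus>\<^bsub>rta\<^esub> b = a + b" "\<one>\<^bsub>rta\<^esub> = 1" "\<zero>\<^bsub>rta\<^esub> = 0"
  by (simp_all add: ring_of_type_algebra_def)

text \<open>Exactness is imposed in positive degrees; the kernel of \<open>d 0\<close> is the module
  that is being resolved.\<close>

locale resolution_complex =
  fixes E :: "nat \<Rightarrow> ('a::comm_ring_1, 'e) module" and d :: "nat \<Rightarrow> 'e \<Rightarrow> 'e"
  assumes mod: "module rta (E q)" and d: "d q \<in> linear_maps rta (E q) (E (Suc q))"
    and exact: "d q ` carrier (E q) = a_kernel (E (Suc q)) (E (Suc (Suc q))) (d (Suc q))"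
begin

lemma ab: "abelian_group (E q)" using mod[of q] by (rule module.axioms(2))

abbreviation C where "C q \<equiv> carrier (E q)"
abbreviation pl where "pl q \<equiv> add (E q)"
abbreviation ze where "ze q \<equiv> ring.zero (E q)"
abbreviation sm where "sm q \<equiv> module.smult (E q)"
abbreviation mi where "mi q \<equiv> a_minus (E q)"

lemma pl_C [simp]: "x \<in> C q \<Longrightarrow> y \<in> C q \<Longrightarrow> pl q x y \<in> C q" using abelian_group.axioms(1)[OF ab] by (rule abelian_monoid.a_closed)
lemma ze_C [simp]: "ze q \<in> C q" using abelian_group.axioms(1)[OF ab] by (rule abelian_monoid.zero_closed)
lemma sm_C [simp]: "x \<in> C q \<Longrightarrow> sm q a x \<in> C q" using module.smult_closed[OF mod, of a x q] by simp
lemma mi_C [simp]: "x \<in> C q \<Longrightarrow> y \<in> C q \<Longrightarrow> mi q x y \<in> C q" using ab by (rule abelian_group.minus_closed)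
lemma pl_assoc: "x \<in> C q \<Longrightarrow> y \<in> C q \<Longrightarrow> z \<in> C q \<Longrightarrow> pl q (pl q x y) z = pl q x (pl q y z)"
  using abelian_group.axioms(1)[OF ab] by (rule abelian_monoid.a_assoc)
lemma pl_ze [simp]: "x \<in> C q \<Longrightarrow> pl q x (ze q) = x" "x \<in> C q \<Longrightarrow> pl q (ze q) x = x"
  using abelian_monoid.r_zero[OF abelian_group.axioms(1)[OF ab]] abelian_monoid.l_zero[OF abelian_group.axioms(1)[OF ab]] by blast+
lemma mi_self [simp]: "x \<in> C q \<Longrightarrow> mi q x x = ze q" using abelian_group.r_neg[OF ab] by (simp add: a_minus_def)
lemma mi_pl: "x \<in> C q \<Longrightarrow> y \<in> C q \<Longrightarrow> pl q (mi q x y) y = x"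
  using abelian_group.a_inv_closed[OF ab] abelian_group.l_neg[OF ab] by (simp add: a_minus_def pl_assoc)
lemma pl_mi: "x \<in> C q \<Longrightarrow> y \<in> C q \<Longrightarrow> mi q (pl q x y) y = x"
  using abelian_group.a_inv_closed[OF ab] abelian_group.r_neg[OF ab] by (simp add: a_minus_def pl_assoc)
lemma mi_eqI: "x \<in> C q \<Longrightarrow> y \<in> C q \<Longrightarrow> z \<in> C q \<Longrightarrow> x = pl q z y \<Longrightarrow> mi q x y = z" by (simp add: pl_mi)

lemma sm_sm: "x \<in> C q \<Longrightarrow> sm q a (sm q b x) = sm q (a * b) x"
  using module.smult_assoc1[OF mod, of a b x q] by simp
lemma sm_1 [simp]: "x \<in> C q \<Longrightarrow> sm q 1 x = x" using module.smult_one[OF mod, of x q] by simp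
lemma sm_pl: "x \<in> C q \<Longrightarrow> y \<in> C q \<Longrightarrow> sm q a (pl q x y) = pl q (sm q a x) (sm q a y)"
  using module.smult_r_distr[OF mod, of a x q y] by simp
lemma sm_ze [simp]: "sm q a (ze q) = ze q" using module.smult_r_null[OF mod, of a q] by simp
lemma sm_mi: "x \<in> C q \<Longrightarrow> y \<in> C q \<Longrightarrow> sm q a (mi q x y) = mi q (sm q a x) (sm q a y)"
proof (rule mi_eqI[symmetric])
  assume xy: "x \<in> C q" "y \<in> C q"
  then have "pl q (sm q a (mi q x y)) (sm q a y) = sm q a (pl q (mi q x y) y)" by (simp add: sm_pl)
  then show "sm q a x = pl q (sm q a (mi q x y)) (sm q a y)" using xy by (simp add: mi_pl)
qed simp_all

lemma d_C [simp]: "x \<in> C q \<Longrightarrow> d q x \<in> C (Suc q)" using d[of q] by (auto simp: linear_maps_def)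
lemma d_pl: "x \<in> C q \<Longrightarrow> y \<in> C q \<Longrightarrow> d q (pl q x y) = pl (Suc q) (d q x) (d q y)" using d[of q] by (auto simp: linear_maps_def)
lemma d_sm: "x \<in> C q \<Longrightarrow> d q (sm q a x) = sm (Suc q) a (d q x)" using d[of q] by (auto simp: linear_maps_def)
lemma d_mi: "x \<in> C q \<Longrightarrow> y \<in> C q \<Longrightarrow> d q (mi q x y) = mi (Suc q) (d q x) (d q y)"
proof (rule mi_eqI[symmetric])
  assume xy: "x \<in> C q" "y \<in> C q"
  then have "pl (Suc q) (d q (mi q x y)) (d q y) = d q (pl q (mi q x y) y)" by (simp add: d_pl)
  then show "d q x = pl (Suc q) (d q (mi q x y)) (d q y)" using xy by (simp add: mi_pl)
qed simp_all
lemma dd [simp]: "x \<in> C q \<Longrightarrow> d (Suc q) (d q x) = ze (Suc (Suc q))"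
  using exact[of q] by (auto simp: a_kernel_def' )
lemma exactD: "x \<in> C (Suc q) \<Longrightarrow> d (Suc q) x = ze (Suc (Suc q)) \<Longrightarrow> \<exists>v\<in>C q. x = d q v"
  using exact[of q] by (auto simp: a_kernel_def')

section \<open>Torsion cochains and their cohomology\<close>

definition kills :: "'a list \<Rightarrow> nat \<Rightarrow> nat \<Rightarrow> 'e \<Rightarrow> bool" where
  "kills ys q t e \<longleftrightarrow> (\<forall>y\<in>set ys. sm q (y ^ t) e = ze q)"

definition G :: "'a list \<Rightarrow> nat \<Rightarrow> 'e set" where
  "G ys q = {e \<in> C q. \<exists>t. kills ys q t e}"

text \<open>Cocycles and coboundaries of the subcomplex \<open>G ys\<close> of torsion elements.\<close>

definition Z where "Z ys q = {e \<in> G ys q. d q e = ze (Suc q)}"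
definition Bd where "Bd ys q = (case q of 0 \<Rightarrow> {ze 0} | Suc i \<Rightarrow> d i ` G ys i)"

lemma kills_mono: "e \<in> C q \<Longrightarrow> kills ys q t e \<Longrightarrow> t \<le> t' \<Longrightarrow> kills ys q t' e"
proof -
  assume e: "e \<in> C q" "kills ys q t e" "t \<le> t'"
  have "sm q (y ^ t') e = ze q" if "y \<in> set ys" for y
  proof -
    have "y ^ t' = y ^ (t' - t) * y ^ t" using e(3) by (simp flip: power_add)
    then show ?thesis using e that by (simp add: sm_sm[symmetric] kills_def)
  qed
  then show ?thesis by (simp add: kills_def)
qed

lemma kills_sm: "e \<in> C q \<Longrightarrow> kills ys q t e \<Longrightarrow> kills ys q t (sm q a e)"
  unfolding kills_def by (metis mult.commute sm_sm sm_ze)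
lemma kills_pl: "e \<in> C q \<Longrightarrow> e' \<in> C q \<Longrightarrow> kills ys q t e \<Longrightarrow> kills ys q t e' \<Longrightarrow> kills ys q t (pl q e e')"
  by (simp add: kills_def sm_pl)
lemma kills_mi: "e \<in> C q \<Longrightarrow> e' \<in> C q \<Longrightarrow> kills ys q t e \<Longrightarrow> kills ys q t e' \<Longrightarrow> kills ys q t (mi q e e')"
  by (simp add: kills_def sm_mi)
lemma kills_d: "e \<in> C q \<Longrightarrow> kills ys q t e \<Longrightarrow> kills ys (Suc q) t (d q e)"
proof -
  assume e: "e \<in> C q" "kills ys q t e"
  have "d q (ze q) = ze (Suc q)" using d_mi[of "ze q" q "ze q"] by simp
  then show ?thesis using e by (simp add: kills_def d_sm[symmetric])
qed

lemma G_C: "e \<in> G ys q \<Longrightarrow> e \<in> C q" by (simp add: G_def)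
lemma G_ze: "ze q \<in> G ys q" by (simp add: G_def kills_def)
lemma G_sm: "e \<in> G ys q \<Longrightarrow> sm q a e \<in> G ys q" unfolding G_def by (auto intro: kills_sm)
lemma G_two:
  assumes "e \<in> G ys q" "e' \<in> G ys q" obtains t where "kills ys q t e" "kills ys q t e'"
proof -
  obtain t t' where "kills ys q t e" "kills ys q t' e'" using assms by (auto simp: G_def)
  then have "kills ys q (max t t') e" "kills ys q (max t t') e'"
    using assms kills_mono[OF G_C] by (meson max.cobounded1 max.cobounded2)+
  then show ?thesis by (rule that)
qed
lemma G_pl: "e \<in> G ys q \<Longrightarrow> e' \<in> G ys q \<Longrightarrow> pl q e e' \<in> G ys q"
  using G_two[of e ys q e'] kills_pl G_C unfolding G_def by (metis (mono_tags, lifting) mem_Collect_eq pl_C)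
lemma G_mi: "e \<in> G ys q \<Longrightarrow> e' \<in> G ys q \<Longrightarrow> mi q e e' \<in> G ys q"
  using G_two[of e ys q e'] kills_mi G_C unfolding G_def by (metis (mono_tags, lifting) mem_Collect_eq mi_C)
lemma G_d: "e \<in> G ys q \<Longrightarrow> d q e \<in> G ys (Suc q)" unfolding G_def by (auto intro: kills_d)
lemma G_snoc: "e \<in> G (ys @ [x]) q \<longleftrightarrow> e \<in> G ys q \<and> (\<exists>t. sm q (x ^ t) e = ze q)"
proof
  assume "e \<in> G (ys @ [x]) q" then show "e \<in> G ys q \<and> (\<exists>t. sm q (x ^ t) e = ze q)" by (auto simp: G_def kills_def)
next
  assume e: "e \<in> G ys q \<and> (\<exists>t. sm q (x ^ t) e = ze q)"
  then obtain t t' where t: "kills ys q t e" "kills [x] q t' e" "e \<in> C q" by (auto simp: G_def kills_def)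
  then have "kills ys q (max t t') e" "kills [x] q (max t t') e"
    using kills_mono by (meson max.cobounded1 max.cobounded2)+
  then have "kills (ys @ [x]) q (max t t') e" by (auto simp: kills_def)
  then show "e \<in> G (ys @ [x]) q" using t(3) unfolding G_def by blast
qed

lemma d_ze [simp]: "d q (ze q) = ze (Suc q)" using d_mi[of "ze q" q "ze q"] by simp

lemma Z_sm: "e \<in> Z ys q \<Longrightarrow> sm q a e \<in> Z ys q"
  unfolding Z_def using G_sm G_C by (auto simp: d_sm)
lemma Z_C: "e \<in> Z ys q \<Longrightarrow> e \<in> C q" by (simp add: Z_def G_def)

lemma Bd_sm: "e \<in> Bd ys q \<Longrightarrow> sm q a e \<in> Bd ys q"
proof (cases q)
  case (Suc i)
  assume "e \<in> Bd ys q"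
  then obtain v where v: "v \<in> G ys i" "e = d i v" using Suc by (auto simp: Bd_def)
  then have "sm q a e = d i (sm i a v)" using Suc G_C by (simp add: d_sm)
  then show ?thesis using v G_sm Suc by (auto simp: Bd_def)
qed (auto simp: Bd_def)
lemma Bd_C: "e \<in> Bd ys q \<Longrightarrow> e \<in> C q" using G_C by (auto simp: Bd_def split: nat.splits)
lemma Bd_ze: "ze q \<in> Bd ys q"
proof (cases q)
  case (Suc i)
  have "ze (Suc i) \<in> d i ` G ys i" by (rule image_eqI[of _ _ "ze i"]) (simp_all add: G_ze)
  then show ?thesis using Suc by (simp add: Bd_def)
qed (simp add: Bd_def)

text \<open>Modulo coboundaries this is the submodule of \<open>H\<^sup>q\<close> of the
  \<open>ys\<close>-torsion generated by the multiples with \<open>x\<^sup>n\<close>,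
  \<open>x\<close> in \<open>xs\<close>. If the multiple of a class by
  \<open>prod_list xs ^ s\<close> avoids \<open>Sm ys q (Suc s) xs\<close> for all \<open>s\<close>,
  then the class divided by \<open>prod_list xs\<close> is nonzero in the limit of the quotients,
  which is the top local cohomology of \<open>H\<^sup>q\<close> along \<open>xs\<close>.\<close>

fun Sm :: "'a list \<Rightarrow> nat \<Rightarrow> nat \<Rightarrow> 'a list \<Rightarrow> 'e set" where
  "Sm ys q n [] = Bd ys q"
| "Sm ys q n (x # xs) = {pl q (sm q (x ^ n) \<eta>) r | \<eta> r. \<eta> \<in> Z ys q \<and> r \<in> Sm ys q n xs}"

lemma Sm_C: "r \<in> Sm ys q n xs \<Longrightarrow> r \<in> C q"
  by (induction xs arbitrary: r) (auto intro!: pl_C sm_C dest: Bd_C Z_C)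

lemma Sm_sm: "r \<in> Sm ys q n xs \<Longrightarrow> sm q a r \<in> Sm ys q n xs"
proof (induction xs arbitrary: r)
  case (Cons x xs)
  then obtain \<eta> r' where r: "r = pl q (sm q (x ^ n) \<eta>) r'" "\<eta> \<in> Z ys q" "r' \<in> Sm ys q n xs" by auto
  have "sm q a r = pl q (sm q (x ^ n) (sm q a \<eta>)) (sm q a r')"
    using r Z_C Sm_C by (simp add: sm_pl sm_sm mult.commute)
  then show ?case using Cons.IH[OF r(3)] Z_sm[OF r(2)] by auto
qed (simp add: Bd_sm)

text \<open>Compatibility of the transition maps of that limit.\<close>

lemma Sm_raise: "r \<in> Sm ys q n xs \<Longrightarrow> sm q (prod_list xs ^ k) r \<in> Sm ys q (n + k) xs"
proof (induction xs arbitrary: r)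
  case (Cons x xs)
  then obtain \<eta> r' where r: "r = pl q (sm q (x ^ n) \<eta>) r'" "\<eta> \<in> Z ys q" "r' \<in> Sm ys q n xs" by auto
  have "sm q (prod_list (x # xs) ^ k) r = pl q (sm q (x ^ (n + k)) (sm q (prod_list xs ^ k) \<eta>)) (sm q (x ^ k) (sm q (prod_list xs ^ k) r'))"
    using r Z_C Sm_C by (simp add: sm_pl sm_sm power_mult_distrib power_add mult_ac)
  then show ?case using Sm_sm[OF Cons.IH[OF r(3)], of "x ^ k"] Z_sm[OF r(2), of "prod_list xs ^ k"] by auto
qed (simp add: Bd_sm)

text \<open>\<open>H\<^sup>q\<close> of the \<open>ys\<close>-torsion vanishes above the length of \<open>ys\<close>.\<close>

lemma Z_subset_Bd:
  assumes "\<And>ys' x zs q e t s. ys = ys' @ x # zs \<Longrightarrow> e \<in> C q \<Longrightarrow> kills ys' q t e \<Longrightarrow>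
      \<exists>e'\<in>C q. sm q (x ^ s) e' = e \<and> kills ys' q t e'"
    and "q > length ys" "w \<in> Z ys q"
  shows "w \<in> Bd ys q"
  using assms
proof (induction ys arbitrary: q w rule: rev_induct)
  case Nil
  then obtain i where i: "q = Suc i" using gr0_conv_Suc by auto
  then obtain v where "v \<in> C i" "w = d i v" using exactD[of w i] Nil.prems(3) by (auto simp: Z_def G_def)
  then show ?case using i by (auto simp: Bd_def G_def kills_def)
next
  case (snoc x ys)
  have div: "\<exists>e'\<in>C q. sm q (y ^ s) e' = e \<and> kills ys' q t e'"
    if "ys = ys' @ y # zs" "e \<in> C q" "kills ys' q t e" for ys' y zs q e t s
    by (rule snoc.prems(1)[of ys' y "zs @ [x]" e q t s]) (use that in simp_all)
  define l where "l = q - 2"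
  have l: "q = Suc (Suc l)" "Suc l > length ys" using snoc.prems(2) unfolding l_def length_append_singleton by arith+
  have wZ: "w \<in> Z ys q" using snoc.prems(3) by (auto simp: Z_def G_snoc)
  obtain T where T: "sm q (x ^ T) w = ze q" using snoc.prems(3) by (auto simp: Z_def G_snoc)
  have "w \<in> Bd ys q" using snoc.IH[OF div _ wZ] snoc.prems(2) by simp
  then obtain v where v: "v \<in> G ys (Suc l)" "w = d (Suc l) v" using l by (auto simp: Bd_def)
  have vC: "v \<in> C (Suc l)" using v G_C by blast
  \<comment> \<open>A primitive \<open>v\<close> of \<open>w\<close> need not be
    \<open>x\<close>-torsion, but its multiple by \<open>x\<^sup>T\<close> is a cocycle in a degree
    still above the length of \<open>ys\<close>, hence a coboundary of some \<open>u\<close>.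
    Dividing \<open>u\<close> by \<open>x\<^sup>T\<close> gives the correction of
    \<open>v\<close>.\<close>
  have "sm (Suc l) (x ^ T) v \<in> Z ys (Suc l)"
    using v vC T l G_sm[OF v(1)] by (simp add: Z_def d_sm)
  then have "sm (Suc l) (x ^ T) v \<in> Bd ys (Suc l)" using snoc.IH[OF div l(2)] by simp
  then obtain u where u: "u \<in> G ys l" "sm (Suc l) (x ^ T) v = d l u" by (auto simp: Bd_def)
  obtain t where t: "kills ys l t u" using u by (auto simp: G_def)
  obtain u' where u': "u' \<in> C l" "sm l (x ^ T) u' = u" "kills ys l t u'"
    using snoc.prems(1)[of ys x "[]" u l t T] u t G_C by auto
  have u'G: "u' \<in> G ys l" using u' by (auto simp: G_def)
  define z where "z = mi (Suc l) v (d l u')"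
  have "z \<in> G ys (Suc l)" unfolding z_def using v(1) G_d[OF u'G] by (rule G_mi)
  moreover have "mi (Suc l) (d l u) (d l u) = ze (Suc l)"
    by (rule mi_eqI) (use u G_C in simp_all)
  then have "sm (Suc l) (x ^ T) z = ze (Suc l)"
    using vC u' u by (simp add: z_def sm_mi d_sm[symmetric])
  ultimately have "z \<in> G (ys @ [x]) (Suc l)" by (auto simp: G_snoc)
  moreover have "d (Suc l) z = w"
  proof -
    have "mi q w (ze q) = w" by (rule mi_eqI) (use wZ Z_C in simp_all)
    then show ?thesis using vC u' v l by (simp add: z_def d_mi)
  qed
  ultimately show ?case using l by (auto simp: Bd_def)
qed

text \<open>One more variable raises the degree by one: divide \<open>\<zeta>\<close> by \<open>z\<close> and apply the differential.\<close>

lemma top_class_step: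
  assumes div: "\<And>ys' x zs' q e t s. ys @ [z] = ys' @ x # zs' \<Longrightarrow> e \<in> C q \<Longrightarrow> kills ys' q t e \<Longrightarrow>
      \<exists>e'\<in>C q. sm q (x ^ s) e' = e \<and> kills ys' q t e'"
    and q: "q = length ys"
    and \<zeta>: "\<zeta> \<in> Z ys q" "\<And>s. sm q (prod_list (z # zs) ^ s) \<zeta> \<notin> Sm ys q (Suc s) (z # zs)"
  shows "\<exists>\<zeta>'\<in>Z (ys @ [z]) (Suc q). \<forall>s. sm (Suc q) (prod_list zs ^ s) \<zeta>' \<notin> Sm (ys @ [z]) (Suc q) (Suc s) zs"
proof -
  have div': "\<exists>e'\<in>C q. sm q (x ^ s) e' = e \<and> kills ys' q t e'"
    if "ys = ys' @ x # zs'" "e \<in> C q" "kills ys' q t e" for ys' x zs' q e t s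
    by (rule div[of ys' x "zs' @ [z]" e q t s]) (use that in simp_all)
  have \<zeta>C: "\<zeta> \<in> C q" using \<zeta>(1) by (rule Z_C)
  obtain t where t: "kills ys q t \<zeta>" using \<zeta>(1) by (auto simp: Z_def G_def)
  \<comment> \<open>A connecting homomorphism: \<open>d q z'\<close> is killed by \<open>z\<close>
    because its multiple by \<open>z\<close> is the differential of the cocycle
    \<open>\<zeta>\<close>.\<close>
  obtain z' where z': "z' \<in> C q" "sm q z z' = \<zeta>" "kills ys q t z'"
    using div[of ys z "[]" \<zeta> q t 1] \<zeta>C t by auto
  have z'G: "z' \<in> G ys q" using z' by (auto simp: G_def)
  define \<zeta>' where "\<zeta>' = d q z'"
  have "sm (Suc q) (z ^ 1) \<zeta>' = ze (Suc q)"
    using z' \<zeta>(1) by (simp add: \<zeta>'_def d_sm[symmetric] Z_def)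
  then have "\<exists>t. sm (Suc q) (z ^ t) \<zeta>' = ze (Suc q)" by blast
  then have \<zeta>'Z: "\<zeta>' \<in> Z (ys @ [z]) (Suc q)"
    using G_d[OF z'G] z'(1) by (auto simp: Z_def G_snoc \<zeta>'_def)
  \<comment> \<open>Going back down: in degree \<open>q + 1\<close> every \<open>ys\<close>-torsion
    cocycle is a coboundary, and if \<open>z\<^sup>T\<close> kills it, \<open>z\<^sup>T\<close>
    turns its primitive into a cocycle.\<close>
  have pull: "\<exists>v\<in>G ys q. \<exists>T. d q v = r \<and> sm q (z ^ T) v \<in> Sm ys q n xs" if "r \<in> Sm (ys @ [z]) (Suc q) n xs" for r n xs
    using that
  proof (induction xs arbitrary: r)
    case Nil
    then obtain v where v: "v \<in> G (ys @ [z]) q" "r = d q v" by (auto simp: Bd_def)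
    then obtain T where "v \<in> G ys q" "sm q (z ^ T) v = ze q" by (auto simp: G_snoc)
    then show ?case using v Bd_ze[of q ys] by (intro bexI[of _ v] exI[of _ T]) auto
  next
    case (Cons x xs)
    then obtain \<eta> r' where r: "r = pl (Suc q) (sm (Suc q) (x ^ n) \<eta>) r'" "\<eta> \<in> Z (ys @ [z]) (Suc q)"
      "r' \<in> Sm (ys @ [z]) (Suc q) n xs" by auto
    obtain v' T' where v': "v' \<in> G ys q" "d q v' = r'" "sm q (z ^ T') v' \<in> Sm ys q n xs"
      using Cons.IH[OF r(3)] by blast
    have "\<eta> \<in> Z ys (Suc q)" using r(2) by (auto simp: Z_def G_snoc)
    then have "\<eta> \<in> Bd ys (Suc q)"
      by (rule Z_subset_Bd[rotated 2]) (rule div', assumption+, simp add: q)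
    then obtain e where e: "e \<in> G ys q" "\<eta> = d q e" by (auto simp: Bd_def)
    obtain T where T: "sm (Suc q) (z ^ T) \<eta> = ze (Suc q)" using r(2) by (auto simp: Z_def G_snoc)
    have eC: "e \<in> C q" "v' \<in> C q" using e v' G_C by auto
    have zT: "sm q (z ^ T) e \<in> Z ys q" using T e eC G_sm[OF e(1)] by (simp add: Z_def d_sm)
    define v where "v = pl q (sm q (x ^ n) e) v'"
    have "v \<in> G ys q" unfolding v_def by (intro G_pl G_sm e v')
    moreover have "d q v = r" using eC by (simp add: v_def d_pl d_sm r(1) e(2) v'(2))
    moreover have "sm q (z ^ (T' + T)) v = pl q (sm q (x ^ n) (sm q (z ^ T') (sm q (z ^ T) e))) (sm q (z ^ T) (sm q (z ^ T') v'))"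
      using eC by (simp add: v_def sm_pl sm_sm power_add mult_ac)
    then have "sm q (z ^ (T' + T)) v \<in> Sm ys q n (x # xs)"
      using Z_sm[OF zT, of "z ^ T'"] Sm_sm[OF v'(3), of "z ^ T"] by auto
    ultimately show ?case by blast
  qed
  have "sm (Suc q) (prod_list zs ^ s) \<zeta>' \<notin> Sm (ys @ [z]) (Suc q) (Suc s) zs" for s
  proof
    assume "sm (Suc q) (prod_list zs ^ s) \<zeta>' \<in> Sm (ys @ [z]) (Suc q) (Suc s) zs"
    from pull[OF this] obtain v T where v: "v \<in> G ys q" "d q v = sm (Suc q) (prod_list zs ^ s) \<zeta>'"
      "sm q (z ^ T) v \<in> Sm ys q (Suc s) zs" by blast
    have vC: "v \<in> C q" using v G_C by blast
    \<comment> \<open>The difference of two primitives of the same element is a cocycle;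
      multiplication by \<open>z\<^sup>T\<^sup>+\<^sup>1\<close> then expresses a multiple of
      \<open>\<zeta>\<close> through \<open>Sm\<close>.\<close>
    define u where "u = mi q (sm q (prod_list zs ^ s) z') v"
    have uC: "u \<in> C q" using vC z' by (simp add: u_def)
    have uG: "u \<in> G ys q" unfolding u_def using G_sm[OF z'G] v(1) by (rule G_mi)
    have "d q u = ze (Suc q)" using vC z' v(2) by (simp add: u_def d_mi d_sm \<zeta>'_def)
    then have uZ: "u \<in> Z ys q" using uG by (simp add: Z_def)
    have up: "pl q u v = sm q (prod_list zs ^ s) z'" using vC z' by (simp add: u_def mi_pl)
    have "sm q (z ^ T * prod_list zs ^ s) \<zeta> = sm q (z ^ Suc T) (sm q (prod_list zs ^ s) z')"
      using z'(1) by (simp add: z'(2)[symmetric] sm_sm mult_ac)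
    also have "\<dots> = pl q (sm q (z ^ Suc T) u) (sm q z (sm q (z ^ T) v))"
      unfolding up[symmetric] using uC vC by (simp add: sm_pl sm_sm)
    finally have eq: "sm q (z ^ T * prod_list zs ^ s) \<zeta> = pl q (sm q (z ^ Suc T) u) (sm q z (sm q (z ^ T) v))" .
    \<comment> \<open>The exponents of \<open>z\<close> and of the remaining product are raised to a
      common value.\<close>
    define S where "S = max T s"
    have "prod_list (z # zs) ^ S = z ^ (S - T) * prod_list zs ^ (S - s) * (z ^ T * prod_list zs ^ s)"
    proof -
      have "z ^ S = z ^ (S - T) * z ^ T" "prod_list zs ^ S = prod_list zs ^ (S - s) * prod_list zs ^ s"
        by (simp_all add: S_def flip: power_add)
      then show ?thesis by (simp add: power_mult_distrib mult_ac)
    qed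
    then have "sm q (prod_list (z # zs) ^ S) \<zeta> = sm q (z ^ (S - T) * prod_list zs ^ (S - s)) (sm q (z ^ T * prod_list zs ^ s) \<zeta>)"
      using \<zeta>C by (simp add: sm_sm)
    also have "\<dots> = pl q (sm q (z ^ Suc S) (sm q (prod_list zs ^ (S - s)) u))
        (sm q (z ^ (S - T) * z) (sm q (prod_list zs ^ (S - s)) (sm q (z ^ T) v)))"
    proof -
      have "z ^ Suc S = z ^ (S - T) * z ^ Suc T" unfolding power_add[symmetric] by (simp add: S_def)
      then show ?thesis unfolding eq using uC vC by (simp add: sm_pl sm_sm mult_ac)
    qed
    also have "\<dots> \<in> Sm ys q (Suc S) (z # zs)"
    proof -
      have "Suc s + (S - s) = Suc S" by (simp add: S_def)
      then have "sm q (prod_list zs ^ (S - s)) (sm q (z ^ T) v) \<in> Sm ys q (Suc S) zs"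
        using Sm_raise[OF v(3), of "S - s"] by simp
      from Sm_sm[OF this] Z_sm[OF uZ] show ?thesis unfolding Sm.simps by blast
    qed
    finally show False using \<zeta>(2)[of S] by blast
  qed
  then show ?thesis using \<zeta>'Z by blast
qed

theorem top_class:
  assumes div: "\<And>ys' x zs q e t s. xs = ys' @ x # zs \<Longrightarrow> e \<in> C q \<Longrightarrow> kills ys' q t e \<Longrightarrow>
      \<exists>e'\<in>C q. sm q (x ^ s) e' = e \<and> kills ys' q t e'"
    and \<zeta>: "\<zeta> \<in> Z [] 0" "\<And>s. sm 0 (prod_list xs ^ s) \<zeta> \<notin> Sm [] 0 (Suc s) xs"
  shows "\<exists>\<zeta>\<in>Z xs (length xs). \<zeta> \<notin> Bd xs (length xs)"
proof -
  have "\<exists>\<zeta>\<in>Z ys (length ys). \<forall>s. sm (length ys) (prod_list zs ^ s) \<zeta> \<notin> Sm ys (length ys) (Suc s) zs"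
    if "xs = ys @ zs" for ys zs
    using that
  proof (induction ys arbitrary: zs rule: rev_induct)
    case Nil
    then show ?case using \<zeta> by auto
  next
    case (snoc z ys)
    obtain \<zeta> where \<zeta>: "\<zeta> \<in> Z ys (length ys)" "\<And>s. sm (length ys) (prod_list (z # zs) ^ s) \<zeta> \<notin> Sm ys (length ys) (Suc s) (z # zs)"
      using snoc.IH[of "z # zs"] snoc.prems by auto
    have div': "\<exists>e'\<in>C q. sm q (x ^ s) e' = e \<and> kills ys' q t e'"
      if "ys @ [z] = ys' @ x # zs'" "e \<in> C q" "kills ys' q t e" for ys' x zs' q e t s
    proof (rule div[of ys' x "zs' @ zs" e q t s])
      have "xs = (ys' @ x # zs') @ zs" using snoc.prems that(1) by simp
      then show "xs = ys' @ x # zs' @ zs" by simp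
    qed (use that in simp_all)
    from top_class_step[OF div' refl \<zeta>] show ?case by simp
  qed
  from this[of xs "[]"] obtain \<zeta> where "\<zeta> \<in> Z xs (length xs)" "\<forall>s. sm (length xs) (prod_list [] ^ s) \<zeta> \<notin> Sm xs (length xs) (Suc s) []" by auto
  then show ?thesis using Z_C by (intro bexI[of _ \<zeta>]) auto
qed

end

section \<open>Divisibility and torsion of injective modules\<close>

lemma cring_rta: "cring (rta :: 'a::comm_ring_1 ring)" by (rule cring_from_type_algebra)

lemma a_inv_rta [simp]: "\<ominus>\<^bsub>rta\<^esub> (a :: 'a::comm_ring_1) = - a"
proof -
  interpret cring "rta :: 'a ring" by (rule cring_rta)
  show ?thesis using minus_equality[of "- a" a] by simp
qed

lemma linear_mapsI:
  assumes "\<And>x. x \<in> carrier M \<Longrightarrow> f x \<in> carrier N"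
    and "\<And>x y. x \<in> carrier M \<Longrightarrow> y \<in> carrier M \<Longrightarrow> f (x \<oplus>\<^bsub>M\<^esub> y) = f x \<oplus>\<^bsub>N\<^esub> f y"
    and "\<And>a x. x \<in> carrier M \<Longrightarrow> f (a \<odot>\<^bsub>M\<^esub> x) = a \<odot>\<^bsub>N\<^esub> f x"
  shows "f \<in> linear_maps R M N"
  using assms by (auto simp: linear_maps_def)

definition ideal_module :: "'a::comm_ring_1 set \<Rightarrow> ('a, 'a) module" where
  "ideal_module A = \<lparr>carrier = A, monoid.mult = undefined, one = undefined, zero = 0, add = (+), module.smult = (*)\<rparr>"

lemma ideal_module_simps [simp]:
  "carrier (ideal_module A) = A" "a \<oplus>\<^bsub>ideal_module A\<^esub> b = a + b" "a \<odot>\<^bsub>ideal_module A\<^esub> b = a * b"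
  "\<zero>\<^bsub>ideal_module A\<^esub> = 0"
  by (simp_all add: ideal_module_def)

lemma module_ideal_module:
  fixes A :: "'a::comm_ring_1 set"
  assumes "0 \<in> A" "\<And>f g. f \<in> A \<Longrightarrow> g \<in> A \<Longrightarrow> f + g \<in> A" "\<And>r f. f \<in> A \<Longrightarrow> r * f \<in> A"
  shows "module rta (ideal_module A)"
proof (rule moduleI[OF cring_rta])
  show "abelian_group (ideal_module A)"
  proof (rule abelian_groupI)
    fix x assume "x \<in> carrier (ideal_module A)"
    then show "\<exists>y\<in>carrier (ideal_module A). y \<oplus>\<^bsub>ideal_module A\<^esub> x = \<zero>\<^bsub>ideal_module A\<^esub>"
      using assms(3)[of x "- 1"] by (intro bexI[of _ "- x"]) simp_all
  qed (use assms in \<open>simp_all add: add_ac\<close>)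
qed (use assms in \<open>simp_all add: distrib_left distrib_right mult.assoc\<close>)

text \<open>The ideal generated by the \<open>t\<close>-th powers of the variables in
  \<open>J\<close>, described by supports; \<open>mps_monomial_ideal_decomp\<close> gives back the
  generators.\<close>

definition power_ideal :: "'n set \<Rightarrow> nat \<Rightarrow> ('n::finite, 'k::comm_ring_1) mps set" where
  "power_ideal J t = {f. \<forall>a. mps_nth f a \<noteq> 0 \<longrightarrow> (\<exists>l\<in>J. t \<le> a l)}"

lemma power_ideal_0: "0 \<in> power_ideal J t" by (simp add: power_ideal_def zero_mps.rep_eq)

lemma power_ideal_add: "f \<in> power_ideal J t \<Longrightarrow> g \<in> power_ideal J t \<Longrightarrow> f + g \<in> power_ideal J t"
  unfolding power_ideal_def plus_mps.rep_eq by (auto; metis add_0)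

lemma mps_nth_mult_nonzeroE:
  assumes "mps_nth (f * g) a \<noteq> 0"
  obtains b c where "mps_nth f b \<noteq> 0" "mps_nth g c \<noteq> 0" "\<And>l. a l = b l + c l"
proof -
  obtain p where p: "p \<in> add_pairs a" "(case p of (b, c) \<Rightarrow> mps_nth f b * mps_nth g c) \<noteq> 0"
    using assms unfolding mps_nth_times by (meson sum.neutral)
  obtain b c where bc: "p = (b, c)" by (cases p)
  with p have "mps_nth f b * mps_nth g c \<noteq> 0" "\<forall>l. b l + c l = a l" by (auto simp: add_pairs_def)
  then show ?thesis by (intro that[of b c]) auto
qed

lemma power_ideal_mult: "f \<in> power_ideal J t \<Longrightarrow> r * f \<in> power_ideal J t"
proof -
  assume f: "f \<in> power_ideal J t"
  have "\<exists>l\<in>J. t \<le> a l" if a: "mps_nth (r * f) a \<noteq> 0" for a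
  proof -
    obtain b c where bc: "mps_nth f c \<noteq> 0" "\<And>l. a l = b l + c l"
      using mps_nth_mult_nonzeroE[OF a] by blast
    then obtain l where "l \<in> J" "t \<le> c l" using f by (auto simp: power_ideal_def)
    then show ?thesis using bc(2)[of l] by (intro bexI[of _ l]) simp_all
  qed
  then show ?thesis by (auto simp: power_ideal_def)
qed

lemma power_ideal_uminus: "f \<in> power_ideal J t \<Longrightarrow> - f \<in> power_ideal J t"
  using power_ideal_mult[of f J t "- 1"] by simp

text \<open>A variable outside \<open>J\<close> is a nonzerodivisor modulo the ideal: multiplying by
  it shifts only the exponent at \<open>j\<close>.\<close>

lemma power_ideal_cancel:
  assumes "j \<notin> J" "mps_var j ^ s * g \<in> power_ideal J t"
  shows "g \<in> power_ideal J t"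
proof -
  have "\<exists>l\<in>J. t \<le> b l" if b: "mps_nth g b \<noteq> 0" for b
  proof -
    have "(b(j := b j + s))(j := b j) = b" by simp
    then have "mps_nth (mps_var j ^ s * g) (b(j := b j + s)) \<noteq> 0" using b by (simp add: mps_nth_var_power_mult)
    then obtain l where l: "l \<in> J" "t \<le> (b(j := b j + s)) l" using assms(2) by (auto simp: power_ideal_def)
    with assms(1) have "l \<noteq> j" by auto
    then show ?thesis using l by auto
  qed
  then show ?thesis by (auto simp: power_ideal_def)
qed

lemma var_power_in_power_ideal: "l \<in> J \<Longrightarrow> mps_var l ^ t \<in> power_ideal J t"
  by (auto simp: power_ideal_def mps_var_power mps_monom.rep_eq split: if_splits intro!: bexI[of _ l])

lemma power_ideal_kills:
  fixes E :: "(('n::finite, 'k::comm_ring_1) mps, 'e) module"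
  assumes E: "module rta E" and e: "e \<in> carrier E" "\<And>l. l \<in> J \<Longrightarrow> mps_var l ^ t \<odot>\<^bsub>E\<^esub> e = \<zero>\<^bsub>E\<^esub>"
    and f: "f \<in> power_ideal J t"
  shows "f \<odot>\<^bsub>E\<^esub> e = \<zero>\<^bsub>E\<^esub>"
proof -
  interpret module rta E by fact
  obtain g where g: "f = (\<Sum>l\<in>J. mps_var l ^ t * g l)"
    using mps_monomial_ideal_decomp[of f J t] f by (auto simp: power_ideal_def)
  have "finite A \<Longrightarrow> A \<subseteq> J \<Longrightarrow> (\<Sum>l\<in>A. mps_var l ^ t * g l) \<odot>\<^bsub>E\<^esub> e = \<zero>\<^bsub>E\<^esub>" for A
  proof (induction A rule: finite_induct)
    case empty
    then show ?case using smult_l_null[OF e(1)] by simp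
  next
    case (insert l A)
    have "(g l * mps_var l ^ t) \<odot>\<^bsub>E\<^esub> e = \<zero>\<^bsub>E\<^esub>"
      using smult_assoc1[of "g l" "mps_var l ^ t" e] e insert.prems by (simp add: smult_r_null)
    then show ?case
      using insert smult_l_distr[of "mps_var l ^ t * g l" "\<Sum>l\<in>A. mps_var l ^ t * g l" e] e(1)
      by (simp add: mult.commute)
  qed
  then show ?thesis using g by simp
qed

text \<open>
  The map \<open>X\<^sub>j\<^sup>s g + p \<mapsto> g e\<close> from the ideal \<open>X\<^sub>j\<^sup>s R + (X\<^sub>l\<^sup>t : l \<in> J)\<close> to \<open>E\<close> extends to \<open>R\<close>;
  the image of \<open>1\<close> is the required quotient of \<open>e\<close>.
\<close>

lemma injective_module_divisible:
  fixes E :: "(('n::finite, 'k::comm_ring_1) mps, 'e) module"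
  assumes inj: "injective_module rta E" and j: "j \<notin> J"
    and e: "e \<in> carrier E" "\<And>l. l \<in> J \<Longrightarrow> mps_var l ^ t \<odot>\<^bsub>E\<^esub> e = \<zero>\<^bsub>E\<^esub>"
  shows "\<exists>e'\<in>carrier E. mps_var j ^ s \<odot>\<^bsub>E\<^esub> e' = e \<and> (\<forall>l\<in>J. mps_var l ^ t \<odot>\<^bsub>E\<^esub> e' = \<zero>\<^bsub>E\<^esub>)"
proof -
  have E: "module rta E" using inj by (simp add: injective_module_def)
  interpret E: module rta E by fact
  let ?P = "power_ideal J t" and ?x = "mps_var j ^ s"
  define A :: "('n, 'k) mps set" where "A = {f. \<exists>g. f - ?x * g \<in> ?P}"
  define g where "g f = (SOME g. f - ?x * g \<in> ?P) \<odot>\<^bsub>E\<^esub> e" for f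
  \<comment> \<open>Well-definedness: two multipliers for \<open>f\<close> differ, after cancelling
    the power of the variable, by an element of the power ideal, which kills
    \<open>e\<close>.\<close>
  have gI: "g f = u \<odot>\<^bsub>E\<^esub> e" if u: "f - ?x * u \<in> ?P" for f u
  proof -
    define v where "v = (SOME g. f - ?x * g \<in> ?P)"
    have v: "f - ?x * v \<in> ?P" unfolding v_def using u by (rule someI)
    have "?x * (v - u) = (f - ?x * u) + - (f - ?x * v)" by (simp add: algebra_simps)
    then have "?x * (v - u) \<in> ?P" using power_ideal_add[OF u power_ideal_uminus[OF v]] by simp
    then have "v - u \<in> ?P" by (rule power_ideal_cancel[OF j])
    then have "(v - u) \<odot>\<^bsub>E\<^esub> e = \<zero>\<^bsub>E\<^esub>" using power_ideal_kills[OF E e] by blast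
    then have "v \<odot>\<^bsub>E\<^esub> e = u \<odot>\<^bsub>E\<^esub> e" using E.smult_l_distr[of "v - u" u e] e(1) by simp
    then show ?thesis by (simp add: g_def v_def)
  qed
  have AE: "\<exists>u. f - ?x * u \<in> ?P \<and> g f = u \<odot>\<^bsub>E\<^esub> e" if "f \<in> A" for f
    using that gI by (auto simp: A_def)
  have add: "f + f' - ?x * (u + u') \<in> ?P" if "f - ?x * u \<in> ?P" "f' - ?x * u' \<in> ?P" for f f' u u'
    using power_ideal_add[OF that] by (simp add: algebra_simps)
  have mult: "r * f - ?x * (r * u) \<in> ?P" if "f - ?x * u \<in> ?P" for f r u
    using power_ideal_mult[OF that, of r] by (simp add: algebra_simps)
  have modA: "module rta (ideal_module A)"
  proof (rule module_ideal_module)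
    show "0 \<in> A" by (auto simp: A_def power_ideal_0 intro!: exI[of _ 0])
  next
    fix f f' assume "f \<in> A" "f' \<in> A"
    then show "f + f' \<in> A" unfolding A_def using add by blast
  next
    fix f r assume "f \<in> A"
    then show "r * f \<in> A" unfolding A_def using mult by blast
  qed
  have modR: "module rta (ideal_module (UNIV :: ('n, 'k) mps set))" by (rule module_ideal_module) simp_all
  have glin: "g \<in> linear_maps rta (ideal_module A) E"
  proof (rule linear_mapsI)
    fix f assume "f \<in> carrier (ideal_module A)"
    then obtain u where u: "f - ?x * u \<in> ?P" "g f = u \<odot>\<^bsub>E\<^esub> e" using AE by auto
    then show "g f \<in> carrier E" using e(1) by simp
    fix r show "g (r \<odot>\<^bsub>ideal_module A\<^esub> f) = r \<odot>\<^bsub>E\<^esub> g f"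
      using gI[OF mult[OF u(1), of r]] u(2) E.smult_assoc1[of r u e] e(1) by simp
  next
    fix f f' assume "f \<in> carrier (ideal_module A)" "f' \<in> carrier (ideal_module A)"
    then obtain u u' where "f - ?x * u \<in> ?P" "g f = u \<odot>\<^bsub>E\<^esub> e" "f' - ?x * u' \<in> ?P" "g f' = u' \<odot>\<^bsub>E\<^esub> e"
      using AE[of f] AE[of f'] by auto
    then show "g (f \<oplus>\<^bsub>ideal_module A\<^esub> f') = g f \<oplus>\<^bsub>E\<^esub> g f'"
      using gI[OF add[of f u f' u']] E.smult_l_distr[of u u' e] e(1) by simp
  qed
  have ilin: "(\<lambda>x. x) \<in> linear_maps rta (ideal_module A) (ideal_module UNIV)" by (rule linear_mapsI) simp_all
  \<comment> \<open>Baer's test on the inclusion of an ideal into the ring, both carried by the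
    element type of the ring as in the definition of injectivity.\<close>
  obtain k where k: "k \<in> linear_maps rta (ideal_module UNIV) E" "\<And>f. f \<in> A \<Longrightarrow> k f = g f"
    using inj glin ilin modA modR unfolding injective_module_def by fastforce
  have kmult: "k r = r \<odot>\<^bsub>E\<^esub> k 1" for r
  proof -
    have "k (r \<odot>\<^bsub>ideal_module UNIV\<^esub> 1) = r \<odot>\<^bsub>E\<^esub> k 1" using k(1) unfolding linear_maps_def by fastforce
    then show ?thesis by simp
  qed
  have "k 1 \<in> carrier E" using k(1) by (auto simp: linear_maps_def)
  moreover have "?x \<odot>\<^bsub>E\<^esub> k 1 = e"
  proof -
    have x: "?x - ?x * 1 \<in> ?P" by (simp add: power_ideal_0)
    then have "?x \<in> A" unfolding A_def by blast
    then show ?thesis using gI[OF x] k(2)[of ?x] kmult[of ?x] E.smult_one[OF e(1)] by simp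
  qed
  moreover have "mps_var l ^ t \<odot>\<^bsub>E\<^esub> k 1 = \<zero>\<^bsub>E\<^esub>" if l: "l \<in> J" for l
  proof -
    have x: "mps_var l ^ t - ?x * 0 \<in> ?P" using var_power_in_power_ideal[OF l] by simp
    then have "mps_var l ^ t \<in> A" unfolding A_def by blast
    then show ?thesis using gI[OF x] k(2)[of "mps_var l ^ t"] kmult[of "mps_var l ^ t"] E.smult_l_null[OF e(1)] by simp
  qed
  ultimately show ?thesis by blast
qed

section \<open>Powers of the ideal against powers of the variables\<close>

definition order_ideal :: "'n set \<Rightarrow> nat \<Rightarrow> ('n::finite, 'k::comm_ring_1) mps set" where
  "order_ideal J t = {f. \<forall>a. mps_nth f a \<noteq> 0 \<longrightarrow> t \<le> sum a J}"

lemma order_ideal_0: "0 \<in> order_ideal J t" by (simp add: order_ideal_def zero_mps.rep_eq)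

lemma order_ideal_add: "f \<in> order_ideal J t \<Longrightarrow> g \<in> order_ideal J t \<Longrightarrow> f + g \<in> order_ideal J t"
  unfolding order_ideal_def plus_mps.rep_eq by (auto; metis add_0)

lemma order_ideal_mult: 
  assumes "f \<in> order_ideal J s" "g \<in> order_ideal J t"
  shows "f * g \<in> order_ideal J (s + t)"
proof -
  have "s + t \<le> sum a J" if a: "mps_nth (f * g) a \<noteq> 0" for a
  proof -
    obtain b c where bc: "mps_nth f b \<noteq> 0" "mps_nth g c \<noteq> 0" "\<And>l. a l = b l + c l"
      using mps_nth_mult_nonzeroE[OF a] by blast
    then have "sum a J = sum b J + sum c J" by (simp add: sum.distrib)
    moreover have "s \<le> sum b J" "t \<le> sum c J" using bc assms by (auto simp: order_ideal_def)
    ultimately show ?thesis by simp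
  qed
  then show ?thesis by (auto simp: order_ideal_def)
qed

lemma order_ideal_zero_exponent: "order_ideal J 0 = UNIV" by (simp add: order_ideal_def)

lemma ideal_order_ideal: "ideal (order_ideal J t) (rta :: ('n::finite, 'k::comm_ring_1) mps ring)"
proof -
  have m: "x * a \<in> order_ideal J t" if "a \<in> order_ideal J t" for a x :: "('n, 'k) mps"
    using order_ideal_mult[of x J 0 a t] that by (simp add: order_ideal_zero_exponent)
  interpret cring "rta :: ('n, 'k) mps ring" by (rule cring_rta)
  show ?thesis
  proof (rule idealI[OF ring_axioms])
    show "subgroup (order_ideal J t) (add_monoid (rta :: ('n, 'k) mps ring))"
    proof (rule add.subgroupI)
      fix a :: "('n, 'k) mps" assume "a \<in> order_ideal J t"
      then show "\<ominus>\<^bsub>rta\<^esub> a \<in> order_ideal J t" using m[of a "- 1"] by simp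
    qed (use order_ideal_0[of J t] order_ideal_add in auto)
  qed (use m in \<open>auto simp: mult.commute\<close>)
qed

lemma ideal_power_subset_order_ideal:
  "ideal_power rta (Idl\<^bsub>rta\<^esub> {mps_var j | j. j \<in> J}) t \<subseteq> (order_ideal J t :: ('n::finite, 'k::comm_ring_1) mps set)"
proof (induction t)
  case 0
  then show ?case by (simp add: order_ideal_zero_exponent)
next
  case (Suc t)
  interpret cring "rta :: ('n, 'k) mps ring" by (rule cring_rta)
  have "Idl\<^bsub>rta\<^esub> {mps_var j | j. j \<in> J} \<subseteq> (order_ideal J 1 :: ('n, 'k) mps set)"
  proof (rule genideal_minimal[OF ideal_order_ideal], rule subsetI)
    fix f :: "('n, 'k) mps" assume "f \<in> {mps_var j | j. j \<in> J}"
    then obtain j where j: "j \<in> J" "f = mps_var j" by auto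
    have "Suc 0 \<le> sum (\<lambda>l. if l = j then 1 else 0 :: nat) J" using j by simp
    then show "f \<in> order_ideal J 1" using j by (auto simp: order_ideal_def mps_var.rep_eq split: if_splits)
  qed
  then have I: "f \<in> order_ideal J 1" if "f \<in> Idl\<^bsub>rta\<^esub> {mps_var j | j. j \<in> J}" for f :: "('n, 'k) mps" using that by blast
  show ?case
  proof
    fix f :: "('n, 'k) mps" assume "f \<in> ideal_power rta (Idl\<^bsub>rta\<^esub> {mps_var j | j. j \<in> J}) (Suc t)"
    then have "f \<in> ideal_prod rta (Idl\<^bsub>rta\<^esub> {mps_var j | j. j \<in> J}) (ideal_power rta (Idl\<^bsub>rta\<^esub> {mps_var j | j. j \<in> J}) t)" by simp
    then show "f \<in> order_ideal J (Suc t)"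
    proof (induction rule: ideal_prod.induct)
      case (prod f g)
      then show ?case using order_ideal_mult[OF I, of f g t] Suc.IH by auto
    next
      case (sum f g)
      then show ?case using order_ideal_add by simp
    qed
  qed
qed

lemma var_power_in_ideal_power:
  assumes "l \<in> J"
  shows "mps_var l ^ t \<in> ideal_power rta (Idl\<^bsub>rta\<^esub> {mps_var j | j. j \<in> J}) t"
proof (induction t)
  case (Suc t)
  interpret cring "rta :: ('n::finite, 'k::comm_ring_1) mps ring" by (rule cring_rta)
  have "mps_var l \<in> Idl\<^bsub>rta\<^esub> {mps_var j | j. j \<in> J}" using genideal_self[of "{mps_var j | j. j \<in> J}"] assms by auto
  from ideal_prod.prod[OF this Suc, of rta] show ?case by simp
qed simp

text \<open>The two families of ideals are cofinal. A monomial of degree above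
  \<open>card J * t\<close> in the variables of \<open>J\<close> has some exponent at least
  \<open>t\<close> there, and conversely the \<open>t\<close>-th power of the ideal contains the
  \<open>t\<close>-th powers of the variables.\<close>

lemma torsion_part_iff:
  fixes E :: "(('n::finite, 'k::comm_ring_1) mps, 'e) module"
  assumes E: "module rta E"
  shows "e \<in> torsion_part rta (Idl\<^bsub>rta\<^esub> {mps_var j | j. j \<in> J}) E \<longleftrightarrow>
    e \<in> carrier E \<and> (\<exists>t. \<forall>l\<in>J. mps_var l ^ t \<odot>\<^bsub>E\<^esub> e = \<zero>\<^bsub>E\<^esub>)"
proof
  assume "e \<in> torsion_part rta (Idl\<^bsub>rta\<^esub> {mps_var j | j. j \<in> J}) E"
  then show "e \<in> carrier E \<and> (\<exists>t. \<forall>l\<in>J. mps_var l ^ t \<odot>\<^bsub>E\<^esub> e = \<zero>\<^bsub>E\<^esub>)"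
    using var_power_in_ideal_power unfolding torsion_part_def by blast
next
  assume "e \<in> carrier E \<and> (\<exists>t. \<forall>l\<in>J. mps_var l ^ t \<odot>\<^bsub>E\<^esub> e = \<zero>\<^bsub>E\<^esub>)"
  then obtain t where e: "e \<in> carrier E" "\<And>l. l \<in> J \<Longrightarrow> mps_var l ^ t \<odot>\<^bsub>E\<^esub> e = \<zero>\<^bsub>E\<^esub>" by blast
  have "order_ideal J (Suc (card J * t)) \<subseteq> (power_ideal J t :: ('n, 'k) mps set)"
  proof
    fix f :: "('n, 'k) mps" assume f: "f \<in> order_ideal J (Suc (card J * t))"
    have "\<exists>l\<in>J. t \<le> a l" if "mps_nth f a \<noteq> 0" for a
    proof (rule ccontr)
      assume "\<not> (\<exists>l\<in>J. t \<le> a l)"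
      then have "sum a J \<le> of_nat (card J) * t" by (intro sum_bounded_above) (auto simp: not_le less_imp_le)
      then show False using f that by (auto simp: order_ideal_def)
    qed
    then show "f \<in> power_ideal J t" by (auto simp: power_ideal_def)
  qed
  then have "\<forall>a\<in>ideal_power rta (Idl\<^bsub>rta\<^esub> {mps_var j | j. j \<in> J}) (Suc (card J * t)). a \<odot>\<^bsub>E\<^esub> e = \<zero>\<^bsub>E\<^esub>"
    using ideal_power_subset_order_ideal[of J "Suc (card J * t)"] power_ideal_kills[OF E e] by blast
  then show "e \<in> torsion_part rta (Idl\<^bsub>rta\<^esub> {mps_var j | j. j \<in> J}) E"
    unfolding torsion_part_def using e(1) by blast
qed

section \<open>The trace functional attached to a square root\<close>

lemma prod_mps_var_power: "(\<Prod>l\<in>A. mps_var l ^ a l) = mps_monom (\<lambda>l. if l \<in> A then a l else 0)"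
  for A :: "'n::finite set"
proof -
  have "finite A" by simp
  then show ?thesis
  proof (induction A rule: finite_induct)
    case empty
    then show ?case by (intro mps_eqI) (simp add: mps_nth_one mps_monom.rep_eq)
  next
    case (insert l A)
    then have "(\<lambda>j. (if j = l then a l else 0) + (if j \<in> A then a j else 0)) = (\<lambda>j. if j \<in> insert l A then a j else 0)"
      by auto
    then show ?case using insert by (simp add: mps_var_power mps_monom_mult)
  qed
qed

context differential_trace
begin

lemma comm_ring_hom_\<phi>: "comm_ring_hom \<phi>"
  by unfold_locales (simp_all add: \<phi>_def hom_add hom_mult)

sublocale \<phi>: comm_ring_hom \<phi> by (rule comm_ring_hom_\<phi>)

abbreviation IC where "IC \<equiv> integral_closure \<phi>"

lemma IC_add: "a \<in> IC \<Longrightarrow> b \<in> IC \<Longrightarrow> a + b \<in> IC" by (rule integral_closure_add_mult[OF comm_ring_hom_\<phi>])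
lemma IC_mult: "a \<in> IC \<Longrightarrow> b \<in> IC \<Longrightarrow> a * b \<in> IC" by (rule integral_closure_add_mult[OF comm_ring_hom_\<phi>])
lemma IC_uminus: "a \<in> IC \<Longrightarrow> - a \<in> IC" by (rule integral_closure_uminus[OF comm_ring_hom_\<phi>])
lemma IC_\<phi>: "\<phi> r \<in> IC" by (rule integral_closure_hom[OF comm_ring_hom_\<phi>])
lemma IC_0: "0 \<in> IC" using IC_\<phi>[of 0] by simp
lemma IC_1: "1 \<in> IC" using IC_\<phi>[of 1] by simp

lemma adj_\<phi> [simp]: "\<phi> r \<in> adj \<gamma>" by (simp add: \<phi>_def)

section \<open>Traces of formal differentials\<close>

lemma dtr_add:
  assumes "\<And>j. v j \<in> adj \<gamma>" "\<And>j. w j \<in> adj \<gamma>"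
  shows "dtr \<gamma> (\<lambda>j. v j + w j) = dtr \<gamma> v + dtr \<gamma> w"
  by (simp add: dtr_def tr_add[OF assms] \<iota>K.hom_add distrib_left sum.distrib)

lemma dtr_\<phi>:
  assumes "\<And>j. v j \<in> adj \<gamma>"
  shows "dtr \<gamma> (\<lambda>j. \<phi> r * v j) = to_fract (\<iota> r) * dtr \<gamma> v"
  unfolding dtr_def \<phi>_def tr_smult[OF assms] \<iota>K.hom_mult \<iota>K_to_fract sum_distrib_left
  by (simp only: mult.left_commute)

lemma dtr_0 [simp]: "dtr \<gamma> (\<lambda>j. 0) = 0" by (simp add: dtr_def)

lemma dtr_sum:
  assumes "\<And>c j. c \<in> S \<Longrightarrow> v c j \<in> adj \<gamma>"
  shows "dtr \<gamma> (\<lambda>j. \<Sum>c\<in>S. v c j) = (\<Sum>c\<in>S. dtr \<gamma> (v c))"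
  using assms
proof (induction S rule: infinite_finite_induct)
  case (insert c S)
  then show ?case using dtr_add[of "v c" \<gamma> "\<lambda>j. \<Sum>c\<in>S. v c j"] by (simp add: adj_sum)
qed simp_all

text \<open>The coefficient of \<open>dX\<^sub>j\<close> in the image of the formal differential \<open>\<Sum>\<^sub>c v(c) dc\<close>.\<close>

definition dl :: "'n \<Rightarrow> ('l \<Rightarrow> 'l) \<Rightarrow> 'l" where "dl j v = (\<Sum>c | v c \<noteq> 0. v c * ld j c)"

lemma dl_superset: "finite S \<Longrightarrow> {c. v c \<noteq> 0} \<subseteq> S \<Longrightarrow> dl j v = (\<Sum>c\<in>S. v c * ld j c)"
  unfolding dl_def by (rule sum.mono_neutral_left) auto

lemma dl_add:
  assumes "finite {c. u c \<noteq> 0}" "finite {c. v c \<noteq> 0}"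
  shows "dl j (\<lambda>c. u c + v c) = dl j u + dl j v"
proof -
  let ?S = "{c. u c \<noteq> 0} \<union> {c. v c \<noteq> 0}"
  have "finite ?S" using assms by simp
  moreover have "{c. u c + v c \<noteq> 0} \<subseteq> ?S" by auto
  ultimately show ?thesis by (simp add: dl_superset[of ?S] sum.distrib distrib_right)
qed

lemma dl_smult: "finite {c. v c \<noteq> 0} \<Longrightarrow> dl j (\<lambda>c. a * v c) = a * dl j v"
  by (subst dl_superset[of "{c. v c \<noteq> 0}"]) (auto simp: dl_def sum_distrib_left mult.assoc)

lemma dl_0 [simp]: "dl j (\<lambda>c. 0) = 0" by (simp add: dl_def)

lemma dl_diff:
  assumes "finite {c. u c \<noteq> 0}" "finite {c. v c \<noteq> 0}"
  shows "dl j (\<lambda>c. u c - v c) = dl j u - dl j v"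
  using dl_add[of u "\<lambda>c. - 1 * v c" j] dl_smult[of v j "- 1"] assms by simp

lemma dl_basis: "dl j (\<lambda>c. if c = b then 1 else 0) = ld j b"
  by (subst dl_superset[of "{b}"]) auto

definition admissible :: "('l \<Rightarrow> 'l) \<Rightarrow> bool" where
  "admissible v \<longleftrightarrow> (\<forall>c. v c \<in> IC) \<and> (\<forall>c. c \<notin> IC \<longrightarrow> v c = 0) \<and> finite {c. v c \<noteq> 0}"

text \<open>The finitely many field elements that must lie in \<open>adj \<gamma>\<close> before the
  trace of the form makes sense.\<close>

definition data where "data v = {c. v c \<noteq> 0} \<union> v ` {c. v c \<noteq> 0}"

lemma finite_data: "admissible v \<Longrightarrow> finite (data v)" by (simp add: data_def admissible_def)

lemma dl_in_adj: "data v \<subseteq> adj \<gamma> \<Longrightarrow> dl j v \<in> adj \<gamma>"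
  unfolding dl_def data_def by (intro adj_sum adj_mult ld_in_adj) auto

lemma dtr_dl_integral:
  assumes v: "admissible v" "data v \<subseteq> adj \<gamma>" and a: "a \<in> IC" "a \<in> adj \<gamma>"
  obtains \<rho> where "dtr \<gamma> (\<lambda>j. a * dl j v) = to_fract \<rho>"
proof -
  let ?S = "{c. v c \<noteq> 0}"
  have "\<exists>\<rho>. dtr \<gamma> (\<lambda>j. (a * v c) * ld j c) = to_fract \<rho>" if c: "c \<in> ?S" for c
  proof -
    have "c \<in> IC" "v c \<in> IC" using c v(1) by (auto simp: admissible_def)
    moreover have "c \<in> adj \<gamma>" "v c \<in> adj \<gamma>" using c v(2) by (auto simp: data_def)
    ultimately show ?thesis using a dtr_integral[of "a * v c" \<gamma> c] by (metis IC_mult adj_mult)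
  qed
  then obtain \<rho> where \<rho>: "\<And>c. c \<in> ?S \<Longrightarrow> dtr \<gamma> (\<lambda>j. (a * v c) * ld j c) = to_fract (\<rho> c)" by metis
  have "dtr \<gamma> (\<lambda>j. a * dl j v) = dtr \<gamma> (\<lambda>j. \<Sum>c\<in>?S. (a * v c) * ld j c)"
    by (simp add: dl_def sum_distrib_left mult.assoc)
  also have "\<dots> = (\<Sum>c\<in>?S. dtr \<gamma> (\<lambda>j. (a * v c) * ld j c))"
    using v(2) a(2) by (intro dtr_sum adj_mult ld_in_adj) (auto simp: data_def)
  also have "\<dots> = to_fract (sum \<rho> ?S)" using \<rho> by simp
  finally show ?thesis by (rule that)
qed

end

section \<open>The trace twisted by the square root\<close>

locale square_root = differential_trace \<kappa> Y h
  for \<kappa> :: "'k::field_char_0 \<Rightarrow> 'q::field_char_0" and Y :: "'n::finite \<Rightarrow> 'q"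
    and h :: "('n, 'k) mps fract \<Rightarrow> 'l::field" +
  fixes y :: 'l and i :: 'n
  assumes y: "y ^ 2 = \<phi> (mps_var i)" "y \<in> IC" and Yi: "Y i \<noteq> 0"
begin

lemma two_neq0: "(2 :: 'l) \<noteq> 0"
proof -
  have "h 2 \<noteq> 0" by simp
  then show ?thesis by (simp add: hom_numeral)
qed

lemma y_neq0: "y \<noteq> 0"
proof
  assume "y = 0"
  then have "to_fract (mps_var i :: ('n, 'k) mps) = 0" using y(1) by (simp add: \<phi>_def)
  then have "mps_nth (mps_var i :: ('n, 'k) mps) (\<lambda>j. if j = i then 1 else 0) = 0" by simp
  then show False by (simp add: mps_var.rep_eq)
qed

text \<open>Differentiate \<open>y\<^sup>2 = X\<^sub>i\<close> and divide by
  \<open>2 y\<close>.\<close>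

lemma ld_y: "ld j y = (if j = i then 1 / (2 * y) else 0)"
proof -
  have "2 * y * ld j y = ld j (y * y)" by (simp add: derivation_alongD[OF derivation_along_ld])
  also have "\<dots> = (if j = i then 1 else 0)"
    using y(1) ld_\<phi>[of j "mps_var i"] by (simp add: power2_eq_square mps_deriv_var)
  finally show ?thesis using y_neq0 two_neq0 by (simp add: field_simps split: if_splits)
qed

lemma dtr_ld_y: "dtr \<gamma> (\<lambda>j. b * ld j y) = to_fract (mps_const (Y i)) * \<iota>K (tr \<gamma> (b * ld i y))"
proof -
  have "dtr \<gamma> (\<lambda>j. b * ld j y) = (\<Sum>j\<in>{i}. to_fract (mps_const (Y j)) * \<iota>K (tr \<gamma> (b * ld j y)))"
    unfolding dtr_def by (rule sum.mono_neutral_right) (auto simp: ld_y)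
  then show ?thesis by simp
qed

text \<open>Since \<open>dy = dX\<^sub>i / 2y\<close>, the product \<open>b y\<close> is \<open>2 X\<^sub>i\<close> times \<open>b\<close> times the \<open>X\<^sub>i\<close>-derivative of \<open>y\<close>.\<close>

lemma tr_mult_y:
  assumes b: "b \<in> IC" "b \<in> adj \<gamma>" and y\<gamma>: "y \<in> adj \<gamma>"
  obtains \<sigma> where "\<iota>K (tr \<gamma> (b * y)) = to_fract (mps_var i * \<sigma>)"
proof -
  obtain \<rho> where \<rho>: "dtr \<gamma> (\<lambda>j. b * ld j y) = to_fract \<rho>" using dtr_integral[OF b(2,1) y\<gamma> y(2)] by blast
  have "mps_const (inverse (Y i)) * mps_const (Y i) = (1 :: ('n, 'q) mps)"
    using Yi by (intro mps_eqI) (simp add: mps_nth_const mps_nth_one)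
  then have "to_fract (mps_const (inverse (Y i))) * to_fract (mps_const (Y i)) = (1 :: ('n, 'q) mps fract)"
    by (metis to_fract_1 to_fract_mult)
  then have "\<iota>K (tr \<gamma> (b * ld i y)) = to_fract (mps_const (inverse (Y i))) * (to_fract (mps_const (Y i)) * \<iota>K (tr \<gamma> (b * ld i y)))"
    unfolding mult.assoc[symmetric] by (simp only: mult_1_left)
  also have "\<dots> = to_fract (mps_const (inverse (Y i)) * \<rho>)"
    unfolding \<rho>[unfolded dtr_ld_y] by (rule to_fract_mult[symmetric])
  finally have t: "\<iota>K (tr \<gamma> (b * ld i y)) = to_fract (mps_const (inverse (Y i)) * \<rho>)" .
  have "h (to_fract (2 * mps_var i)) = 2 * y ^ 2" using y(1) by (simp only: \<phi>_def mult_2 to_fract_add hom_add)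
  then have "b * y = h (to_fract (2 * mps_var i)) * (b * ld i y)"
    using y_neq0 two_neq0 by (simp add: ld_y power2_eq_square)
  then have "tr \<gamma> (b * y) = to_fract (2 * mps_var i) * tr \<gamma> (b * ld i y)"
    using tr_smult[OF adj_mult[OF b(2) ld_in_adj[OF y\<gamma>]], of "to_fract (2 * mps_var i)" i] by (simp only:)
  then have "\<iota>K (tr \<gamma> (b * y)) = to_fract (\<iota> (2 * mps_var i) * (mps_const (inverse (Y i)) * \<rho>))"
    by (simp only: \<iota>K.hom_mult \<iota>K_to_fract t to_fract_mult \<iota>.hom_mult)
  moreover have "\<iota> (mps_var i) = mps_var i" by (rule mps_eqI) (simp add: mps_map.rep_eq mps_var.rep_eq)
  ultimately show ?thesis
    by (intro that[of "2 * (mps_const (inverse (Y i)) * \<rho>)"]) (simp add: \<iota>.hom_mult \<iota>.hom_numeral mult_ac del: to_fract_mult)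
qed

text \<open>All integral \<open>b\<close> of the subextension are allowed so that the condition
  survives multiplication by \<open>B\<close>. Membership in \<open>adj \<gamma>\<close> is demanded
  as well because the trace has a meaning only there.\<close>

definition good :: "'l \<Rightarrow> ('n \<Rightarrow> 'l) \<Rightarrow> bool" where
  "good \<gamma> \<delta> \<longleftrightarrow> (\<forall>b. b \<in> IC \<longrightarrow> b \<in> adj \<gamma> \<longrightarrow> (\<forall>j. b * y * \<delta> j \<in> adj \<gamma>) \<and>
     (\<exists>\<rho>. dtr \<gamma> (\<lambda>j. b * y * \<delta> j) = to_fract (mps_var i * \<rho>)))"

text \<open>
  The trace functional vanishes modulo \<open>X\<^sub>i\<close> on every \<open>B\<close>-multiple of the form \<open>\<Sum>\<^sub>j \<delta>\<^sub>j dX\<^sub>j\<close>, once it is computed in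
  a sufficiently large finite subextension; \<open>L\<close> itself may have infinite degree.
\<close>

definition negligible :: "('n \<Rightarrow> 'l) \<Rightarrow> bool" where
  "negligible \<delta> \<longleftrightarrow> (\<exists>A. finite A \<and> (\<forall>\<gamma>. A \<subseteq> adj \<gamma> \<longrightarrow> good \<gamma> \<delta>))"

lemma negligible_0: "negligible (\<lambda>j. 0)"
  unfolding negligible_def good_def by (intro exI[of _ "{}"]) (auto intro!: exI[of _ 0])

lemma negligible_add:
  assumes "negligible u" "negligible v" shows "negligible (\<lambda>j. u j + v j)"
proof -
  obtain A A' where A: "finite A" "\<And>\<gamma>. A \<subseteq> adj \<gamma> \<Longrightarrow> good \<gamma> u" and A': "finite A'" "\<And>\<gamma>. A' \<subseteq> adj \<gamma> \<Longrightarrow> good \<gamma> v"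
    using assms unfolding negligible_def by blast
  have "good \<gamma> (\<lambda>j. u j + v j)" if \<gamma>: "A \<union> A' \<subseteq> adj \<gamma>" for \<gamma>
    unfolding good_def
  proof (intro allI impI)
    fix b assume b: "b \<in> IC" "b \<in> adj \<gamma>"
    obtain \<rho> where u: "\<And>j. b * y * u j \<in> adj \<gamma>" "dtr \<gamma> (\<lambda>j. b * y * u j) = to_fract (mps_var i * \<rho>)"
      using A(2)[of \<gamma>] \<gamma> b unfolding good_def by blast
    obtain \<rho>' where v: "\<And>j. b * y * v j \<in> adj \<gamma>" "dtr \<gamma> (\<lambda>j. b * y * v j) = to_fract (mps_var i * \<rho>')"
      using A'(2)[of \<gamma>] \<gamma> b unfolding good_def by blast
    have "dtr \<gamma> (\<lambda>j. b * y * (u j + v j)) = to_fract (mps_var i * (\<rho> + \<rho>'))"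
      using dtr_add[of "\<lambda>j. b * y * u j" \<gamma> "\<lambda>j. b * y * v j"] u v by (simp add: distrib_left del: to_fract_mult)
    then show "(\<forall>j. b * y * (u j + v j) \<in> adj \<gamma>) \<and> (\<exists>\<rho>. dtr \<gamma> (\<lambda>j. b * y * (u j + v j)) = to_fract (mps_var i * \<rho>))"
      using adj_add[OF u(1) v(1)] by (intro conjI allI exI[of _ "\<rho> + \<rho>'"]) (simp_all only: distrib_left)
  qed
  then show ?thesis using A(1) A'(1) unfolding negligible_def by (intro exI[of _ "A \<union> A'"]) simp
qed

lemma negligible_smult:
  assumes "negligible v" "a \<in> IC" shows "negligible (\<lambda>j. a * v j)"
proof -
  obtain A where A: "finite A" "\<And>\<gamma>. A \<subseteq> adj \<gamma> \<Longrightarrow> good \<gamma> v"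
    using assms unfolding negligible_def by blast
  have "good \<gamma> (\<lambda>j. a * v j)" if \<gamma>: "insert a A \<subseteq> adj \<gamma>" for \<gamma>
    unfolding good_def
  proof (intro allI impI)
    fix b assume b: "b \<in> IC" "b \<in> adj \<gamma>"
    have eq: "b * y * (a * v j) = (b * a) * y * v j" for j by (simp add: mult_ac)
    have "b * a \<in> IC" "b * a \<in> adj \<gamma>" using b assms(2) \<gamma> IC_mult by auto
    then show "(\<forall>j. b * y * (a * v j) \<in> adj \<gamma>) \<and> (\<exists>\<rho>. dtr \<gamma> (\<lambda>j. b * y * (a * v j)) = to_fract (mps_var i * \<rho>))"
      using A(2)[of \<gamma>] \<gamma> unfolding good_def eq by blast
  qed
  then show ?thesis using A(1) unfolding negligible_def by (intro exI[of _ "insert a A"]) simp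
qed

text \<open>The derivatives of \<open>r\<close> are scalars and leave the trace; what remains is the
  trace of \<open>b y\<close>, divisible by \<open>X\<^sub>i\<close>.\<close>

lemma negligible_\<phi>: "negligible (\<lambda>j. ld j (\<phi> r))"
proof -
  have "good \<gamma> (\<lambda>j. \<phi> (mps_deriv j r))" if \<gamma>: "{y} \<subseteq> adj \<gamma>" for \<gamma>
    unfolding good_def
  proof (intro allI impI)
    fix b assume b: "b \<in> IC" "b \<in> adj \<gamma>"
    have by\<gamma>: "b * y \<in> adj \<gamma>" using b \<gamma> by auto
    obtain \<sigma> where \<sigma>: "\<iota>K (tr \<gamma> (b * y)) = to_fract (mps_var i * \<sigma>)"
      using tr_mult_y[of b \<gamma>] b \<gamma> by auto
    have "tr \<gamma> (b * y * \<phi> (mps_deriv j r)) = to_fract (mps_deriv j r) * tr \<gamma> (b * y)" for j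
      using tr_smult[OF by\<gamma>, of "to_fract (mps_deriv j r)"] by (simp add: \<phi>_def mult.commute)
    then have "dtr \<gamma> (\<lambda>j. b * y * \<phi> (mps_deriv j r)) =
        (\<Sum>j\<in>UNIV. to_fract (mps_const (Y j)) * (to_fract (\<iota> (mps_deriv j r)) * to_fract (mps_var i * \<sigma>)))"
      by (simp only: dtr_def \<iota>K.hom_mult \<iota>K_to_fract \<sigma>)
    also have "\<dots> = to_fract (\<Sum>j\<in>UNIV. mps_const (Y j) * (\<iota> (mps_deriv j r) * (mps_var i * \<sigma>)))"
      by simp
    also have "(\<Sum>j\<in>UNIV. mps_const (Y j) * (\<iota> (mps_deriv j r) * (mps_var i * \<sigma>))) =
        mps_var i * (\<Sum>j\<in>UNIV. mps_const (Y j) * \<iota> (mps_deriv j r) * \<sigma>)"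
      by (simp add: sum_distrib_left mult_ac)
    finally show "(\<forall>j. b * y * \<phi> (mps_deriv j r) \<in> adj \<gamma>) \<and>
        (\<exists>\<rho>. dtr \<gamma> (\<lambda>j. b * y * \<phi> (mps_deriv j r)) = to_fract (mps_var i * \<rho>))"
      using by\<gamma> by (intro conjI allI exI) (auto simp del: to_fract_mult)
  qed
  then show ?thesis unfolding negligible_def ld_\<phi> by (intro exI[of _ "{y}"]) simp
qed

text \<open>Compare the coefficients at the monomial with exponent 0 at \<open>i\<close> and
  \<open>s\<close> elsewhere. The form \<open>dy\<close> contributes the nonzero constant
  \<open>c\<close>; multiples of \<open>X\<^sub>i\<close> and of
  \<open>X\<^sub>l\<^sup>s\<^sup>+\<^sup>1\<close> contribute nothing.\<close>

lemma trace_obstruction: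
  assumes v: "\<And>l. l \<noteq> i \<Longrightarrow> admissible (v l)"
    and neg: "negligible (\<lambda>j. \<phi> (\<Prod>l\<in>UNIV - {i}. mps_var l ^ s) * ld j y - (\<Sum>l\<in>UNIV - {i}. \<phi> (mps_var l ^ Suc s) * dl j (v l)))"
      (is "negligible ?\<delta>")
  shows False
proof -
  let ?J = "UNIV - {i}" and ?P = "\<Prod>l\<in>UNIV - {i}. mps_var l ^ s :: ('n, 'k) mps"
  obtain A where A: "finite A" "\<And>\<gamma>. A \<subseteq> adj \<gamma> \<Longrightarrow> good \<gamma> ?\<delta>"
    using neg unfolding negligible_def by blast
  have "finite (insert y (A \<union> (\<Union>l\<in>?J. data (v l))))" using A(1) v finite_data by auto
  then obtain \<gamma> where "insert y (A \<union> (\<Union>l\<in>?J. data (v l))) \<subseteq> adj \<gamma>" using primitive_element_finite by metis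
  then have \<gamma>: "A \<subseteq> adj \<gamma>" "y \<in> adj \<gamma>" "\<And>l. l \<noteq> i \<Longrightarrow> data (v l) \<subseteq> adj \<gamma>" by auto
  obtain \<rho> where \<rho>: "dtr \<gamma> (\<lambda>j. 1 * y * ?\<delta> j) = to_fract (mps_var i * \<rho>)"
    using A(2)[OF \<gamma>(1), unfolded good_def, rule_format, OF IC_1 adj_1] by blast
  have "\<exists>\<rho>. dtr \<gamma> (\<lambda>j. y * dl j (v l)) = to_fract \<rho>" if "l \<noteq> i" for l
    using dtr_dl_integral[OF v[OF that] \<gamma>(3)[OF that] y(2) \<gamma>(2)] by blast
  then obtain \<tau> where \<tau>: "\<And>l. l \<noteq> i \<Longrightarrow> dtr \<gamma> (\<lambda>j. y * dl j (v l)) = to_fract (\<tau> l)" by metis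
  \<comment> \<open>By \<open>ld_y\<close>, \<open>y\<close> times its derivative by
    \<open>X\<^sub>i\<close> is 1/2, and the trace of 1 is the degree.\<close>
  define c where "c = Y i * (of_nat (degree (mpoly \<gamma>)) / 2)"
  have c0: "c \<noteq> 0" using Yi mpoly_degree_pos[of \<gamma>] by (simp add: c_def)
  interpret mc: comm_ring_hom "mps_const :: 'q \<Rightarrow> ('n, 'q) mps" by (rule comm_ring_hom_mps_const)
  have "h 2 * (y * ld i y) = 1" using y_neq0 two_neq0 by (simp add: ld_y hom_numeral)
  then have "2 * tr \<gamma> (y * ld i y) = of_nat (degree (mpoly \<gamma>))"
    using tr_smult[of "y * ld i y" \<gamma> 2] \<gamma>(2) by (simp add: tr_1 adj_mult ld_in_adj)
  then have "\<iota>K (2 * tr \<gamma> (y * ld i y)) = \<iota>K (of_nat (degree (mpoly \<gamma>)))" by (rule arg_cong)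
  then have "2 * \<iota>K (tr \<gamma> (y * ld i y)) = of_nat (degree (mpoly \<gamma>))"
    by (simp add: \<iota>K.hom_mult \<iota>K.hom_numeral \<iota>K.hom_of_nat)
  also have "\<dots> = 2 * to_fract (mps_const (of_nat (degree (mpoly \<gamma>)) / 2))"
  proof -
    interpret tf: comm_ring_hom "to_fract :: ('n, 'q) mps \<Rightarrow> _" by unfold_locales simp_all
    have "2 * mps_const (of_nat (degree (mpoly \<gamma>)) / 2) = (of_nat (degree (mpoly \<gamma>)) :: ('n, 'q) mps)"
      by (rule mps_eqI) (simp only: mult_2 plus_mps.rep_eq mps_nth_const mps_nth_of_nat, simp)
    then have "to_fract (2 * mps_const (of_nat (degree (mpoly \<gamma>)) / 2) :: ('n, 'q) mps) = to_fract (of_nat (degree (mpoly \<gamma>)))"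
      by (rule arg_cong)
    then show ?thesis by (simp add: tf.hom_numeral tf.hom_of_nat)
  qed
  finally have "\<iota>K (tr \<gamma> (y * ld i y)) = to_fract (mps_const (of_nat (degree (mpoly \<gamma>)) / 2))" by simp
  then have yy: "dtr \<gamma> (\<lambda>j. y * ld j y) = to_fract (mps_const c)"
    unfolding dtr_ld_y c_def mc.hom_mult by simp
  have in1: "\<phi> ?P * (y * ld j y) \<in> adj \<gamma>" for j using \<gamma>(2) by (intro adj_mult ld_in_adj) simp_all
  have in2: "\<phi> (- (mps_var l ^ Suc s)) * (y * dl j (v l)) \<in> adj \<gamma>" if "l \<in> ?J" for l j
    using \<gamma> that by (intro adj_mult dl_in_adj) (simp_all del: \<phi>.hom_uminus)
  have "to_fract (mps_var i * \<rho>) = dtr \<gamma> (\<lambda>j. \<phi> ?P * (y * ld j y) + (\<Sum>l\<in>?J. \<phi> (- (mps_var l ^ Suc s)) * (y * dl j (v l))))"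
    unfolding \<rho>[symmetric] by (simp add: algebra_simps sum_distrib_left sum_negf \<phi>.hom_uminus)
  also have "\<dots> = dtr \<gamma> (\<lambda>j. \<phi> ?P * (y * ld j y)) + (\<Sum>l\<in>?J. dtr \<gamma> (\<lambda>j. \<phi> (- (mps_var l ^ Suc s)) * (y * dl j (v l))))"
    using in1 in2 by (subst dtr_add) (simp_all only: dtr_sum adj_sum)
  also have "dtr \<gamma> (\<lambda>j. \<phi> ?P * (y * ld j y)) = to_fract (\<iota> ?P * mps_const c)"
    using \<gamma>(2) by (subst dtr_\<phi>) (auto simp: yy intro!: adj_mult ld_in_adj)
  also have "(\<Sum>l\<in>?J. dtr \<gamma> (\<lambda>j. \<phi> (- (mps_var l ^ Suc s)) * (y * dl j (v l)))) =
      (\<Sum>l\<in>?J. to_fract (\<iota> (- (mps_var l ^ Suc s)) * \<tau> l))"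
  proof (rule sum.cong[OF refl])
    fix l assume "l \<in> ?J"
    then have "l \<noteq> i" by simp
    then show "dtr \<gamma> (\<lambda>j. \<phi> (- (mps_var l ^ Suc s)) * (y * dl j (v l))) = to_fract (\<iota> (- (mps_var l ^ Suc s)) * \<tau> l)"
      using \<gamma> \<tau> by (subst dtr_\<phi>) (auto intro!: adj_mult dl_in_adj)
  qed
  finally have "to_fract (mps_var i * \<rho>) = to_fract (\<iota> ?P * mps_const c + (\<Sum>l\<in>?J. \<iota> (- (mps_var l ^ Suc s)) * \<tau> l))"
    by simp
  then have eq: "mps_var i * \<rho> = \<iota> ?P * mps_const c + (\<Sum>l\<in>?J. \<iota> (- (mps_var l ^ Suc s)) * \<tau> l)"
    by (simp only: to_fract_eq_iff)
  define a where "a l = (if l = i then 0 else s)" for l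
  have P: "?P = mps_monom a" unfolding prod_mps_var_power by (rule arg_cong[of _ _ mps_monom]) (auto simp: a_def)
  have "mps_nth (\<iota> ?P * mps_const c) a = c"
    by (subst mult.commute) (simp add: P mps_map.rep_eq mps_monom.rep_eq)
  moreover have "mps_nth (\<iota> (- (mps_var l ^ Suc s)) * \<tau> l) a = 0" if "l \<in> ?J" for l
  proof -
    have "\<iota> (mps_var l) = mps_var l" by (rule mps_eqI) (simp add: mps_map.rep_eq mps_var.rep_eq)
    then have "\<iota> (- (mps_var l ^ Suc s)) * \<tau> l = - (mps_var l ^ Suc s * \<tau> l)"
      by (simp add: \<iota>.hom_uminus \<iota>.hom_power \<iota>.hom_mult)
    then show ?thesis using mps_nth_var_power_mult[of l "Suc s" "\<tau> l" a] that
      by (simp add: uminus_mps.rep_eq a_def del: power_Suc)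
  qed
  moreover have "mps_nth (mps_var i * \<rho>) a = 0"
    using mps_var_dvd_iff[of i "mps_var i * \<rho>"] by (simp add: a_def)
  ultimately show False using c0 unfolding eq by (simp add: plus_mps.rep_eq)
qed

end

section \<open>Differentials and local cohomology\<close>

context module
begin

lemma quotient_module_coset:
  assumes N: "submodule N R M"
  shows "carrier (quotient_module M N) = (\<lambda>u. N +>\<^bsub>M\<^esub> u) ` carrier M"
    and "u \<in> carrier M \<Longrightarrow> v \<in> carrier M \<Longrightarrow>
      (N +>\<^bsub>M\<^esub> u) \<oplus>\<^bsub>quotient_module M N\<^esub> (N +>\<^bsub>M\<^esub> v) = N +>\<^bsub>M\<^esub> (u \<oplus>\<^bsub>M\<^esub> v)"
    and "a \<in> carrier R \<Longrightarrow> u \<in> carrier M \<Longrightarrow>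
      a \<odot>\<^bsub>quotient_module M N\<^esub> (N +>\<^bsub>M\<^esub> u) = N +>\<^bsub>M\<^esub> (a \<odot>\<^bsub>M\<^esub> u)"
    and "u \<in> carrier M \<Longrightarrow> v \<in> carrier M \<Longrightarrow> N +>\<^bsub>M\<^esub> u = N +>\<^bsub>M\<^esub> v \<Longrightarrow> u \<ominus>\<^bsub>M\<^esub> v \<in> N"
proof -
  have sg: "subgroup N (add_monoid M)" using N by (rule submodule.axioms(1))
  interpret N: abelian_subgroup N M
    by (rule abelian_subgroupI3[OF additive_subgroupI[OF sg]]) (rule M.abelian_group_axioms)
  show "carrier (quotient_module M N) = (\<lambda>u. N +>\<^bsub>M\<^esub> u) ` carrier M"
    by (auto simp: quotient_module_def A_RCOSETS_def')
  show "(N +>\<^bsub>M\<^esub> u) \<oplus>\<^bsub>quotient_module M N\<^esub> (N +>\<^bsub>M\<^esub> v) = N +>\<^bsub>M\<^esub> (u \<oplus>\<^bsub>M\<^esub> v)"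
    if "u \<in> carrier M" "v \<in> carrier M"
    using N.a_rcos_sum[OF that] by (simp add: quotient_module_def)
  show "a \<odot>\<^bsub>quotient_module M N\<^esub> (N +>\<^bsub>M\<^esub> u) = N +>\<^bsub>M\<^esub> (a \<odot>\<^bsub>M\<^esub> u)"
    if a: "a \<in> carrier R" and u: "u \<in> carrier M"
  proof -
    have "N +>\<^bsub>M\<^esub> (a \<odot>\<^bsub>M\<^esub> x) = N +>\<^bsub>M\<^esub> (a \<odot>\<^bsub>M\<^esub> u)" if x: "x \<in> N +>\<^bsub>M\<^esub> u" for x
    proof -
      obtain n where n: "n \<in> N" "x = n \<oplus>\<^bsub>M\<^esub> u" using x by (auto simp: a_r_coset_def')
      have "n \<in> carrier M" using n(1) N.a_subset by blast
      then have "a \<odot>\<^bsub>M\<^esub> x = (a \<odot>\<^bsub>M\<^esub> n) \<oplus>\<^bsub>M\<^esub> (a \<odot>\<^bsub>M\<^esub> u)" using n(2) a u smult_r_distr by simp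
      moreover have "a \<odot>\<^bsub>M\<^esub> n \<in> N" using submodule.smult_closed[OF N] a n(1) by blast
      ultimately have "a \<odot>\<^bsub>M\<^esub> x \<in> N +>\<^bsub>M\<^esub> (a \<odot>\<^bsub>M\<^esub> u)" by (auto simp: a_r_coset_def')
      then show ?thesis using M.a_repr_independence[OF _ smult_closed[OF a u] sg] by blast
    qed
    moreover have "N +>\<^bsub>M\<^esub> u \<noteq> {}" using M.a_rcosI[OF N.zero_closed N.a_subset u] by blast
    ultimately have "(\<Union>x\<in>N +>\<^bsub>M\<^esub> u. N +>\<^bsub>M\<^esub> (a \<odot>\<^bsub>M\<^esub> x)) = N +>\<^bsub>M\<^esub> (a \<odot>\<^bsub>M\<^esub> u)"
      by (intro SUP_eq_const)
    then show ?thesis by (simp add: quotient_module_def)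
  qed
  show "u \<ominus>\<^bsub>M\<^esub> v \<in> N" if uv: "u \<in> carrier M" "v \<in> carrier M" and eq: "N +>\<^bsub>M\<^esub> u = N +>\<^bsub>M\<^esub> v"
  proof -
    have "N +>\<^bsub>M\<^esub> (u \<oplus>\<^bsub>M\<^esub> \<ominus>\<^bsub>M\<^esub> v) = N" using M.a_coset_add_inv2[OF eq uv N.a_subset] .
    then show ?thesis unfolding a_minus_def using M.a_coset_join1 uv sg by blast
  qed
qed

lemma submodule_submodule_generated:
  assumes "S \<subseteq> carrier M"
  shows "submodule (submodule_generated R M S) R M"
proof (rule submoduleI)
  show "submodule_generated R M S \<subseteq> carrier M"
    unfolding submodule_generated_def using carrier_is_submodule assms by blast
qed (auto simp: submodule_generated_def intro: submoduleE additive_subgroup.zero_closed[OF additive_subgroupI] submodule.axioms(1))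

end

section \<open>Kaehler differentials as cosets of formal differentials\<close>

context differential_trace
begin

abbreviation Br :: "'l ring" where "Br \<equiv> ring_of_type_algebra\<lparr>carrier := IC\<rparr>"

lemma Br_simps [simp]:
  "carrier Br = IC" "\<zero>\<^bsub>Br\<^esub> = 0" "\<one>\<^bsub>Br\<^esub> = 1" "a \<oplus>\<^bsub>Br\<^esub> b = a + b" "a \<otimes>\<^bsub>Br\<^esub> b = a * b"
  by (simp_all add: ring_of_type_algebra_def)

lemma cring_Br: "cring Br"
proof (rule cringI)
  show "abelian_group Br"
  proof (rule abelian_groupI)
    fix x assume "x \<in> carrier Br"
    then show "\<exists>y\<in>carrier Br. y \<oplus>\<^bsub>Br\<^esub> x = \<zero>\<^bsub>Br\<^esub>" by (intro bexI[of _ "- x"]) (simp_all add: IC_uminus)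
  qed (simp_all add: IC_0 IC_add add_ac)
  show "Group.comm_monoid Br" by (rule comm_monoidI) (simp_all add: IC_1 IC_mult mult_ac)
qed (simp add: distrib_right)

abbreviation F where "F \<equiv> free_module Br IC"

lemma F_simps [simp]:
  "carrier F = Collect admissible" "\<zero>\<^bsub>F\<^esub> = (\<lambda>c. 0)" "u \<oplus>\<^bsub>F\<^esub> v = (\<lambda>c. u c + v c)" "a \<odot>\<^bsub>F\<^esub> v = (\<lambda>c. a * v c)"
proof -
  have "carrier F = {v. (\<forall>s\<in>IC. v s \<in> IC) \<and> (\<forall>s. s \<notin> IC \<longrightarrow> v s = 0) \<and> finite {s. v s \<noteq> 0}}"
    by (simp add: free_module_def)
  also have "\<dots> = Collect admissible"
    unfolding admissible_def using IC_0 by (intro Collect_cong) metis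
  finally show "carrier F = Collect admissible" .
qed (simp_all add: free_module_def)

lemma admissible_0: "admissible (\<lambda>c. 0)" by (simp add: admissible_def IC_0)

lemma admissible_finite: "admissible v \<Longrightarrow> finite {c. v c \<noteq> 0}" by (simp add: admissible_def)

lemma admissible_add:
  assumes "admissible u" "admissible v" shows "admissible (\<lambda>c. u c + v c)"
proof -
  have "{c. u c + v c \<noteq> 0} \<subseteq> {c. u c \<noteq> 0} \<union> {c. v c \<noteq> 0}" by auto
  then have "finite {c. u c + v c \<noteq> 0}" by (rule finite_subset) (use assms admissible_finite in simp)
  then show ?thesis using assms by (auto simp: admissible_def IC_add)
qed

lemma admissible_smult: assumes "admissible v" "a \<in> IC" shows "admissible (\<lambda>c. a * v c)"
proof -
  have "{c. a * v c \<noteq> 0} \<subseteq> {c. v c \<noteq> 0}" by auto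
  then have "finite {c. a * v c \<noteq> 0}" by (rule finite_subset) (use assms(1) admissible_finite in simp)
  then show ?thesis using assms by (auto simp: admissible_def IC_mult)
qed

lemma admissible_uminus: "admissible v \<Longrightarrow> admissible (\<lambda>c. - v c)"
  by (auto simp: admissible_def IC_uminus)

lemma admissible_sum: "(\<And>l. l \<in> S \<Longrightarrow> admissible (v l)) \<Longrightarrow> admissible (\<lambda>c. \<Sum>l\<in>S. v l c)"
  by (induction S rule: infinite_finite_induct) (simp_all add: admissible_0 admissible_add)

lemma dl_sum: "(\<And>l. l \<in> S \<Longrightarrow> admissible (v l)) \<Longrightarrow> dl j (\<lambda>c. \<Sum>l\<in>S. v l c) = (\<Sum>l\<in>S. dl j (v l))"
proof (induction S rule: infinite_finite_induct)
  case (insert l S)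
  then show ?case using dl_add[of "v l" "\<lambda>c. \<Sum>l\<in>S. v l c" j] by (simp add: admissible_finite admissible_sum)
qed simp_all

lemma module_F: "module Br F"
proof (rule moduleI[OF cring_Br])
  show "abelian_group F"
  proof (rule abelian_groupI)
    fix v assume "v \<in> carrier F"
    then show "\<exists>u\<in>carrier F. u \<oplus>\<^bsub>F\<^esub> v = \<zero>\<^bsub>F\<^esub>"
      by (intro bexI[of _ "\<lambda>c. - v c"]) (simp_all add: admissible_uminus)
  qed (auto simp: admissible_0 admissible_add add_ac)
qed (auto simp: admissible_smult algebra_simps)

sublocale F: module Br F by (rule module_F)

lemma a_inv_F: "admissible v \<Longrightarrow> \<ominus>\<^bsub>F\<^esub> v = (\<lambda>c. - v c)"
  by (rule F.minus_equality) (simp_all add: admissible_uminus)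

lemma minus_F: "admissible v \<Longrightarrow> u \<ominus>\<^bsub>F\<^esub> v = (\<lambda>c. u c - v c)"
  by (simp add: a_minus_def a_inv_F)

definition db :: "'l \<Rightarrow> 'l \<Rightarrow> 'l" where "db b = (\<lambda>c. if c = b then 1 else 0)"

lemma free_basis_Br: "free_basis Br b = db b" unfolding free_basis_def db_def Br_simps ..

lemma admissible_db: "b \<in> IC \<Longrightarrow> admissible (db b)" by (auto simp: admissible_def db_def IC_0 IC_1)

lemma dl_db: "dl j (db b) = ld j b" unfolding db_def by (rule dl_basis)

lemma kaehler_relations_eq:
  "kaehler_relations rta Br \<phi> =
     {(\<lambda>c. db (a + b) c - (db a c + db b c)) | a b. a \<in> IC \<and> b \<in> IC} \<union>
     {(\<lambda>c. db (a * b) c - (a * db b c + b * db a c)) | a b. a \<in> IC \<and> b \<in> IC} \<union> {db (\<phi> r) | r. True}"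
proof -
  have 1: "db (a + b) \<ominus>\<^bsub>F\<^esub> (db a \<oplus>\<^bsub>F\<^esub> db b) = (\<lambda>c. db (a + b) c - (db a c + db b c))"
    if "a \<in> IC" "b \<in> IC" for a b
    using that by (simp add: minus_F admissible_add admissible_db)
  have 2: "db (a * b) \<ominus>\<^bsub>F\<^esub> (a \<odot>\<^bsub>F\<^esub> db b \<oplus>\<^bsub>F\<^esub> b \<odot>\<^bsub>F\<^esub> db a) = (\<lambda>c. db (a * b) c - (a * db b c + b * db a c))"
    if "a \<in> IC" "b \<in> IC" for a b
    using that by (simp add: minus_F admissible_add admissible_smult admissible_db)
  show ?thesis
    unfolding kaehler_relations_def Let_def free_basis_Br Br_simps rta_simps
    by (intro arg_cong2[of _ _ _ _ "(\<union>)"] Collect_cong ex_cong1) (auto simp: 1 2 simp del: F_simps)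
qed

definition relations where "relations = submodule_generated Br F (kaehler_relations rta Br \<phi>)"

abbreviation \<Omega> :: "(('n, 'k) mps, ('l \<Rightarrow> 'l) set) module" where
  "\<Omega> \<equiv> restrict_scalars \<phi> (kaehler_differentials rta Br \<phi>)"

definition cl where "cl u = relations +>\<^bsub>F\<^esub> u"

lemma admissible_diff: "admissible u \<Longrightarrow> admissible v \<Longrightarrow> admissible (\<lambda>c. u c - v c)"
  using admissible_add[of u "\<lambda>c. - v c"] admissible_uminus[of v] by simp

lemma kaehler_relations_admissible: "kaehler_relations rta Br \<phi> \<subseteq> carrier F"
  unfolding kaehler_relations_eq
  by (auto intro!: admissible_diff admissible_add admissible_smult admissible_db IC_add IC_mult IC_\<phi>)

lemma submodule_relations: "submodule relations Br F"
  unfolding relations_def by (rule F.submodule_submodule_generated[OF kaehler_relations_admissible])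

lemma \<Omega>_simps:
  "carrier \<Omega> = cl ` Collect admissible"
  "admissible u \<Longrightarrow> admissible v \<Longrightarrow> cl u \<oplus>\<^bsub>\<Omega>\<^esub> cl v = cl (\<lambda>c. u c + v c)"
  "admissible u \<Longrightarrow> r \<odot>\<^bsub>\<Omega>\<^esub> cl u = cl (\<lambda>c. \<phi> r * u c)"
  "admissible u \<Longrightarrow> admissible v \<Longrightarrow> cl u = cl v \<Longrightarrow> (\<lambda>c. u c - v c) \<in> relations"
  using F.quotient_module_coset[OF submodule_relations]
  by (simp_all add: restrict_scalars_def kaehler_differentials_def cl_def minus_F IC_\<phi> flip: relations_def)

end

section \<open>Nonvanishing of the top local cohomology\<close>

context square_root
begin

text \<open>The admissible elements with negligible image form a submodule of the free module.
  Additivity and the Leibniz rule have image 0, since each \<open>ld j\<close> is a derivation; the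
  differentials of elements of \<open>R\<close> are covered by
  \<open>negligible_\<phi>\<close>.\<close>

lemma relations_negligible: "v \<in> relations \<Longrightarrow> negligible (\<lambda>j. dl j v)"
proof -
  let ?N = "{v. admissible v \<and> negligible (\<lambda>j. dl j v)}"
  have "submodule ?N Br F"
  proof (rule F.submoduleI)
    fix v assume "v \<in> ?N"
    then show "\<ominus>\<^bsub>F\<^esub> v \<in> ?N"
      using negligible_smult[of "\<lambda>j. dl j v" "- 1"] dl_smult[OF admissible_finite, of v _ "- 1"] IC_uminus[OF IC_1]
      by (simp add: a_inv_F admissible_uminus)
  next
    fix u v assume "u \<in> ?N" "v \<in> ?N"
    then show "u \<oplus>\<^bsub>F\<^esub> v \<in> ?N" using negligible_add by (simp add: admissible_add dl_add admissible_finite)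
  next
    fix a v assume "a \<in> carrier Br" "v \<in> ?N"
    then show "a \<odot>\<^bsub>F\<^esub> v \<in> ?N" using negligible_smult by (simp add: admissible_smult dl_smult admissible_finite)
  qed (auto simp: admissible_0 negligible_0)
  moreover have "kaehler_relations rta Br \<phi> \<subseteq> ?N"
  proof
    fix v assume v: "v \<in> kaehler_relations rta Br \<phi>"
    have "negligible (\<lambda>j. dl j v)"
      using v unfolding kaehler_relations_eq
    proof (elim UnE CollectE exE conjE)
      fix a b assume v: "v = (\<lambda>c. db (a + b) c - (db a c + db b c))" and "a \<in> IC" "b \<in> IC"
      then have "dl j v = 0" for j
        by (simp add: dl_diff dl_add dl_db admissible_finite admissible_add admissible_db IC_add derivation_alongD[OF derivation_along_ld])
      then show ?thesis using negligible_0 by simp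
    next
      fix a b assume v: "v = (\<lambda>c. db (a * b) c - (a * db b c + b * db a c))" and "a \<in> IC" "b \<in> IC"
      then have "dl j v = 0" for j
        by (simp add: dl_diff dl_add dl_smult dl_db admissible_finite admissible_smult admissible_add admissible_db IC_mult derivation_alongD[OF derivation_along_ld])
      then show ?thesis using negligible_0 by simp
    next
      fix r assume "v = db (\<phi> r)"
      then show ?thesis using negligible_\<phi>[of r] by (simp add: dl_db)
    qed
    then show "v \<in> ?N" using v kaehler_relations_admissible by auto
  qed
  ultimately have "relations \<subseteq> ?N" unfolding relations_def submodule_generated_def by blast
  then show "v \<in> relations \<Longrightarrow> negligible (\<lambda>j. dl j v)" by blast
qed

text \<open>The image of \<open>dy\<close> is the starting class of \<open>top_class\<close>: an
  expression of its multiple through \<open>Sm\<close> would be an identity in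
  \<open>\<Omega>\<close> that \<open>trace_obstruction\<close> excludes, and injectivity of the
  terms of the resolution provides the divisions.\<close>

theorem local_cohomology_nonzero:
  fixes \<epsilon> :: "('l \<Rightarrow> 'l) set \<Rightarrow> 'e" and E :: "nat \<Rightarrow> (('n, 'k) mps, 'e) module"
  assumes res: "injective_resolution rta \<Omega> \<epsilon> E d"
  defines "H \<equiv> local_cohomology rta (Idl\<^bsub>rta\<^esub> {mps_var j | j. j \<noteq> i}) E d (CARD('n) - 1)"
  shows "carrier H \<noteq> {\<zero>\<^bsub>H\<^esub>}"
proof -
  have inj: "injective_module rta (E q)" for q using res by (simp add: injective_resolution_def)
  interpret resolution_complex E d
    by (rule resolution_complex.intro) (use res in \<open>simp_all add: injective_resolution_def injective_module_def\<close>)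
  let ?J = "UNIV - {i}"
  let ?I = "Idl\<^bsub>rta\<^esub> {mps_var j | j. j \<in> ?J} :: ('n, 'k) mps set"
  obtain js where js: "distinct js" "set js = ?J" using finite_distinct_list[of ?J] by auto
  define xs where "xs = (map mps_var js :: ('n, 'k) mps list)"
  have len: "length xs = CARD('n) - 1" using js by (simp add: xs_def distinct_card[symmetric])
  have tor: "torsion_part rta ?I (E q) = G xs q" for q
    using torsion_part_iff[OF mod, of _ ?J q] js by (auto simp: G_def kills_def xs_def)
  have \<epsilon>: "\<epsilon> \<in> linear_maps rta \<Omega> (E 0)" "inj_on \<epsilon> (carrier \<Omega>)" "\<epsilon> ` carrier \<Omega> = a_kernel (E 0) (E 1) (d 0)"
    using res by (simp_all add: injective_resolution_def)
  have \<epsilon>C: "\<epsilon> (cl u) \<in> C 0" if "admissible u" for u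
    using \<epsilon>(1) that by (auto simp: linear_maps_def \<Omega>_simps)
  have \<epsilon>_pl: "pl 0 (\<epsilon> (cl u)) (\<epsilon> (cl v)) = \<epsilon> (cl (\<lambda>c. u c + v c))" if "admissible u" "admissible v" for u v
  proof -
    have "\<epsilon> (cl u \<oplus>\<^bsub>\<Omega>\<^esub> cl v) = pl 0 (\<epsilon> (cl u)) (\<epsilon> (cl v))"
      using \<epsilon>(1) that unfolding linear_maps_def \<Omega>_simps(1) by blast
    then show ?thesis using that by (simp add: \<Omega>_simps)
  qed
  have \<epsilon>_sm: "sm 0 r (\<epsilon> (cl u)) = \<epsilon> (cl (\<lambda>c. \<phi> r * u c))" if "admissible u" for r u
  proof -
    have "\<epsilon> (r \<odot>\<^bsub>\<Omega>\<^esub> cl u) = sm 0 r (\<epsilon> (cl u))"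
      using \<epsilon>(1) that unfolding linear_maps_def \<Omega>_simps(1) rta_simps by blast
    then show ?thesis using that by (simp add: \<Omega>_simps)
  qed
  have \<epsilon>_ze: "\<epsilon> (cl (\<lambda>c. 0)) = ze 0"
    using \<epsilon>_sm[OF admissible_0, of 0] module.smult_l_null[OF mod \<epsilon>C[OF admissible_0]] by simp
  have Z0: "Z [] 0 = \<epsilon> ` cl ` Collect admissible"
    using \<epsilon>(3) by (auto simp: Z_def G_def kills_def a_kernel_def' \<Omega>_simps)
  \<comment> \<open>In degree 0, before any torsion is imposed, cocycles are images of
    differentials, so elements of \<open>Sm\<close> unfold to combinations of formal differentials
    \<open>v l\<close> with coefficients \<open>X\<^sub>l\<^sup>n\<close>.\<close>
  have Sm0: "\<exists>v. (\<forall>l\<in>set ls. admissible (v l)) \<and> r = \<epsilon> (cl (\<lambda>c. \<Sum>l\<in>set ls. \<phi> (mps_var l ^ n) * v l c))"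
    if "distinct ls" "r \<in> Sm [] 0 n (map mps_var ls)" for ls r n
    using that
  proof (induction ls arbitrary: r)
    case Nil
    then show ?case by (simp add: Bd_def \<epsilon>_ze)
  next
    case (Cons l ls)
    then obtain \<eta> r' where r: "r = pl 0 (sm 0 (mps_var l ^ n) \<eta>) r'" "\<eta> \<in> Z [] 0" "r' \<in> Sm [] 0 n (map mps_var ls)" by auto
    obtain u where u: "admissible u" "\<eta> = \<epsilon> (cl u)" using r(2) Z0 by auto
    obtain v where v: "\<forall>l\<in>set ls. admissible (v l)" "r' = \<epsilon> (cl (\<lambda>c. \<Sum>l\<in>set ls. \<phi> (mps_var l ^ n) * v l c))"
      using Cons.IH[OF _ r(3)] Cons.prems(1) by auto
    have l: "l \<notin> set ls" using Cons.prems(1) by simp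
    define v' where "v' = v(l := u)"
    have "(\<Sum>l\<in>set (l # ls). \<phi> (mps_var l ^ n) * v' l c) = \<phi> (mps_var l ^ n) * u c + (\<Sum>l\<in>set ls. \<phi> (mps_var l ^ n) * v l c)" for c
    proof -
      have "(\<Sum>l\<in>set ls. \<phi> (mps_var l ^ n) * v' l c) = (\<Sum>l\<in>set ls. \<phi> (mps_var l ^ n) * v l c)"
        using l by (intro sum.cong) (auto simp: v'_def)
      then show ?thesis using l by (simp add: v'_def)
    qed
    moreover have "admissible (\<lambda>c. \<Sum>l\<in>set ls. \<phi> (mps_var l ^ n) * v l c)"
      using v(1) by (intro admissible_sum admissible_smult IC_\<phi>) auto
    then have "r = \<epsilon> (cl (\<lambda>c. \<phi> (mps_var l ^ n) * u c + (\<Sum>l\<in>set ls. \<phi> (mps_var l ^ n) * v l c)))"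
      unfolding r(1) u(2) v(2) \<epsilon>_sm[OF u(1)] using u(1) by (intro \<epsilon>_pl admissible_smult IC_\<phi>)
    moreover have "\<forall>l'\<in>set (l # ls). admissible (v' l')" using u(1) v(1) by (auto simp: v'_def)
    ultimately show ?case by (intro exI[of _ v']) simp
  qed
  define \<zeta> where "\<zeta> = \<epsilon> (cl (db y))"
  have "\<zeta> \<in> Z [] 0" unfolding Z0 \<zeta>_def using admissible_db[OF y(2)] by blast
  moreover have "sm 0 (prod_list xs ^ s) \<zeta> \<notin> Sm [] 0 (Suc s) xs" for s
  proof
    assume "sm 0 (prod_list xs ^ s) \<zeta> \<in> Sm [] 0 (Suc s) xs"
    then obtain v where v: "\<forall>l\<in>?J. admissible (v l)"
      and eq: "sm 0 (prod_list xs ^ s) \<zeta> = \<epsilon> (cl (\<lambda>c. \<Sum>l\<in>?J. \<phi> (mps_var l ^ Suc s) * v l c))"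
      using Sm0[OF js(1)] unfolding xs_def js(2) by blast
    let ?P = "\<Prod>l\<in>?J. mps_var l ^ s :: ('n, 'k) mps"
    let ?u = "\<lambda>c. \<phi> ?P * db y c" and ?w = "\<lambda>c. \<Sum>l\<in>?J. \<phi> (mps_var l ^ Suc s) * v l c"
    have "prod_list xs = (\<Prod>l\<in>?J. mps_var l)" unfolding xs_def using js prod.distinct_set_conv_list[of js "mps_var :: 'n \<Rightarrow> ('n, 'k) mps"] by simp
    then have P: "prod_list xs ^ s = ?P" by (simp add: prod_power_distrib)
    have u: "admissible ?u" by (intro admissible_smult admissible_db y IC_\<phi>)
    have wl: "admissible (\<lambda>c. \<phi> (mps_var l ^ Suc s) * v l c)" if "l \<in> ?J" for l
      using v that by (intro admissible_smult IC_\<phi>) auto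
    have w: "admissible ?w" by (rule admissible_sum[OF wl])
    have "\<epsilon> (cl ?u) = \<epsilon> (cl ?w)" using eq unfolding \<zeta>_def \<epsilon>_sm[OF admissible_db[OF y(2)]] P .
    then have "cl ?u = cl ?w"
    proof (rule inj_onD[OF \<epsilon>(2)])
      show "cl ?u \<in> carrier \<Omega>" "cl ?w \<in> carrier \<Omega>"
        unfolding \<Omega>_simps(1) using u w by (blast intro: imageI)+
    qed
    then have "negligible (\<lambda>j. dl j (\<lambda>c. ?u c - ?w c))" using relations_negligible \<Omega>_simps(4)[OF u w] by blast
    moreover have "dl j (\<lambda>c. ?u c - ?w c) = \<phi> ?P * ld j y - (\<Sum>l\<in>?J. \<phi> (mps_var l ^ Suc s) * dl j (v l))" for j
    proof -
      have "dl j ?w = (\<Sum>l\<in>?J. \<phi> (mps_var l ^ Suc s) * dl j (v l))"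
        using v by (subst dl_sum[OF wl]) (auto intro!: sum.cong dl_smult admissible_finite)
      moreover have "dl j ?u = \<phi> ?P * ld j y" using admissible_db[OF y(2)] by (subst dl_smult) (auto intro: admissible_finite simp: dl_db)
      ultimately show ?thesis using dl_diff[OF admissible_finite[OF u] admissible_finite[OF w], of j] by simp
    qed
    ultimately show False using trace_obstruction[of v s] v by simp
  qed
  \<comment> \<open>The indices are distinct, so the divisor is a variable different from those
    whose torsion must be preserved.\<close>
  moreover have "\<exists>e'\<in>C q. sm q (x ^ s) e' = e \<and> kills ys q t e'"
    if xs: "xs = ys @ x # zs" and e: "e \<in> C q" "kills ys q t e" for ys x zs q e t s
  proof -
    obtain js1 j js2 where j: "js = js1 @ j # js2" "ys = map mps_var js1" "x = mps_var j"
      using xs unfolding xs_def by (auto simp: map_eq_append_conv map_eq_Cons_conv)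
    have "j \<notin> set js1" using js(1) j(1) by simp
    from injective_module_divisible[OF inj this e(1), of t s] e(2)
    show ?thesis by (auto simp: j kills_def)
  qed
  ultimately obtain \<xi> where \<xi>: "\<xi> \<in> Z xs (length xs)" "\<xi> \<notin> Bd xs (length xs)" using top_class[of xs \<zeta>] by blast
  let ?q = "CARD('n) - 1"
  let ?M = "(E ?q)\<lparr>carrier := Z xs ?q\<rparr>"
  have HZ: "H = quotient_module ?M (Bd xs ?q)"
  proof -
    have J: "{mps_var j | j. j \<noteq> i} = ({mps_var j | j. j \<in> ?J} :: ('n, 'k) mps set)" by auto
    have Z: "G xs q \<inter> a_kernel (E q) (E (Suc q)) (d q) = Z xs q" for q
      by (auto simp: Z_def a_kernel_def' G_C)
    have Bd: "(case q of 0 \<Rightarrow> {ze 0} | Suc p \<Rightarrow> d p ` G xs p) = Bd xs q" for q by (simp add: Bd_def)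
    show ?thesis unfolding H_def local_cohomology_def J tor Z Bd ..
  qed
  \<comment> \<open>This coset contains \<open>\<xi>\<close>, while the zero coset \<open>Bd\<close>
    does not.\<close>
  have "Bd xs ?q +>\<^bsub>?M\<^esub> \<xi> \<in> carrier H"
    using \<xi>(1) unfolding HZ len by (auto simp: quotient_module_def A_RCOSETS_def')
  moreover have "\<zero>\<^bsub>H\<^esub> = Bd xs ?q" by (simp add: HZ quotient_module_def)
  moreover have "\<xi> \<in> Bd xs ?q +>\<^bsub>?M\<^esub> \<xi>"
    using Bd_ze[of ?q xs] Z_C[OF \<xi>(1)] unfolding len by (force simp: a_r_coset_def')
  ultimately show ?thesis using \<xi>(2) unfolding len by auto
qed

end

section \<open>Generic coordinates\<close>

lemma field_hom_fract_const: "field_hom (\<lambda>c. to_fract (mps_const c) :: ('n::finite, 'k::field_char_0) mps fract)"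
proof -
  interpret mc: comm_ring_hom "mps_const :: 'k \<Rightarrow> ('n, 'k) mps" by (rule comm_ring_hom_mps_const)
  show ?thesis by unfold_locales (simp_all add: mc.hom_add mc.hom_mult)
qed

text \<open>The variables themselves serve as \<open>Y\<close>, in the fraction field of a second
  copy of the power series ring, used as coefficient field. A form evaluated at them is that form
  again, so its vanishing kills all its coefficients.\<close>

lemma generic_direction_fract:
  "generic_direction (\<lambda>c. to_fract (mps_const c)) (\<lambda>j. to_fract (mps_var j) :: ('n::finite, 'k::field_char_0) mps fract)"
proof (intro generic_direction.intro generic_direction_axioms.intro)
  show "field_hom (\<lambda>c. to_fract (mps_const c) :: ('n, 'k) mps fract)" by (rule field_hom_fract_const)
next
  fix d w and a :: "'n \<Rightarrow> nat"
  assume 0: "mps_at (\<lambda>j. to_fract (mps_var j) :: ('n, 'k) mps fract) d (mps_map (\<lambda>c. to_fract (mps_const c)) w) = 0"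
    and a: "mdeg a = d"
  interpret tf: comm_ring_hom "to_fract :: ('n, 'k) mps \<Rightarrow> _" by unfold_locales simp_all
  have "(\<Prod>j\<in>UNIV. to_fract (mps_var j) ^ b j) = (to_fract (mps_monom b) :: ('n, 'k) mps fract)" for b
    using prod_mps_var_power[of b UNIV] by (simp flip: tf.hom_power tf.hom_prod)
  then have "to_fract (\<Sum>b | mdeg b = d. mps_const (mps_nth w b) * mps_monom b :: ('n, 'k) mps) = 0"
    using 0 by (simp add: mps_at_def mps_map.rep_eq)
  then have "(\<Sum>b | mdeg b = d. mps_const (mps_nth w b) * mps_monom b :: ('n, 'k) mps) = 0"
    by (simp only: to_fract_eq_0_iff)
  then have "mps_nth (\<Sum>b | mdeg b = d. mps_const (mps_nth w b) * mps_monom b :: ('n, 'k) mps) a = 0"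
    by (simp add: zero_mps.rep_eq)
  then have "(\<Sum>b | mdeg b = d. if a = b then mps_nth w b else 0) = 0"
    by (simp add: mps_monom.rep_eq if_distrib cong: if_cong)
  then show "mps_nth w a = 0" using a by (simp add: finite_mdeg)
qed

theorem theorem2p2:
  fixes h :: "('n::finite, 'k::field_char_0) mps fract \<Rightarrow> 'l::field"
    and i :: 'n
    and \<epsilon> :: "('l \<Rightarrow> 'l) set \<Rightarrow> 'e"
    and E :: "nat \<Rightarrow> (('n, 'k) mps, 'e) module"
    and d :: "nat \<Rightarrow> 'e \<Rightarrow> 'e"
  defines "R \<equiv> (ring_of_type_algebra :: ('n, 'k) mps ring)"
    and "\<phi> \<equiv> (\<lambda>r. h (to_fract r))"
  defines "B \<equiv> (ring_of_type_algebra :: 'l ring)\<lparr>carrier := integral_closure \<phi>\<rparr>"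
    and "I \<equiv> Idl\<^bsub>R\<^esub> {mps_var j | j. j \<noteq> i}"
  defines "\<Omega> \<equiv> restrict_scalars \<phi> (kaehler_differentials R B \<phi>)"
    and "H \<equiv> local_cohomology R I E d (CARD('n) - 1)"
  assumes "algebraic_extension h"
    and "\<exists>y\<in>carrier B. y ^ 2 = \<phi> (mps_var i)"
    and "injective_resolution R \<Omega> \<epsilon> E d"
  shows "carrier H \<noteq> {\<zero>\<^bsub>H\<^esub>}"
proof -
  obtain y where y: "y \<in> integral_closure \<phi>" "y ^ 2 = \<phi> (mps_var i)" using assms(8) by (auto simp: B_def)
  have h: "h \<in> Ring.ring_hom rta rta" and alg: "\<And>x. \<exists>p. p \<noteq> 0 \<and> poly (map_poly h p) x = 0"
    using assms(7) by (simp_all add: algebraic_extension_def)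
  have h_add: "h (a + b) = h a + h b" and h_mult: "h (a * b) = h a * h b" and h_1: "h 1 = 1" for a b
    using ring_hom_add[OF h, of a b] ring_hom_mult[OF h, of a b] ring_hom_one[OF h] by simp_all
  \<comment> \<open>Membership in \<open>ring_hom\<close> gives sums, products and one; preservation
    of zero follows by cancellation.\<close>
  have "h 0 + 0 = h 0 + h 0" using h_add[of 0 0] by (simp only: add_0_right)
  then have "h 0 = 0" by (simp only: add_left_cancel)
  then have "field_hom h" by unfold_locales (simp_all add: h_add h_mult h_1)
  then have ae: "alg_ext h" using alg by (intro alg_ext.intro alg_ext_axioms.intro)
  interpret D: differential_trace "\<lambda>c. to_fract (mps_const c) :: ('n, 'k) mps fract" "\<lambda>j. to_fract (mps_var j)" h
    by (rule differential_trace.intro[OF generic_direction_fract ae])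
  have \<phi>: "D.\<phi> = \<phi>" by (simp add: fun_eq_iff D.\<phi>_def \<phi>_def)
  have "mps_nth (mps_var i :: ('n, 'k) mps) (\<lambda>j. if j = i then 1 else 0) \<noteq> 0" by (simp add: mps_var.rep_eq)
  then have "mps_var i \<noteq> (0 :: ('n, 'k) mps)" by (metis zero_mps.rep_eq)
  then interpret square_root "\<lambda>c. to_fract (mps_const c) :: ('n, 'k) mps fract" "\<lambda>j. to_fract (mps_var j)" h y i
    by unfold_locales (simp_all add: \<phi> y)
  show ?thesis
    using local_cohomology_nonzero[of \<epsilon> E d] assms(9) unfolding \<phi> H_def I_def \<Omega>_def B_def R_def by blast
qed

end
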